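(* Let $G$ be a finite group, $C_2^n=\langle x_1\rangle\times\cdots\times\langle x_n\rangle$ an elementary abelian $2$-group of rank $n$, and $[\alpha]\in H^2(G\times C_2^n,\mathbb{Z}^* )$ a class inflated from $H^2(G,\mathbb{Z}^* )$. Then, for all $2\le i\le n$, $K_i$ is an iterated internal semidirect product $$K_i=\overrightarrow{\rtimes}_{\vec{j}\in\{0,1\}^{i-1}}K_{\vec{j}}$$ with respect to a specific ordering of $\{0,1\}^{i-1}$, and $K_{\vec{j}}\cong U_{1+\sum_{t=1}^{i-1}j_t}$ for $\vec{j}=(j_1,\ldots,j_{i-1})\in\{0,1\}^{i-1}$. Furthermore, $$\mathcal{U}(\mathbb{Z}^\alpha[G\times C_2^n])=K_n\rtimes\Big(K_{n-1}\rtimes\big(\cdots K_2\rtimes(K_1\rtimes\mathcal{U}(\mathbb{Z}^\alpha[G]))\big)\Big)$$ $$=\Big(\big((N_n\rtimes N_{n-1})\rtimes\cdots\big)\rtimes N_1\Big)\rtimes\big(\mathcal{U}(\mathbb{Z}^\alpha[G])\times\langle x_1,\ldots,x_n\rangle\big)$$ for some torsion-free normal subgroups $N_i$ of $K_i$ such that $K_i\cong N_i\times\langle x_i\rangle$.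
   Context: $\mathcal{U}(\cdot)$ is the unit group; $\mathbb{Z}^*=\{\pm1\}$ with trivial action; cocycles are normalized. $\mathbb{Z}^\alpha[H]$ is the twisted group ring: free $\mathbb{Z}$-module with basis $\{u_x\}_{x\in H}$, $u_xu_y=\alpha(x,y)u_{xy}$. The class is inflated along the projection $G\times C_2^n\to G$, so the elements $u_{x_i}$, written simply $x_i$, are central of order $2$. $C_2^i$ denotes the subgroup $\langle x_1,\ldots,x_i\rangle$, and $\mathbb{Z}^\alpha[G\times C_2^i]$ is the corresponding subring of $\mathbb{Z}^\alpha[G\times C_2^n]$. For $1\le i\le n$, $K_i$ is the kernel of the epimorphism $\mathcal{U}(\mathbb{Z}^\alpha[G\times C_2^i])\to\mathcal{U}(\mathbb{Z}^\alpha[G\times C_2^{i-1}])$ induced by the ring morphism $u+vx_i\mapsto u+v$ ($u,v\in\mathbb{Z}^\alpha[G\times C_2^{i-1}]$). For $i\ge1$, $$U_i=\{1+2^iu\mid u\in\mathbb{Z}^\alpha[G]\}\cap\mathcal{U}(\mathbb{Z}^\alpha[G]).$$ For $\vec{j}=(j_1,\ldots,j_{i-1})\in\{0,1\}^{i-1}$, $$K_{\vec{j}}=\{1+u(1-x_1)^{j_1}\cdots(1-x_{i-1})^{j_{i-1}}(1-x_i)\mid u\in\mathbb{Z}^\alpha[G]\}\cap\mathcal{U}(\mathbb{Z}^\alpha[G\times C_2^i]).$$ "Iterated internal semidirect product" means that, for a suitable ordering and bracketing of the factors, $K_i$ is obtained from the subgroups $K_{\vec{j}}$ by successively forming internal semidirect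 products. *)

theory Defs
  imports "HOL-Algebra.Product_Groups" "HOL-Algebra.Ring"
begin

section \<open>Cocycles with values in the units of the integers, with trivial action\<close>

definition normalized_cocycle :: "('h, 'c) monoid_scheme \<Rightarrow> ('h \<Rightarrow> 'h \<Rightarrow> int) \<Rightarrow> bool" where
  "normalized_cocycle H \<alpha> \<longleftrightarrow>
     (\<forall>x\<in>carrier H. \<forall>y\<in>carrier H. \<alpha> x y \<in> {1, -1}) \<and>
     (\<forall>x\<in>carrier H. \<forall>y\<in>carrier H. \<forall>z\<in>carrier H.
        \<alpha> x y * \<alpha> (x \<otimes>\<^bsub>H\<^esub> y) z = \<alpha> y z * \<alpha> x (y \<otimes>\<^bsub>H\<^esub> z)) \<and>
     (\<forall>x\<in>carrier H. \<alpha> \<one>\<^bsub>H\<^esub> x = 1 \<and> \<alpha> x \<one>\<^bsub>H\<^esub> = 1)"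

text \<open>\<open>\<alpha>\<close> and \<open>\<beta>\<close> differ by the coboundary of \<open>f\<close>,
  which is \<open>f x * f y / f (x y)\<close>.\<close>

definition cohomologous ::
  "('h, 'c) monoid_scheme \<Rightarrow> ('h \<Rightarrow> 'h \<Rightarrow> int) \<Rightarrow> ('h \<Rightarrow> 'h \<Rightarrow> int) \<Rightarrow> bool" where
  "cohomologous H \<alpha> \<beta> \<longleftrightarrow>
     (\<exists>f \<in> carrier H \<rightarrow> {1, -1}. \<forall>x\<in>carrier H. \<forall>y\<in>carrier H.
        \<alpha> x y * f (x \<otimes>\<^bsub>H\<^esub> y) = \<beta> x y * (f x * f y))"

definition inflation :: "('g \<Rightarrow> 'g \<Rightarrow> int) \<Rightarrow> 'g \<times> 'e \<Rightarrow> 'g \<times> 'e \<Rightarrow> int" where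
  "inflation \<beta> x y = \<beta> (fst x) (fst y)"

definition class_inflated ::
  "('g, 'b) monoid_scheme \<Rightarrow> ('e, 'c) monoid_scheme \<Rightarrow> ('g \<times> 'e \<Rightarrow> 'g \<times> 'e \<Rightarrow> int) \<Rightarrow> bool" where
  "class_inflated G E \<alpha> \<longleftrightarrow>
     (\<exists>\<beta>. normalized_cocycle G \<beta> \<and> cohomologous (G \<times>\<times> E) \<alpha> (inflation \<beta>))"


section \<open>Twisted group rings over the integers\<close>

text \<open>Elements are finitely supported coefficient functions, zero outside the group.\<close>

definition supp :: "('h \<Rightarrow> int) \<Rightarrow> 'h set" where
  "supp a = {x. a x \<noteq> 0}"

definition basis_elem :: "'h \<Rightarrow> 'h \<Rightarrow> int" where
  "basis_elem x = (\<lambda>z. if z = x then 1 else 0)"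

definition twisted_group_ring ::
  "('h, 'c) monoid_scheme \<Rightarrow> ('h \<Rightarrow> 'h \<Rightarrow> int) \<Rightarrow> ('h \<Rightarrow> int) ring" where
  "twisted_group_ring H \<alpha> =
     \<lparr>carrier = {a. finite (supp a) \<and> supp a \<subseteq> carrier H},
      monoid.mult = (\<lambda>a b z. \<Sum>x\<in>supp a. \<Sum>y\<in>supp b.
                if x \<otimes>\<^bsub>H\<^esub> y = z then a x * b y * \<alpha> x y else 0),
      one = basis_elem \<one>\<^bsub>H\<^esub>,
      ring.zero = (\<lambda>z. 0),
      ring.add = (\<lambda>a b z. a z + b z)\<rparr>"

lemma supp_basis_elem [simp]: "supp (basis_elem x) = {x}"
  by (auto simp: supp_def basis_elem_def)

lemma basis_elem_apply: "basis_elem x z = (if z = x then 1 else 0)"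
  by (simp add: basis_elem_def)

lemma basis_elem_closed:
  "x \<in> carrier H \<Longrightarrow> basis_elem x \<in> carrier (twisted_group_ring H \<alpha>)"
  by (simp add: twisted_group_ring_def)

lemma basis_elem_mult:
  "basis_elem x \<otimes>\<^bsub>twisted_group_ring H \<alpha>\<^esub> basis_elem y =
     (\<lambda>z. \<alpha> x y * basis_elem (x \<otimes>\<^bsub>H\<^esub> y) z)"
  by (auto simp: twisted_group_ring_def fun_eq_iff basis_elem_apply)


section \<open>The twisted group rings of \<open>G \<times> C\<^sub>2\<^sup>i\<close> inside that of \<open>G \<times> C\<^sub>2\<^sup>n\<close>\<close>

definition C2_pow :: "nat \<Rightarrow> (nat \<Rightarrow> int) monoid" where
  "C2_pow n = product_group {1..n} (\<lambda>_. integer_mod_group 2)"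

definition C2_gen :: "nat \<Rightarrow> nat \<Rightarrow> nat \<Rightarrow> int" where
  "C2_gen n i = (\<lambda>k\<in>{1..n}. if k = i then 1 else 0)"

definition C2_sub :: "nat \<Rightarrow> nat \<Rightarrow> (nat \<Rightarrow> int) set" where
  "C2_sub n i = generate (C2_pow n) (C2_gen n ` {1..i})"

type_synonym 'g cocycle = "'g \<times> (nat \<Rightarrow> int) \<Rightarrow> 'g \<times> (nat \<Rightarrow> int) \<Rightarrow> int"
type_synonym 'g elem = "'g \<times> (nat \<Rightarrow> int) \<Rightarrow> int"

definition full_ring :: "('g, 'b) monoid_scheme \<Rightarrow> nat \<Rightarrow> 'g cocycle \<Rightarrow> 'g elem ring" where
  "full_ring G n \<alpha> = twisted_group_ring (G \<times>\<times> C2_pow n) \<alpha>"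

text \<open>For \<open>i = 0\<close> this is the twisted group ring of \<open>G\<close>, for \<open>i = n\<close> it is \<^const>\<open>full_ring\<close>.\<close>

definition sub_ring ::
  "('g, 'b) monoid_scheme \<Rightarrow> nat \<Rightarrow> 'g cocycle \<Rightarrow> nat \<Rightarrow> 'g elem ring" where
  "sub_ring G n \<alpha> i = (full_ring G n \<alpha>)
     \<lparr>carrier := {a \<in> carrier (full_ring G n \<alpha>). supp a \<subseteq> carrier G \<times> C2_sub n i}\<rparr>"

definition x_elem :: "('g, 'b) monoid_scheme \<Rightarrow> nat \<Rightarrow> nat \<Rightarrow> 'g elem" where
  "x_elem G n i = basis_elem (\<one>\<^bsub>G\<^esub>, C2_gen n i)"

definition unit_group :: "('g, 'b) monoid_scheme \<Rightarrow> nat \<Rightarrow> 'g cocycle \<Rightarrow> 'g elem monoid" where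
  "unit_group G n \<alpha> = units_of (full_ring G n \<alpha>)"

abbreviation subgroup_of :: "('a, 'b) monoid_scheme \<Rightarrow> 'a set \<Rightarrow> ('a, 'b) monoid_scheme" where
  "subgroup_of M S \<equiv> M\<lparr>carrier := S\<rparr>"

text \<open>The ring morphism \<open>u + v x\<^sub>i \<mapsto> u + v\<close>; every element of the \<open>i\<close>-th ring has
  exactly one such decomposition over the \<open>(i-1)\<close>-st.\<close>

definition eps ::
  "('g, 'b) monoid_scheme \<Rightarrow> nat \<Rightarrow> 'g cocycle \<Rightarrow> nat \<Rightarrow> 'g elem \<Rightarrow> 'g elem" where
  "eps G n \<alpha> i a = (THE w.
     \<exists>u\<in>carrier (sub_ring G n \<alpha> (i - 1)). \<exists>v\<in>carrier (sub_ring G n \<alpha> (i - 1)).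
       a = u \<oplus>\<^bsub>full_ring G n \<alpha>\<^esub> (v \<otimes>\<^bsub>full_ring G n \<alpha>\<^esub> x_elem G n i) \<and>
       w = u \<oplus>\<^bsub>full_ring G n \<alpha>\<^esub> v)"

definition K_group ::
  "('g, 'b) monoid_scheme \<Rightarrow> nat \<Rightarrow> 'g cocycle \<Rightarrow> nat \<Rightarrow> 'g elem set" where
  "K_group G n \<alpha> i =
     kernel (units_of (sub_ring G n \<alpha> i)) (units_of (sub_ring G n \<alpha> (i - 1))) (eps G n \<alpha> i)"

definition U_group ::
  "('g, 'b) monoid_scheme \<Rightarrow> nat \<Rightarrow> 'g cocycle \<Rightarrow> nat \<Rightarrow> 'g elem set" where
  "U_group G n \<alpha> k =
     {\<one>\<^bsub>full_ring G n \<alpha>\<^esub> \<oplus>\<^bsub>full_ring G n \<alpha>\<^esub> add_pow (full_ring G n \<alpha>) ((2::nat) ^ k) u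
        | u. u \<in> carrier (sub_ring G n \<alpha> 0)}
     \<inter> Units (sub_ring G n \<alpha> 0)"

text \<open>\<open>(1 - x\<^sub>1)\<^bsup>j 1\<^esup> \<dots> (1 - x\<^bsub>i-1\<^esub>)\<^bsup>j (i-1)\<^esup> (1 - x\<^sub>i)\<close>\<close>

definition K_vec_factor ::
  "('g, 'b) monoid_scheme \<Rightarrow> nat \<Rightarrow> 'g cocycle \<Rightarrow> nat \<Rightarrow> (nat \<Rightarrow> nat) \<Rightarrow> 'g elem" where
  "K_vec_factor G n \<alpha> i j =
     (let A = full_ring G n \<alpha>; d = (\<lambda>t. \<one>\<^bsub>A\<^esub> \<ominus>\<^bsub>A\<^esub> x_elem G n t)
      in foldr (\<lambda>t p. (d t [^]\<^bsub>A\<^esub> j t) \<otimes>\<^bsub>A\<^esub> p) [1..<i] (d i))"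

definition K_vec ::
  "('g, 'b) monoid_scheme \<Rightarrow> nat \<Rightarrow> 'g cocycle \<Rightarrow> nat \<Rightarrow> (nat \<Rightarrow> nat) \<Rightarrow> 'g elem set" where
  "K_vec G n \<alpha> i j =
     {\<one>\<^bsub>full_ring G n \<alpha>\<^esub> \<oplus>\<^bsub>full_ring G n \<alpha>\<^esub> (u \<otimes>\<^bsub>full_ring G n \<alpha>\<^esub> K_vec_factor G n \<alpha> i j)
        | u. u \<in> carrier (sub_ring G n \<alpha> 0)}
     \<inter> Units (sub_ring G n \<alpha> i)"


section \<open>Iterated internal semidirect products\<close>

text \<open>\<open>K = N \<rtimes> H\<close> and \<open>K = A \<times> B\<close> internally, for subsets of an ambient group \<open>M\<close>.\<close>

definition internal_semidirect ::
  "('a, 'b) monoid_scheme \<Rightarrow> 'a set \<Rightarrow> 'a set \<Rightarrow> 'a set \<Rightarrow> bool" where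
  "internal_semidirect M N H K \<longleftrightarrow>
     subgroup K M \<and> N \<lhd> subgroup_of M K \<and> subgroup H (subgroup_of M K) \<and>
     N \<inter> H = {\<one>\<^bsub>M\<^esub>} \<and> N <#>\<^bsub>M\<^esub> H = K"

definition internal_direct ::
  "('a, 'b) monoid_scheme \<Rightarrow> 'a set \<Rightarrow> 'a set \<Rightarrow> 'a set \<Rightarrow> bool" where
  "internal_direct M A B K \<longleftrightarrow>
     subgroup K M \<and> A \<lhd> subgroup_of M K \<and> B \<lhd> subgroup_of M K \<and>
     A \<inter> B = {\<one>\<^bsub>M\<^esub>} \<and> A <#>\<^bsub>M\<^esub> B = K"

text \<open>A bracketed product; in \<open>Semi s t\<close> the left factor \<open>s\<close> is the normal one.\<close>

datatype 'f bracketing = Factor 'f | Semi "'f bracketing" "'f bracketing"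

primrec factor_list :: "'f bracketing \<Rightarrow> 'f list" where
  "factor_list (Factor f) = [f]"
| "factor_list (Semi s t) = factor_list s @ factor_list t"

primrec iterated_semidirect ::
  "('a, 'b) monoid_scheme \<Rightarrow> 'a set bracketing \<Rightarrow> 'a set \<Rightarrow> bool" where
  "iterated_semidirect M (Factor H) K \<longleftrightarrow> subgroup H M \<and> K = H"
| "iterated_semidirect M (Semi s t) K \<longleftrightarrow>
     (\<exists>N H. iterated_semidirect M s N \<and> iterated_semidirect M t H \<and> internal_semidirect M N H K)"

text \<open>For \<open>fs = [f\<^sub>1, \<dots>, f\<^sub>m]\<close>: \<open>f\<^sub>1 \<rtimes> (f\<^sub>2 \<rtimes> (\<dots> \<rtimes> (f\<^sub>m \<rtimes> f)))\<close>
  and \<open>((f\<^sub>1 \<rtimes> f\<^sub>2) \<rtimes> \<dots> \<rtimes> f\<^sub>m) \<rtimes> f\<close>.\<close>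

definition right_nested :: "'f list \<Rightarrow> 'f \<Rightarrow> 'f bracketing" where
  "right_nested fs f = foldr (\<lambda>g t. Semi (Factor g) t) fs (Factor f)"

definition left_nested :: "'f list \<Rightarrow> 'f \<Rightarrow> 'f bracketing" where
  "left_nested fs f =
     (case fs @ [f] of g # gs \<Rightarrow> foldl (\<lambda>t h. Semi t (Factor h)) (Factor g) gs)"

lemma nested_examples:
  "right_nested [a, b, c] d = Semi (Factor a) (Semi (Factor b) (Semi (Factor c) (Factor d)))"
  "left_nested [a, b, c] d = Semi (Semi (Semi (Factor a) (Factor b)) (Factor c)) (Factor d)"
  by (simp_all add: right_nested_def left_nested_def)

definition torsion_free :: "('a, 'b) monoid_scheme \<Rightarrow> 'a set \<Rightarrow> bool" where
  "torsion_free M N \<longleftrightarrow> (\<forall>x\<in>N. \<forall>m::nat. 0 < m \<longrightarrow> x [^]\<^bsub>M\<^esub> m = \<one>\<^bsub>M\<^esub> \<longrightarrow> x = \<one>\<^bsub>M\<^esub>)"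

end

(*
All the semidirect decompositions come from idempotent ring endomorphisms: if f is one and
U is a group of units with f U <= U, then U = (ker f | U) x| f U.  Taking x_i |-> 1 gives
the kernels K_i.  Writing K_i = {1 + v (1 - x_i)}, with v in the ring over C_2^(i-1), the
specialisations x_(i-1) |-> 1, ..., x_1 |-> 1 split K_i successively into the K_j: each one
replaces v by its value and sends the rest to a multiple of 1 - x_m.  Since (1 - x)^2 = 2 (1 - x),
the specialisation of all x_t to -1 identifies K_j with the congruence group U_(1 + sum j).

Under x_i |-> -1 the group K_i becomes a group of units 1 + 2v.  A torsion unit of this kind
is 1 or -1: odd order is excluded 2-adically, and even order leads to an idempotent -v, which is
0 or 1 because its left multiplication matrix is idempotent of trace |H| times the coefficient
at 1.  That coefficient, tr, is multiplicative modulo 4 on the units 1 + 2v and invariant under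
conjugation, so N_i = {tr = 1 mod 4} is a torsion-free complement of x_i in K_i, normalised by
all units of the i-th ring.  The second chain is then the associativity of semidirect products
along the groups W_i Z, where W_i is the unit group of the i-th ring and Z = <x_1, ..., x_n>
is central.
*)
theory Submission
  imports Defs "HOL-Algebra.Subrings" "HOL-Algebra.Zassenhaus"
begin

text \<open>What shapes the proof is the element \<open>x i\<close> of order 2 in
  \<open>K i\<close>: a torsion-free complement needs a character of \<open>K i\<close> that detects
  it. The coefficient at 1 is not multiplicative, but for units \<open>1 + 2u\<close> and
  \<open>1 + 2v\<close> the uncontrolled term \<open>u v\<close> of the product carries the factor
  4, while modulo 4 the values 1 and -1 are still distinct; this is the origin of the modulus.

  Triviality of idempotents is an integrality statement: the coefficients of \<open>e\<close> and
  \<open>1 - e\<close> at 1 are nonnegative integers with sum 1. Nonnegativity comes from comparing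
  an idempotent matrix with the orthogonal projection onto its column space, which has the same
  trace, and whose trace is a sum of squares.

  The arguments about units use only formal properties of the ring (no 2-torsion, 2-adic separation,
  trivial idempotents, a trace) and live in the abstract \<open>involution_tower\<close>.
  Coefficients and the cocycle enter only in its instance, where \<alpha> is assumed cohomologous to
  an inflated cocycle, so that centrality and order 2 of the \<open>x i\<close> must be read off
  from the coboundary relation.\<close>

section \<open>Idempotent matrices\<close>

text \<open>Gram-Schmidt for vectors that may be linearly dependent: induction gives the residues of
  \<open>w\<close> and of \<open>v k\<close> modulo the earlier vectors, and then the residue of
  \<open>w\<close> is corrected along that of \<open>v k\<close>.\<close>

lemma orthogonal_projection:
  fixes v :: "'j \<Rightarrow> 'h \<Rightarrow> real"
  assumes "finite S" and "finite J"
  shows "\<exists>c. \<forall>k\<in>J. (\<Sum>x\<in>S. (w x - (\<Sum>i\<in>J. c i * v i x)) * v k x) = 0"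
  using \<open>finite J\<close>
proof (induction J arbitrary: w)
  case empty
  show ?case by simp
next
  case (insert k J)
  obtain c where c: "\<forall>i\<in>J. (\<Sum>x\<in>S. (w x - (\<Sum>i\<in>J. c i * v i x)) * v i x) = 0"
    using insert.IH by blast
  obtain d where d: "\<forall>i\<in>J. (\<Sum>x\<in>S. (v k x - (\<Sum>i\<in>J. d i * v i x)) * v i x) = 0"
    using insert.IH by blast
  define w' where "w' x = w x - (\<Sum>i\<in>J. c i * v i x)" for x
  define v' where "v' x = v k x - (\<Sum>i\<in>J. d i * v i x)" for x
  \<comment> \<open>The usual projection coefficient. If the denominator vanishes, so does
    \<open>v'\<close> on \<open>S\<close>, and any value of the quotient is correct.\<close>
  define t where "t = (\<Sum>x\<in>S. w' x * v' x) / (\<Sum>x\<in>S. v' x * v' x)"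
  define c' where "c' i = (if i = k then t else c i - t * d i)" for i
  have "(\<Sum>i\<in>J. c' i * v i x) = (\<Sum>i\<in>J. (c i - t * d i) * v i x)" for x
    using insert.hyps(2) by (intro sum.cong) (auto simp: c'_def)
  then have residue: "w x - (\<Sum>i\<in>insert k J. c' i * v i x) = w' x - t * v' x" for x
    using insert.hyps
    by (simp add: w'_def v'_def c'_def algebra_simps sum.distrib sum_distrib_left sum_subtractf)
  have old: "(\<Sum>x\<in>S. (w' x - t * v' x) * v i x) = 0" if "i \<in> J" for i
  proof -
    have "(\<Sum>x\<in>S. (w' x - t * v' x) * v i x)
        = (\<Sum>x\<in>S. w' x * v i x) - t * (\<Sum>x\<in>S. v' x * v i x)"
      by (simp add: algebra_simps sum_subtractf sum_distrib_left)
    then show ?thesis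
      using c d that by (simp add: w'_def v'_def)
  qed
  have new: "(\<Sum>x\<in>S. (w' x - t * v' x) * v' x) = 0"
  proof (cases "(\<Sum>x\<in>S. v' x * v' x) = 0")
    case True
    then have "\<forall>x\<in>S. v' x = 0"
      using \<open>finite S\<close> by (simp add: sum_nonneg_eq_0_iff)
    then show ?thesis by simp
  next
    case False
    have "(\<Sum>x\<in>S. (w' x - t * v' x) * v' x)
        = (\<Sum>x\<in>S. w' x * v' x) - t * (\<Sum>x\<in>S. v' x * v' x)"
      by (simp add: algebra_simps sum_subtractf sum_distrib_left)
    then show ?thesis
      using False by (simp add: t_def)
  qed
  \<comment> \<open>\<open>v k\<close> is \<open>v'\<close> plus a combination of the earlier
    vectors, so orthogonality to all of these gives orthogonality to \<open>v k\<close>.\<close>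
  have "(\<Sum>x\<in>S. (w' x - t * v' x) * v k x)
      = (\<Sum>x\<in>S. (w' x - t * v' x) * v' x)
        + (\<Sum>x\<in>S. \<Sum>i\<in>J. d i * ((w' x - t * v' x) * v i x))"
  proof -
    have "r * v k x = r * v' x + (\<Sum>i\<in>J. d i * (r * v i x))" for r x
      by (simp add: v'_def right_diff_distrib sum_distrib_left mult.left_commute)
    then show ?thesis
      by (simp only: sum.distrib)
  qed
  also have "\<dots> = (\<Sum>i\<in>J. d i * (\<Sum>x\<in>S. (w' x - t * v' x) * v i x))"
    unfolding new by (subst sum.swap) (simp add: sum_distrib_left)
  finally have "(\<Sum>x\<in>S. (w' x - t * v' x) * v k x) = 0"
    using old by simp
  with old show ?case
    unfolding residue[symmetric] by blast
qed

text \<open>Let \<open>F\<close> be the orthogonal projection onto the column space of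
  \<open>P\<close>. Equal column spaces give \<open>P F = F\<close> and \<open>F P = P\<close>,
  hence tr P = tr (F P) = tr (P F) = tr F, and for a symmetric idempotent this is the sum of the
  squares of all entries. If it is 0, then \<open>F = 0\<close> and
  \<open>P = F P = 0\<close>.\<close>

lemma trace_idempotent_matrix:
  fixes P :: "'h \<Rightarrow> 'h \<Rightarrow> real"
  assumes "finite S"
    and idem: "\<And>i j. i \<in> S \<Longrightarrow> j \<in> S \<Longrightarrow> (\<Sum>k\<in>S. P i k * P k j) = P i j"
  shows "0 \<le> (\<Sum>i\<in>S. P i i)"
    and "(\<Sum>i\<in>S. P i i) = 0 \<Longrightarrow> i \<in> S \<Longrightarrow> j \<in> S \<Longrightarrow> P i j = 0"
proof -
  define residue where
    "residue y c x = (if x = y then 1 else 0) - (\<Sum>i\<in>S. c i * P x i)" for y c x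
  have "\<forall>y. \<exists>c. \<forall>k\<in>S. (\<Sum>x\<in>S. residue y c x * P x k) = 0"
    unfolding residue_def
    by (rule allI, rule orthogonal_projection[OF assms(1) assms(1), where v = "\<lambda>i x. P x i"])
  from choice[OF this] obtain C where "\<forall>y. \<forall>k\<in>S. (\<Sum>x\<in>S. residue y (C y) x * P x k) = 0"
    by (rule exE)
  then have C: "(\<Sum>x\<in>S. residue y (C y) x * P x k) = 0" if "k \<in> S" for y k
    using that by blast
  \<comment> \<open>Column \<open>y\<close> of \<open>F\<close> is the projection of the
    \<open>y\<close>-th unit vector, with coefficients \<open>C y\<close> on the columns of
    \<open>P\<close>; \<open>residue y (C y)\<close> is the orthogonal rest.\<close>
  define F where "F x y = (\<Sum>i\<in>S. C y i * P x i)" for x y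
  have FtP: "(\<Sum>x\<in>S. F x y * P x k) = P y k" if "y \<in> S" "k \<in> S" for y k
  proof -
    have "(\<Sum>x\<in>S. (if x = y then 1 else 0) * P x k) = (\<Sum>x\<in>S. F x y * P x k)"
      using C[OF that(2), of y] by (simp add: residue_def F_def left_diff_distrib sum_subtractf)
    moreover have "(\<Sum>x\<in>S. (if x = y then 1 else 0) * P x k) = (\<Sum>x\<in>S. if x = y then P x k else 0)"
      by (intro sum.cong) auto
    ultimately show ?thesis
      using that assms(1) by simp
  qed
  have PF: "(\<Sum>x\<in>S. P z x * F x y) = F z y" if "z \<in> S" for z y
  proof -
    have "(\<Sum>x\<in>S. P z x * F x y) = (\<Sum>x\<in>S. \<Sum>i\<in>S. C y i * (P z x * P x i))"
      unfolding F_def sum_distrib_left by (simp add: mult_ac)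
    also have "\<dots> = (\<Sum>i\<in>S. C y i * (\<Sum>x\<in>S. P z x * P x i))"
      by (subst sum.swap) (simp add: sum_distrib_left)
    also have "\<dots> = F z y"
      using idem that by (simp add: F_def)
    finally show ?thesis .
  qed
  \<comment> \<open>The transpose of \<open>F\<close> times \<open>F\<close> equals
    \<open>F\<close>. The left side is symmetric, hence so is \<open>F\<close>.\<close>
  have FtF: "(\<Sum>x\<in>S. F x y * F x z) = F y z" if "y \<in> S" for y z
  proof -
    have "(\<Sum>x\<in>S. F x y * F x z) = (\<Sum>x\<in>S. \<Sum>i\<in>S. C z i * (F x y * P x i))"
      unfolding F_def[of _ z] sum_distrib_left by (simp add: mult_ac)
    also have "\<dots> = (\<Sum>i\<in>S. C z i * (\<Sum>x\<in>S. F x y * P x i))"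
      by (subst sum.swap) (simp add: sum_distrib_left)
    also have "\<dots> = F y z"
      using FtP that by (simp add: F_def[of y z])
    finally show ?thesis .
  qed
  have sym: "F y z = F z y" if "y \<in> S" "z \<in> S" for y z
    using FtF[of y z] FtF[of z y] that by (simp add: mult.commute)
  have "(\<Sum>y\<in>S. F y y) = (\<Sum>y\<in>S. \<Sum>x\<in>S. P y x * F x y)"
    using PF by simp
  also have "\<dots> = (\<Sum>x\<in>S. \<Sum>y\<in>S. F y x * P y x)"
    by (subst sum.swap) (intro sum.cong refl, auto simp: sym mult.commute)
  also have "\<dots> = (\<Sum>x\<in>S. P x x)"
    using FtP by simp
  finally have trace: "(\<Sum>x\<in>S. P x x) = (\<Sum>y\<in>S. \<Sum>x\<in>S. F x y * F x y)"
    using FtF by simp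
  then show "0 \<le> (\<Sum>i\<in>S. P i i)"
    by (simp add: sum_nonneg)
  assume "(\<Sum>i\<in>S. P i i) = 0" and ij: "i \<in> S" "j \<in> S"
  then have "\<forall>y\<in>S. \<forall>x\<in>S. F x y = 0"
    using trace \<open>finite S\<close> by (simp add: sum_nonneg_eq_0_iff sum_nonneg)
  then show "P i j = 0"
    using FtP[OF ij] ij by simp
qed

section \<open>Internal semidirect products\<close>

lemma (in group) internal_semidirectI:
  assumes "subgroup K G" and "subgroup N G" and "subgroup H G" and "N \<subseteq> K" and "H \<subseteq> K"
    and "\<And>k a. k \<in> K \<Longrightarrow> a \<in> N \<Longrightarrow> k \<otimes> a \<otimes> inv k \<in> N"
    and "N \<inter> H \<subseteq> {\<one>}" and "K \<subseteq> N <#> H"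
  shows "internal_semidirect G N H K"
proof -
  have "N \<lhd> G\<lparr>carrier := K\<rparr>"
    using assms subgroup_incl m_inv_consistent
    by (subst group.normal_inv_iff) (auto simp: subgroup_imp_group)
  moreover have "N <#> H \<subseteq> K"
    using assms by (auto simp: set_mult_def intro: subgroup.m_closed)
  moreover have "\<one> \<in> N \<inter> H"
    using assms by (simp add: subgroup.one_closed)
  ultimately show ?thesis
    using assms by (auto simp: internal_semidirect_def subgroup_incl)
qed

lemma (in group) internal_semidirectD:
  assumes "internal_semidirect G N H K"
  shows "subgroup K G" and "subgroup N G" and "subgroup H G" and "N \<subseteq> K" and "H \<subseteq> K"
    and "\<And>k a. k \<in> K \<Longrightarrow> a \<in> N \<Longrightarrow> k \<otimes> a \<otimes> inv k \<in> N"
    and "N \<inter> H = {\<one>}" and "K = N <#> H"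
proof -
  show K: "subgroup K G" and "N \<inter> H = {\<one>}" and "K = N <#> H"
    using assms by (auto simp: internal_semidirect_def)
  have N: "N \<lhd> G\<lparr>carrier := K\<rparr>" and H: "subgroup H (G\<lparr>carrier := K\<rparr>)"
    using assms by (auto simp: internal_semidirect_def)
  have NK: "subgroup N (G\<lparr>carrier := K\<rparr>)"
    using N by (simp add: normal_def)
  show "subgroup N G" "subgroup H G"
    using incl_subgroup[OF K] NK H by auto
  show "N \<subseteq> K" "H \<subseteq> K"
    using subgroup.subset[OF NK] subgroup.subset[OF H] by auto
  show "k \<otimes> a \<otimes> inv k \<in> N" if "k \<in> K" "a \<in> N" for k a
    using normal.inv_op_closed2[OF N, of k a] that m_inv_consistent[OF K] by simp
qed

text \<open>\<open>k\<close> factors as \<open>k (f k)^-1\<close> times \<open>f k\<close>, and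
  idempotence puts the first factor into the kernel. \<open>f\<close> is an endomorphism of the
  ambient group, so that one substitution can serve many subgroups \<open>K\<close>.\<close>

lemma (in group) idempotent_hom_semidirect:
  assumes K: "subgroup K G" and f: "f \<in> hom G G" and fK: "f ` K \<subseteq> K"
    and idem: "\<And>k. k \<in> K \<Longrightarrow> f (f k) = f k"
  shows "internal_semidirect G {k \<in> K. f k = \<one>} (f ` K) K"
proof -
  interpret f: group_hom G G f
    using f by unfold_locales
  have carr: "k \<in> carrier G" if "k \<in> K" for k
    using subgroup.mem_carrier[OF K that] .
  show ?thesis
  proof (rule internal_semidirectI)
    have "{k \<in> K. f k = \<one>} = K \<inter> kernel G G f"
      using carr by (auto simp: kernel_def)
    then show "subgroup {k \<in> K. f k = \<one>} G"
      using subgroups_Inter_pair[OF K f.subgroup_kernel] by simp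
    show "subgroup (f ` K) G"
      by (rule f.subgroup_img_is_subgroup[OF K])
    show "k \<otimes> a \<otimes> inv k \<in> {k \<in> K. f k = \<one>}" if "k \<in> K" "a \<in> {k \<in> K. f k = \<one>}" for k a
      using that carr subgroup.m_closed[OF K] subgroup.m_inv_closed[OF K] by auto
    show "{k \<in> K. f k = \<one>} \<inter> f ` K \<subseteq> {\<one>}"
      using idem by auto
    show "K \<subseteq> {k \<in> K. f k = \<one>} <#> f ` K"
    proof
      fix k assume k: "k \<in> K"
      then have fk: "f k \<in> K"
        using fK by auto
      have "k \<otimes> inv f k \<in> {k \<in> K. f k = \<one>}"
        using k fk carr idem subgroup.m_closed[OF K] subgroup.m_inv_closed[OF K] by auto
      moreover have "k = (k \<otimes> inv f k) \<otimes> f k"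
        using carr[OF k] carr[OF fk] by (simp add: m_assoc)
      ultimately show "k \<in> {k \<in> K. f k = \<one>} <#> f ` K"
        using k unfolding set_mult_def by blast
    qed
  qed (use K fK in auto)
qed

lemma (in group) conjugate_mult:
  assumes "k \<in> carrier G" "a \<in> carrier G" "b \<in> carrier G"
  shows "k \<otimes> (a \<otimes> b) \<otimes> inv k = (k \<otimes> a \<otimes> inv k) \<otimes> (k \<otimes> b \<otimes> inv k)"
  using assms by (simp add: m_assoc inv_solve_left)

text \<open>Conjugation by \<open>w = q k\<close> preserves \<open>Q N\<close>: \<open>k\<close>
  normalises \<open>Q\<close> and \<open>N\<close> separately, and \<open>q\<close> lies in the
  subgroup \<open>Q N\<close> itself. This is the passage from right to left nesting.\<close>

lemma (in group) semidirect_assoc: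
  assumes out: "internal_semidirect G Q K W" and inn: "internal_semidirect G N H K"
  shows "internal_semidirect G Q N (Q <#> N)" and "internal_semidirect G (Q <#> N) H W"
proof -
  note o = internal_semidirectD[OF out] and i = internal_semidirectD[OF inn]
  note carr = subgroup.mem_carrier[OF o(1)] subgroup.mem_carrier[OF o(2)]
    subgroup.mem_carrier[OF i(1)] subgroup.mem_carrier[OF i(2)] subgroup.mem_carrier[OF i(3)]
  have "subgroup (Q <#> N) (G\<lparr>carrier := W\<rparr>)"
    using out o i subgroup_incl
    by (intro mult_norm_sub_in_sub) (auto simp: internal_semidirect_def)
  then have P: "subgroup (Q <#> N) G" and PW: "Q <#> N \<subseteq> W"
    using incl_subgroup[OF o(1)] subgroup.subset by fastforce+
  have QP: "Q \<subseteq> Q <#> N"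
    using carr(2) subgroup.one_closed[OF i(2)] by (force simp: set_mult_def)
  have NP: "N \<subseteq> Q <#> N"
    using carr(4) subgroup.one_closed[OF o(2)] by (force simp: set_mult_def)
  show "internal_semidirect G Q N (Q <#> N)"
    using P QP NP PW o i by (intro internal_semidirectI) auto
  show "internal_semidirect G (Q <#> N) H W"
  proof (rule internal_semidirectI)
    show "H \<subseteq> W" using o i by auto
    fix w a assume "w \<in> W" and "a \<in> Q <#> N"
    then obtain q k q1 n1 where wk: "w = q \<otimes> k" "q \<in> Q" "k \<in> K"
      and a: "a = q1 \<otimes> n1" "q1 \<in> Q" "n1 \<in> N"
      unfolding o(8) set_mult_def by blast
    have c: "q \<in> carrier G" "k \<in> carrier G" "q1 \<in> carrier G" "n1 \<in> carrier G"
      using wk a carr by auto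
    have "k \<otimes> q1 \<otimes> inv k \<in> Q" "k \<otimes> n1 \<otimes> inv k \<in> N"
      using wk a o(5,6) i(6) by auto
    then have "k \<otimes> a \<otimes> inv k \<in> Q <#> N"
      unfolding a(1) conjugate_mult[OF c(2,3,4)] by (auto simp: set_mult_def)
    then have "q \<otimes> (k \<otimes> a \<otimes> inv k) \<otimes> inv q \<in> Q <#> N"
      using wk(2) QP P by (meson subgroup.m_closed subgroup.m_inv_closed subsetD)
    moreover have "q \<otimes> (k \<otimes> a \<otimes> inv k) \<otimes> inv q = w \<otimes> a \<otimes> inv w"
      unfolding wk(1) a(1) using c by (simp add: inv_mult_group m_assoc)
    ultimately show "w \<otimes> a \<otimes> inv w \<in> Q <#> N" by simp
  next
    show "(Q <#> N) \<inter> H \<subseteq> {\<one>}"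
    proof
      fix h assume "h \<in> (Q <#> N) \<inter> H"
      then obtain q a where h: "h = q \<otimes> a" "q \<in> Q" "a \<in> N" "h \<in> H"
        unfolding set_mult_def by blast
      \<comment> \<open>Both \<open>h\<close> and \<open>a\<close> lie in \<open>K\<close>, so
        \<open>q\<close> lies in the trivial intersection of \<open>Q\<close> and
        \<open>K\<close>.\<close>
      then have "q = h \<otimes> inv a"
        using carr by (simp add: m_assoc)
      moreover have "h \<otimes> inv a \<in> K"
        using h i by (meson subgroup.m_closed subgroup.m_inv_closed subsetD)
      ultimately have "q = \<one>"
        using h(2) o(7) by auto
      then have "h \<in> N \<inter> H"
        using h carr by simp
      then show "h \<in> {\<one>}"
        using i(7) by simp
    qed
    show "W \<subseteq> (Q <#> N) <#> H"
      unfolding o(8) i(8) using carr(2) i(2,3)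
      by (subst set_mult_assoc) (auto dest: subgroup.subset)
  qed (use o i P PW in auto)
qed

lemma (in group) iterated_semidirect_right_nested:
  assumes "subgroup (W 0) G"
    and "\<And>i. i \<in> {1..n} \<Longrightarrow> internal_semidirect G (K i) (W (i - 1)) (W i)"
  shows "iterated_semidirect G (right_nested (map K (rev [1..<Suc n])) (W 0)) (W n)"
  using assms(2)
proof (induction n)
  case 0
  then show ?case
    using assms(1) by (simp add: right_nested_def)
next
  case (Suc n)
  have step: "internal_semidirect G (K (Suc n)) (W n) (W (Suc n))"
    using Suc.prems[of "Suc n"] by simp
  have "right_nested (map K (rev [1..<Suc (Suc n)])) (W 0)
      = Semi (Factor (K (Suc n))) (right_nested (map K (rev [1..<Suc n])) (W 0))"
    by (simp add: right_nested_def)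
  moreover have "iterated_semidirect G (right_nested (map K (rev [1..<Suc n])) (W 0)) (W n)"
    using Suc by simp
  ultimately show ?case
    using step internal_semidirectD(2)[OF step] by auto
qed

lemma (in group) iterated_semidirect_left_nested:
  assumes "subgroup (D 0) G"
    and step: "\<And>i. i \<in> {1..n} \<Longrightarrow> internal_semidirect G (N i) (D (i - 1)) (D i)"
  shows "iterated_semidirect G (left_nested (map N (rev [1..<Suc n])) (D 0)) (D n)"
proof (cases n)
  case 0
  then show ?thesis
    using assms(1) by (simp add: left_nested_def)
next
  case (Suc m)
  \<comment> \<open>The left-nested product of \<open>N n, ..., N (k + 1)\<close>. Descending
    induction on \<open>k\<close> keeps \<open>D k\<close> as its complement in \<open>D n\<close>;
    each step splits \<open>D (k + 1)\<close> and reassociates.\<close>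
  let ?b = "\<lambda>k. foldl (\<lambda>t h. Semi t (Factor h)) (Factor (N n)) (map N (rev [Suc k..<n]))"
  have "\<exists>Q. iterated_semidirect G (?b k) Q \<and> internal_semidirect G Q (D k) (D n)" if "k \<le> m" for k
    using that
  proof (induction rule: inc_induct)
    case base
    have "internal_semidirect G (N n) (D m) (D n)"
      using step[of n] Suc by simp
    then show ?case
      using internal_semidirectD(2) Suc by auto
  next
    case (step k)
    then obtain Q where Q: "iterated_semidirect G (?b (Suc k)) Q"
      "internal_semidirect G Q (D (Suc k)) (D n)"
      by blast
    have inn: "internal_semidirect G (N (Suc k)) (D k) (D (Suc k))"
      using assms(2)[of "Suc k"] step.hyps Suc by simp
    have "?b k = Semi (?b (Suc k)) (Factor (N (Suc k)))"
      using step.hyps Suc by (subst upt_conv_Cons) auto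
    then have "iterated_semidirect G (?b k) (Q <#> N (Suc k))"
      using Q semidirect_assoc(1)[OF Q(2) inn] internal_semidirectD(2)[OF inn] by auto
    then show ?case
      using semidirect_assoc(2)[OF Q(2) inn] by blast
  qed
  then obtain Q where "iterated_semidirect G (?b 0) Q" "internal_semidirect G Q (D 0) (D n)"
    by blast
  then show ?thesis
    using assms(1) Suc by (auto simp: left_nested_def)
qed

lemma (in group) commuting_factors_iso:
  assumes N: "subgroup N G" and Z: "subgroup Z G" and "N \<inter> Z = {\<one>}" and K: "N <#> Z = K"
    and comm: "\<And>a z. a \<in> N \<Longrightarrow> z \<in> Z \<Longrightarrow> a \<otimes> z = z \<otimes> a"
  shows "G\<lparr>carrier := K\<rparr> \<cong> G\<lparr>carrier := N\<rparr> \<times>\<times> G\<lparr>carrier := Z\<rparr>"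
proof -
  interpret N: group "G\<lparr>carrier := N\<rparr>"
    by (rule subgroup_imp_group[OF N])
  interpret Z: group "G\<lparr>carrier := Z\<rparr>"
    by (rule subgroup_imp_group[OF Z])
  interpret NZ: group_disjoint_sum G N Z
    using N Z by unfold_locales (auto simp: subgroup_def)
  have "(\<lambda>(a, z). a \<otimes> z) \<in> iso (G\<lparr>carrier := N\<rparr> \<times>\<times> G\<lparr>carrier := Z\<rparr>) (G\<lparr>carrier := K\<rparr>)"
  proof (rule isoI)
    have "a \<otimes> b \<otimes> (z \<otimes> y) = a \<otimes> z \<otimes> (b \<otimes> y)"
      if "a \<in> N" "b \<in> N" "z \<in> Z" "y \<in> Z" for a b z y
      using that comm[of b z] subgroup.mem_carrier[OF N] subgroup.mem_carrier[OF Z]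
      by (metis m_assoc m_closed)
    then show "(\<lambda>(a, z). a \<otimes> z) \<in> hom (G\<lparr>carrier := N\<rparr> \<times>\<times> G\<lparr>carrier := Z\<rparr>) (G\<lparr>carrier := K\<rparr>)"
      using K by (auto simp: hom_def DirProd_def set_mult_def)
    have "inj_on (\<lambda>(a, z). a \<otimes> z) (N \<times> Z)"
      using NZ.cancel assms(3) by (auto simp: inj_on_def)
    moreover have "(\<lambda>(a, z). a \<otimes> z) ` (N \<times> Z) = K"
      using K by (auto simp: set_mult_def)
    ultimately show "bij_betw (\<lambda>(a, z). a \<otimes> z)
        (carrier (G\<lparr>carrier := N\<rparr> \<times>\<times> G\<lparr>carrier := Z\<rparr>)) (carrier (G\<lparr>carrier := K\<rparr>))"
      by (simp add: bij_betw_def DirProd_def)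
  qed
  then show ?thesis
    using group.iso_sym[OF DirProd_group[OF N.is_group Z.is_group]] is_isoI by blast
qed

section \<open>Rings with a tower of central involutions\<close>

declare One_nat_def [simp del]

lemma (in ring) ring_hom_units:
  assumes "h \<in> ring_hom R R"
  shows "h \<in> hom (units_of R) (units_of R)"
proof (rule homI)
  show "h a \<in> carrier (units_of R)" if a: "a \<in> carrier (units_of R)" for a
  proof -
    obtain b where "a \<in> carrier R" "b \<in> carrier R" "a \<otimes> b = \<one>" "b \<otimes> a = \<one>"
      using a by (auto simp: units_of_def Units_def)
    moreover from this have "h a \<otimes> h b = \<one>" "h b \<otimes> h a = \<one>"
      by (simp_all add: ring_hom_mult[OF assms, symmetric] ring_hom_one[OF assms])
    ultimately show ?thesis
      using ring_hom_closed[OF assms] by (auto simp: units_of_def Units_def)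
  qed
  show "h (a \<otimes>\<^bsub>units_of R\<^esub> b) = h a \<otimes>\<^bsub>units_of R\<^esub> h b"
    if "a \<in> carrier (units_of R)" "b \<in> carrier (units_of R)" for a b
    using that by (simp add: units_of_def Units_def ring_hom_mult[OF assms])
qed

text \<open>Every central square root of 1 obeys the same multiplication formula. Comparing
  \<open>y = x i\<close> with \<open>y = 1\<close> or \<open>y = -1\<close> makes substitution for
  \<open>x i\<close> multiplicative.\<close>

lemma (in ring) mult_adjoined_root_of_one:
  assumes "u \<in> carrier R" "v \<in> carrier R" "u' \<in> carrier R" "v' \<in> carrier R" "y \<in> carrier R"
    and "\<And>a. a \<in> carrier R \<Longrightarrow> y \<otimes> a = a \<otimes> y" and "y \<otimes> y = \<one>"
  shows "(u \<oplus> v \<otimes> y) \<otimes> (u' \<oplus> v' \<otimes> y) = (u \<otimes> u' \<oplus> v \<otimes> v') \<oplus> (u \<otimes> v' \<oplus> v \<otimes> u') \<otimes> y"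
proof -
  note closed = assms(1-5)
  have comm: "y \<otimes> u' = u' \<otimes> y" "y \<otimes> v' = v' \<otimes> y"
    using assms(6) closed by auto
  have "v \<otimes> y \<otimes> u' = v \<otimes> u' \<otimes> y"
    using closed by (simp add: m_assoc comm)
  moreover have "v \<otimes> y \<otimes> (v' \<otimes> y) = v \<otimes> v'"
  proof -
    have "y \<otimes> (v' \<otimes> y) = y \<otimes> (y \<otimes> v')"
      by (simp add: comm)
    also have "\<dots> = v'"
      using closed assms(7) by (simp add: m_assoc[symmetric])
    finally show ?thesis
      using closed by (simp add: m_assoc)
  qed
  ultimately show ?thesis
    using closed by (simp add: l_distr r_distr m_assoc[symmetric] a_ac)
qed

text \<open>\<open>B S\<close> is the subring generated by \<open>B {}\<close> and the \<open>x i\<close> with \<open>i \<in> S\<close>; subsets rather than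
  initial segments are needed to substitute for one \<open>x i\<close> while keeping the later ones.\<close>

locale involution_tower = ring A for A (structure) +
  fixes n :: nat and B :: "nat set \<Rightarrow> 'a set" and x :: "nat \<Rightarrow> 'a" and tr :: "'a \<Rightarrow> int"
  assumes B_subring: "S \<subseteq> {1..n} \<Longrightarrow> subring (B S) A"
    and B_mono: "S \<subseteq> T \<Longrightarrow> T \<subseteq> {1..n} \<Longrightarrow> B S \<subseteq> B T"
    and B_full: "B {1..n} = carrier A"
    and x_in_B: "i \<in> {1..n} \<Longrightarrow> x i \<in> B {i}"
    and x_comm: "i \<in> {1..n} \<Longrightarrow> a \<in> carrier A \<Longrightarrow> x i \<otimes> a = a \<otimes> x i"
    and x_sq: "i \<in> {1..n} \<Longrightarrow> x i \<otimes> x i = \<one>"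
    and B_insert: "S \<subseteq> {1..n} \<Longrightarrow> i \<in> {1..n} - S \<Longrightarrow> a \<in> B (insert i S) \<Longrightarrow>
      \<exists>u\<in>B S. \<exists>v\<in>B S. a = u \<oplus> v \<otimes> x i"
    and B_direct: "i \<in> {1..n} \<Longrightarrow>
      u \<in> B ({1..n} - {i}) \<Longrightarrow> v \<in> B ({1..n} - {i}) \<Longrightarrow>
      u' \<in> B ({1..n} - {i}) \<Longrightarrow> v' \<in> B ({1..n} - {i}) \<Longrightarrow>
      u \<oplus> v \<otimes> x i = u' \<oplus> v' \<otimes> x i \<Longrightarrow> u = u' \<and> v = v'"
    and double_eq_zero: "a \<in> carrier A \<Longrightarrow> a \<oplus> a = \<zero> \<Longrightarrow> a = \<zero>"
    and two_adic_separated: "a \<in> carrier A \<Longrightarrow>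
      (\<And>k::nat. \<exists>b\<in>carrier A. a = add_pow A ((2::nat) ^ k) b) \<Longrightarrow> a = \<zero>"
    and trivial_idempotents: "a \<in> carrier A \<Longrightarrow> a \<otimes> a = a \<Longrightarrow> a = \<zero> \<or> a = \<one>"
    and tr_add: "a \<in> carrier A \<Longrightarrow> b \<in> carrier A \<Longrightarrow> tr (a \<oplus> b) = tr a + tr b"
    and tr_comm: "a \<in> carrier A \<Longrightarrow> b \<in> carrier A \<Longrightarrow> tr (a \<otimes> b) = tr (b \<otimes> a)"
    and tr_one: "tr \<one> = 1"
begin

abbreviation M where "M \<equiv> units_of A"

lemma M_group: "group M"
  by (rule units_group)

lemma M_simps [simp]: "carrier M = Units A" "(\<otimes>\<^bsub>M\<^esub>) = (\<otimes>)" "\<one>\<^bsub>M\<^esub> = \<one>"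
  by (simp_all add: units_of_def)

lemma inv_M: "a \<in> Units A \<Longrightarrow> inv\<^bsub>M\<^esub> a = inv a"
  by (rule units_of_inv)

lemma B_carrier: "S \<subseteq> {1..n} \<Longrightarrow> a \<in> B S \<Longrightarrow> a \<in> carrier A"
  using subringE(1)[OF B_subring] by blast

lemma B_zero: "S \<subseteq> {1..n} \<Longrightarrow> \<zero> \<in> B S" and B_one: "S \<subseteq> {1..n} \<Longrightarrow> \<one> \<in> B S"
  using subringE[OF B_subring] by auto

lemma B_minus: "S \<subseteq> {1..n} \<Longrightarrow> a \<in> B S \<Longrightarrow> \<ominus> a \<in> B S"
  using subringE(5)[OF B_subring] by auto

lemma B_mult: "S \<subseteq> {1..n} \<Longrightarrow> a \<in> B S \<Longrightarrow> b \<in> B S \<Longrightarrow> a \<otimes> b \<in> B S"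
  using subringE(6)[OF B_subring] by auto

lemma B_add: "S \<subseteq> {1..n} \<Longrightarrow> a \<in> B S \<Longrightarrow> b \<in> B S \<Longrightarrow> a \<oplus> b \<in> B S"
  using subringE(7)[OF B_subring] by auto

lemma B_diff: "S \<subseteq> {1..n} \<Longrightarrow> a \<in> B S \<Longrightarrow> b \<in> B S \<Longrightarrow> a \<ominus> b \<in> B S"
  unfolding a_minus_def by (intro B_add B_minus)

lemmas B_closed = B_zero B_one B_minus B_mult B_add B_diff

lemma x_in_B': "i \<in> S \<Longrightarrow> S \<subseteq> {1..n} \<Longrightarrow> x i \<in> B S"
  using x_in_B[of i] B_mono[of "{i}" S] by blast

lemma x_closed: "i \<in> {1..n} \<Longrightarrow> x i \<in> carrier A"
  using x_in_B[of i] B_carrier[of "{i}"] by auto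

lemma B_decompose:
  assumes "i \<in> {1..n}" and "a \<in> carrier A"
  obtains u v where "u \<in> B ({1..n} - {i})" "v \<in> B ({1..n} - {i})" "a = u \<oplus> v \<otimes> x i"
proof -
  have "insert i ({1..n} - {i}) = {1..n}"
    using assms(1) by auto
  then show ?thesis
    using B_insert[of "{1..n} - {i}" i a] assms B_full that by auto
qed

section \<open>Substitution of a value for one generator\<close>

text \<open>The decomposition is over all other generators, not only the earlier ones, so that the
  substitution acts on the whole ring and fixes the later \<open>x j\<close> too.\<close>

definition spec :: "nat \<Rightarrow> 'a \<Rightarrow> 'a \<Rightarrow> 'a" where
  "spec i s a = (THE w. \<exists>u\<in>B ({1..n} - {i}). \<exists>v\<in>B ({1..n} - {i}).
     a = u \<oplus> v \<otimes> x i \<and> w = u \<oplus> v \<otimes> s)"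

lemma spec_eq:
  assumes "i \<in> {1..n}" "u \<in> B ({1..n} - {i})" "v \<in> B ({1..n} - {i})"
  shows "spec i s (u \<oplus> v \<otimes> x i) = u \<oplus> v \<otimes> s"
  unfolding spec_def using assms B_direct[OF assms] by (intro the_equality) blast+

lemma spec_id:
  assumes "i \<in> {1..n}" "a \<in> B ({1..n} - {i})" "s \<in> carrier A"
  shows "spec i s a = a"
proof -
  have "a \<in> carrier A"
    using assms B_carrier by blast
  then show ?thesis
    using spec_eq[OF assms(1,2), of \<zero> s] x_closed assms B_zero by simp
qed

lemma spec_id':
  assumes "i \<in> {1..n}" "a \<in> B S" "S \<subseteq> {1..n} - {i}" "s \<in> carrier A"
  shows "spec i s a = a"
  using spec_id[OF assms(1) _ assms(4)] B_mono[OF assms(3)] assms(2) by blast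

lemma spec_x:
  assumes "i \<in> {1..n}" "s \<in> carrier A"
  shows "spec i s (x i) = s"
  using spec_eq[OF assms(1), of \<zero> \<one> s] x_closed assms B_zero B_one by simp

text \<open>The two values to be substituted. Like \<open>x i\<close> they are central with square
  1, which is what makes the substitution a ring endomorphism.\<close>

definition signs :: "'a set" where
  "signs = {\<one>, \<ominus> \<one>}"

lemma signs:
  assumes "s \<in> signs"
  shows "s \<in> carrier A" and "a \<in> carrier A \<Longrightarrow> s \<otimes> a = a \<otimes> s" and "s \<otimes> s = \<one>"
    and "S \<subseteq> {1..n} \<Longrightarrow> s \<in> B S"
  using assms B_closed by (auto simp: signs_def l_minus r_minus)

lemma spec_ring_hom:
  assumes i: "i \<in> {1..n}" and s: "s \<in> signs"
  shows "spec i s \<in> ring_hom A A"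
proof -
  note si = signs[OF s]
  let ?C = "{1..n} - {i}"
  have C: "?C \<subseteq> {1..n}" by auto
  note cl = B_closed[OF C] B_carrier[OF C] x_closed[OF i] si(1)
  show ?thesis
  proof (rule ring_hom_memI)
    show "spec i s a \<in> carrier A" if a: "a \<in> carrier A" for a
    proof -
      obtain u v where "u \<in> B ?C" "v \<in> B ?C" "a = u \<oplus> v \<otimes> x i"
        by (rule B_decompose[OF i a])
      then show ?thesis
        using cl by (simp add: spec_eq[OF i])
    qed
    show "spec i s \<one> = \<one>"
      using spec_id[OF i] cl by simp
    fix a b assume a: "a \<in> carrier A" and b: "b \<in> carrier A"
    obtain u v where uv: "u \<in> B ?C" "v \<in> B ?C" "a = u \<oplus> v \<otimes> x i"
      by (rule B_decompose[OF i a])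
    obtain u' v' where "u' \<in> B ?C" "v' \<in> B ?C" "b = u' \<oplus> v' \<otimes> x i"
      by (rule B_decompose[OF i b])
    note d = uv this
    have c: "u \<in> carrier A" "v \<in> carrier A" "u' \<in> carrier A" "v' \<in> carrier A"
      using d cl by auto
    have "a \<otimes> b = (u \<otimes> u' \<oplus> v \<otimes> v') \<oplus> (u \<otimes> v' \<oplus> v \<otimes> u') \<otimes> x i"
      unfolding d using c cl x_comm[OF i] x_sq[OF i]
      by (intro mult_adjoined_root_of_one)
    then have "spec i s (a \<otimes> b) = (u \<otimes> u' \<oplus> v \<otimes> v') \<oplus> (u \<otimes> v' \<oplus> v \<otimes> u') \<otimes> s"
      using d cl by (simp add: spec_eq[OF i])
    also have "\<dots> = (u \<oplus> v \<otimes> s) \<otimes> (u' \<oplus> v' \<otimes> s)"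
      using c si by (intro mult_adjoined_root_of_one[symmetric])
    finally show "spec i s (a \<otimes> b) = spec i s a \<otimes> spec i s b"
      using d by (simp add: spec_eq[OF i])
    have "a \<oplus> b = (u \<oplus> u') \<oplus> (v \<oplus> v') \<otimes> x i"
      unfolding d using c cl by (simp add: l_distr a_ac)
    then have "spec i s (a \<oplus> b) = (u \<oplus> u') \<oplus> (v \<oplus> v') \<otimes> s"
      using d cl by (simp add: spec_eq[OF i])
    then show "spec i s (a \<oplus> b) = spec i s a \<oplus> spec i s b"
      unfolding d(3,6) spec_eq[OF i d(1,2)] spec_eq[OF i d(4,5)]
      using c cl by (simp add: l_distr a_ac)
  qed
qed

lemma spec_ring_hom_ring:
  "i \<in> {1..n} \<Longrightarrow> s \<in> signs \<Longrightarrow> ring_hom_ring A A (spec i s)"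
  by (intro ring_hom_ringI2 spec_ring_hom) (rule ring_axioms)+

lemma spec_in_B:
  assumes i: "i \<in> {1..n}" and s: "s \<in> signs" and S: "S \<subseteq> {1..n}" and a: "a \<in> B S"
  shows "spec i s a \<in> B (S - {i})"
proof -
  \<comment> \<open>Adding \<open>i\<close> before decomposing treats the cases
    \<open>i \<in> S\<close> and \<open>i \<notin> S\<close> alike.\<close>
  have "a \<in> B (insert i (S - {i}))"
    using a B_mono[of S "insert i (S - {i})"] i S by auto
  then obtain u v where uv: "u \<in> B (S - {i})" "v \<in> B (S - {i})" "a = u \<oplus> v \<otimes> x i"
    using B_insert[of "S - {i}" i a] i S by auto
  then have "u \<in> B ({1..n} - {i})" "v \<in> B ({1..n} - {i})"
    using B_mono[of "S - {i}" "{1..n} - {i}"] S by auto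
  then have "spec i s a = u \<oplus> v \<otimes> s"
    using uv spec_eq[OF i] by simp
  moreover have "S - {i} \<subseteq> {1..n}"
    using S by auto
  ultimately show ?thesis
    using uv signs(4)[OF s] by (simp add: B_closed)
qed

section \<open>The elements \<open>1 - x i\<close>\<close>

definition E :: "nat \<Rightarrow> 'a" where
  "E i = \<one> \<ominus> x i"

lemma E_in_B: "i \<in> S \<Longrightarrow> S \<subseteq> {1..n} \<Longrightarrow> E i \<in> B S"
  unfolding E_def by (intro B_diff B_one x_in_B')

lemma E_closed: "i \<in> {1..n} \<Longrightarrow> E i \<in> carrier A"
  by (simp add: E_def x_closed)

lemma E_comm: "i \<in> {1..n} \<Longrightarrow> a \<in> carrier A \<Longrightarrow> E i \<otimes> a = a \<otimes> E i"
  by (simp add: E_def a_minus_def l_distr r_distr l_minus r_minus x_closed x_comm)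

lemma E_sq: "i \<in> {1..n} \<Longrightarrow> E i \<otimes> E i = E i \<oplus> E i"
  by (simp add: E_def a_minus_def l_distr r_distr l_minus r_minus x_closed x_sq minus_add a_ac)

lemma spec_one_E: "i \<in> {1..n} \<Longrightarrow> spec i \<one> (E i) = \<zero>"
proof -
  assume i: "i \<in> {1..n}"
  interpret h: ring_hom_ring A A "spec i \<one>"
    using i by (intro spec_ring_hom_ring) (simp_all add: signs_def)
  show ?thesis
    using i by (simp add: E_def a_minus_def x_closed spec_x r_neg)
qed

lemma spec_minus_one_E: "i \<in> {1..n} \<Longrightarrow> spec i (\<ominus> \<one>) (E i) = \<one> \<oplus> \<one>"
proof -
  assume i: "i \<in> {1..n}"
  interpret h: ring_hom_ring A A "spec i (\<ominus> \<one>)"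
    using i by (intro spec_ring_hom_ring) (simp_all add: signs_def)
  show ?thesis
    using i by (simp add: E_def a_minus_def x_closed spec_x)
qed

text \<open>\<open>u + w x = (u + w) - w (1 - x)\<close>: the value at \<open>x = 1\<close> plus a
  multiple of \<open>1 - x\<close>, with coefficient \<open>-w\<close>.\<close>

lemma B_insert_E:
  assumes "S \<subseteq> {1..n}" "i \<in> {1..n} - S" "a \<in> B (insert i S)"
  obtains v where "v \<in> B S" "a = spec i \<one> a \<oplus> v \<otimes> E i"
proof -
  obtain u w where uw: "u \<in> B S" "w \<in> B S" "a = u \<oplus> w \<otimes> x i"
    using B_insert[OF assms] by auto
  then have "u \<in> B ({1..n} - {i})" "w \<in> B ({1..n} - {i})"
    using B_mono[of S "{1..n} - {i}"] assms by auto
  then have "spec i \<one> a = u \<oplus> w"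
    using uw spec_eq[of i u w \<one>] assms B_carrier[OF assms(1)] by simp
  moreover have "u \<oplus> w \<otimes> x i = u \<oplus> w \<oplus> (\<ominus> w) \<otimes> E i"
    using uw assms B_carrier[OF assms(1)] x_closed[of i]
    by (simp add: E_def a_minus_def r_distr l_minus r_minus a_assoc r_neg2)
  ultimately show ?thesis
    using that[of "\<ominus> w"] uw B_minus[OF assms(1)] by simp
qed

section \<open>Unit groups of the subrings and the kernels \<open>K i\<close>\<close>

definition W :: "nat set \<Rightarrow> 'a set" where
  "W S = Units (A\<lparr>carrier := B S\<rparr>)"

lemma W_iff: "a \<in> W S \<longleftrightarrow> a \<in> B S \<and> (\<exists>b\<in>B S. a \<otimes> b = \<one> \<and> b \<otimes> a = \<one>)"
  by (auto simp: W_def Units_def)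

lemma W_Units: "S \<subseteq> {1..n} \<Longrightarrow> W S \<subseteq> Units A"
  using B_carrier[of S] unfolding W_def Units_def by auto

lemma W_carrier: "S \<subseteq> {1..n} \<Longrightarrow> a \<in> W S \<Longrightarrow> a \<in> carrier A"
  using W_Units Units_closed by blast

lemma W_mono: "S \<subseteq> T \<Longrightarrow> T \<subseteq> {1..n} \<Longrightarrow> W S \<subseteq> W T"
  using B_mono[of S T] unfolding W_def Units_def by auto

lemma W_full: "W {1..n} = Units A"
  by (simp add: W_def B_full)

lemma W_subgroup:
  assumes S: "S \<subseteq> {1..n}"
  shows "subgroup (W S) M"
proof (rule group.subgroupI[OF M_group])
  show "W S \<subseteq> carrier M"
    using W_Units[OF S] by simp
  show "W S \<noteq> {}"
    using B_one[OF S] by (force simp: W_iff)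
  show "inv\<^bsub>M\<^esub> a \<in> W S" if a: "a \<in> W S" for a
  proof -
    obtain b where b: "a \<in> B S" "b \<in> B S" "a \<otimes> b = \<one>" "b \<otimes> a = \<one>"
      using a by (auto simp: W_iff)
    then have "inv a = b"
      using inv_unique'[of a b] B_carrier[OF S] by auto
    moreover have "inv\<^bsub>M\<^esub> a = inv a"
      using a W_Units[OF S] inv_M by blast
    ultimately show ?thesis
      using b W_iff[of b] \<open>inv a = b\<close> by auto
  qed
  show "a \<otimes>\<^bsub>M\<^esub> b \<in> W S" if ab: "a \<in> W S" "b \<in> W S" for a b
  proof -
    obtain a' b' where c: "a \<in> B S" "a' \<in> B S" "a \<otimes> a' = \<one>" "a' \<otimes> a = \<one>"
       "b \<in> B S" "b' \<in> B S" "b \<otimes> b' = \<one>" "b' \<otimes> b = \<one>"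
      using ab by (auto simp: W_iff)
    have cc: "a \<in> carrier A" "b \<in> carrier A" "a' \<in> carrier A" "b' \<in> carrier A"
      using c B_carrier[OF S] by auto
    have "(a \<otimes> b) \<otimes> (b' \<otimes> a') = a \<otimes> (b \<otimes> b') \<otimes> a'"
      "(b' \<otimes> a') \<otimes> (a \<otimes> b) = b' \<otimes> (a' \<otimes> a) \<otimes> b"
      using cc by (simp_all add: m_assoc)
    then have "(a \<otimes> b) \<otimes> (b' \<otimes> a') = \<one>" "(b' \<otimes> a') \<otimes> (a \<otimes> b) = \<one>"
      using c cc by simp_all
    then show ?thesis
      using c B_mult[OF S] by (auto simp: W_iff)
  qed
qed

lemma ring_hom_W:
  assumes h: "h \<in> ring_hom A A" and "h ` B S \<subseteq> B T" and "S \<subseteq> {1..n}" and "a \<in> W S"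
  shows "h a \<in> W T"
proof -
  obtain b where b: "a \<in> B S" "b \<in> B S" "a \<otimes> b = \<one>" "b \<otimes> a = \<one>"
    using assms by (auto simp: W_iff)
  then have "a \<in> carrier A" "b \<in> carrier A"
    using B_carrier[OF assms(3)] by auto
  then have "h a \<otimes> h b = \<one>" "h b \<otimes> h a = \<one>"
    using b by (simp_all add: ring_hom_mult[OF h, symmetric] ring_hom_one[OF h])
  then show ?thesis
    using b assms(2) by (auto simp: W_iff)
qed

lemma spec_W:
  assumes "i \<in> {1..n}" "s \<in> signs" "S \<subseteq> {1..n}" "a \<in> W S"
  shows "spec i s a \<in> W (S - {i})"
  using ring_hom_W[OF spec_ring_hom[OF assms(1,2)] _ assms(3,4)] spec_in_B[OF assms(1-3)] by blast

lemma one_sign: "\<one> \<in> signs" and minus_one_sign: "\<ominus> \<one> \<in> signs"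
  by (simp_all add: signs_def)

lemma spec_hom: "i \<in> {1..n} \<Longrightarrow> s \<in> signs \<Longrightarrow> spec i s \<in> hom M M"
  by (intro ring_hom_units spec_ring_hom)

definition K :: "nat \<Rightarrow> 'a set" where
  "K i = {k \<in> W {1..i}. spec i \<one> k = \<one>}"

lemma interval_minus: "{1..i} - {i} = {1..i - 1}" for i :: nat
  by auto

lemma K_semidirect:
  assumes i: "i \<in> {1..n}"
  shows "internal_semidirect M (K i) (W {1..i - 1}) (W {1..i})"
proof -
  have sub: "{1..i} \<subseteq> {1..n}" "{1..i - 1} \<subseteq> {1..n} - {i}"
    using i by auto
  have into: "spec i \<one> a \<in> W {1..i - 1}" if "a \<in> W {1..i}" for a
    using spec_W[OF i one_sign sub(1) that] by (simp add: interval_minus)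
  have fixed: "spec i \<one> a = a" if "a \<in> W {1..i - 1}" for a
    using that spec_id'[OF i _ sub(2)] by (auto simp: W_iff)
  have mono: "W {1..i - 1} \<subseteq> W {1..i}"
    using sub by (intro W_mono) auto
  have "internal_semidirect M {k \<in> W {1..i}. spec i \<one> k = \<one>\<^bsub>M\<^esub>} (spec i \<one> ` W {1..i}) (W {1..i})"
    using i into fixed mono
    by (intro group.idempotent_hom_semidirect[OF M_group] W_subgroup sub spec_hom one_sign) auto
  moreover have "spec i \<one> ` W {1..i} = W {1..i - 1}"
    using into fixed mono by (force simp: image_iff)
  ultimately show ?thesis
    by (simp add: K_def)
qed

lemma K_subgroup: "i \<in> {1..n} \<Longrightarrow> subgroup (K i) M"
  using group.internal_semidirectD(2)[OF M_group K_semidirect] .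

text \<open>The groups interpolating between \<open>K i\<close> (at \<open>m = i - 1\<close>) and the factors \<open>K\<^sub>j\<close> (at \<open>m = 0\<close>).\<close>

definition L :: "nat \<Rightarrow> nat \<Rightarrow> 'a \<Rightarrow> 'a set" where
  "L i m p = {\<one> \<oplus> v \<otimes> p |v. v \<in> B {1..m}} \<inter> W {1..i}"

lemma K_eq_L:
  assumes i: "i \<in> {1..n}"
  shows "K i = L i (i - 1) (E i)"
proof -
  have sub: "{1..i - 1} \<subseteq> {1..n}" "{1..i - 1} \<subseteq> {1..n} - {i}" "i \<in> {1..n} - {1..i - 1}"
      "{1..i} = insert i {1..i - 1}"
    using i by auto
  interpret h: ring_hom_ring A A "spec i \<one>"
    by (rule spec_ring_hom_ring[OF i one_sign])
  have "\<exists>v\<in>B {1..i - 1}. k = \<one> \<oplus> v \<otimes> E i" if "k \<in> K i" for k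
    using that B_insert_E[OF sub(1,3), of k] sub(4) by (auto simp: K_def W_iff)
  moreover have "spec i \<one> (\<one> \<oplus> v \<otimes> E i) = \<one>" if "v \<in> B {1..i - 1}" for v
    using that B_carrier[OF sub(1) that] E_closed[OF i] spec_one_E[OF i] by simp
  ultimately show ?thesis
    by (auto simp: K_def L_def)
qed

text \<open>Putting \<open>x (m + 1) = 1\<close> fixes \<open>p\<close>, which involves later
  generators only, and so acts on \<open>v\<close> alone. The image retains a coefficient in the
  first \<open>m\<close> generators; on the kernel the factor \<open>1 - x (m + 1)\<close> splits
  off. That \<open>L i (Suc m) p\<close> is a subgroup is supplied by the preceding
  splitting.\<close>

lemma L_semidirect:
  assumes "Suc m < i" "i \<in> {1..n}" and p: "p \<in> B {Suc (Suc m)..i}"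
    and L: "subgroup (L i (Suc m) p) M"
  shows "internal_semidirect M (L i m (E (Suc m) \<otimes> p)) (L i m p) (L i (Suc m) p)"
proof -
  let ?t = "Suc m"
  have t: "?t \<in> {1..n}" "?t \<in> {1..n} - {1..m}"
    using assms by auto
  have sub: "{1..m} \<subseteq> {1..n}" "{1..m} \<subseteq> {1..n} - {?t}" "{1..?t} = insert ?t {1..m}"
    "{Suc (Suc m)..i} \<subseteq> {1..n} - {?t}" "{Suc (Suc m)..i} \<subseteq> {1..n}" "{1..i} \<subseteq> {1..n}"
    using assms by auto
  interpret h: ring_hom_ring A A "spec ?t \<one>"
    by (rule spec_ring_hom_ring[OF t(1) one_sign])
  have pc: "p \<in> carrier A" "spec ?t \<one> p = p"
    using p B_carrier[OF sub(5)] spec_id'[OF t(1) p sub(4)] by auto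
  have into: "spec ?t \<one> v \<in> B {1..m}" if "v \<in> B {1..?t}" for v
    using spec_in_B[OF t(1) one_sign _ that] assms interval_minus[of ?t] by auto
  have spec_elem: "spec ?t \<one> (\<one> \<oplus> v \<otimes> p) = \<one> \<oplus> spec ?t \<one> v \<otimes> p" if "v \<in> B {1..?t}" for v
    using that pc B_carrier[of "{1..?t}" v] t by auto
  have fixed: "spec ?t \<one> v = v" if "v \<in> B {1..m}" for v
    using spec_id'[OF t(1) that sub(2)] by simp
  have mono: "B {1..m} \<subseteq> B {1..?t}"
    using t by (intro B_mono) auto
  have specW: "spec ?t \<one> a \<in> W {1..i}" if "a \<in> W {1..i}" for a
    using spec_W[OF t(1) one_sign sub(6) that] W_mono[of "{1..i} - {?t}" "{1..i}"] sub(6) by auto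
  have img: "spec ?t \<one> ` L i ?t p = L i m p"
  proof
    show "spec ?t \<one> ` L i ?t p \<subseteq> L i m p"
      using into specW spec_elem by (fastforce simp: L_def)
    show "L i m p \<subseteq> spec ?t \<one> ` L i ?t p"
    proof
      fix a assume "a \<in> L i m p"
      then obtain v where v: "v \<in> B {1..m}" "a = \<one> \<oplus> v \<otimes> p" "a \<in> W {1..i}"
        by (auto simp: L_def)
      then have "a \<in> L i ?t p" "spec ?t \<one> a = a"
        using mono spec_elem[of v] fixed[of v] by (auto simp: L_def)
      then show "a \<in> spec ?t \<one> ` L i ?t p"
        by (metis image_eqI)
    qed
  qed
  have ker: "{a \<in> L i ?t p. spec ?t \<one> a = \<one>} = L i m (E ?t \<otimes> p)"
  proof (intro equalityI subsetI)
    fix a assume "a \<in> {a \<in> L i ?t p. spec ?t \<one> a = \<one>}"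
    then obtain v where v: "v \<in> B {1..?t}" "a = \<one> \<oplus> v \<otimes> p" "a \<in> W {1..i}" "spec ?t \<one> a = \<one>"
      by (auto simp: L_def)
    obtain b where b: "b \<in> B {1..m}" "v = spec ?t \<one> v \<oplus> b \<otimes> E ?t"
      using B_insert_E[OF sub(1) t(2), of v] v sub(3) by auto
    define u where "u = spec ?t \<one> v"
    \<comment> \<open>Membership in the kernel yields \<open>u p = 0\<close> rather than
      \<open>u = 0\<close>; this already removes the contribution of \<open>u\<close> to
      \<open>a\<close>.\<close>
    have u: "u \<in> carrier A" "b \<in> carrier A" "v = u \<oplus> b \<otimes> E ?t" "\<one> \<oplus> u \<otimes> p = \<one>"
      using b v spec_elem into B_carrier[OF sub(1)] unfolding u_def by auto
    have "a = (\<one> \<oplus> u \<otimes> p) \<oplus> b \<otimes> (E ?t \<otimes> p)"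
      using v(2) u(1-3) pc E_closed[OF t(1)] by (simp add: l_distr m_assoc a_assoc)
    then show "a \<in> L i m (E ?t \<otimes> p)"
      using u(4) b v by (auto simp: L_def)
  next
    fix a assume "a \<in> L i m (E ?t \<otimes> p)"
    then obtain b where b: "b \<in> B {1..m}" "a = \<one> \<oplus> b \<otimes> (E ?t \<otimes> p)" "a \<in> W {1..i}"
      by (auto simp: L_def)
    have c: "b \<in> carrier A" "E ?t \<in> carrier A"
      using b B_carrier[OF sub(1)] E_closed[OF t(1)] by auto
    have "b \<otimes> E ?t \<in> B {1..?t}" "a = \<one> \<oplus> (b \<otimes> E ?t) \<otimes> p"
      using b c pc mono E_in_B[of ?t "{1..?t}"] B_mult[of "{1..?t}"] t by (auto simp: m_assoc)
    moreover have "spec ?t \<one> a = \<one>"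
      using b(2) c pc spec_one_E[OF t(1)] by simp
    ultimately show "a \<in> {a \<in> L i ?t p. spec ?t \<one> a = \<one>}"
      using b(3) by (auto simp: L_def)
  qed
  have "spec ?t \<one> (spec ?t \<one> a) = spec ?t \<one> a" if "a \<in> L i ?t p" for a
  proof -
    have "spec ?t \<one> a \<in> L i m p"
      using img that by blast
    then show ?thesis
      using spec_elem fixed mono by (auto simp: L_def)
  qed
  moreover have "spec ?t \<one> ` L i ?t p \<subseteq> L i ?t p"
    unfolding img using mono by (auto simp: L_def)
  ultimately have "internal_semidirect M {a \<in> L i ?t p. spec ?t \<one> a = \<one>\<^bsub>M\<^esub>}
      (spec ?t \<one> ` L i ?t p) (L i ?t p)"
    by (intro group.idempotent_hom_semidirect[OF M_group L spec_hom[OF t(1) one_sign]]) auto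
  then show ?thesis
    unfolding img by (simp add: ker)
qed

text \<open>A composite of single substitutions, highest generator first, so that each one meets an
  element of a smaller ring. The values -1 will give the map onto the congruence groups; the values
  1 erase generators from products of the \<open>x t\<close>.\<close>

lemma evaluation_exists:
  assumes "k \<le> m" "m \<le> n" and s: "\<And>t. s t \<in> signs"
  shows "\<exists>h\<in>ring_hom A A. (\<forall>a\<in>B {1..k}. h a = a) \<and> h ` B {1..m} \<subseteq> B {1..k}
    \<and> (\<forall>t\<in>{k<..m}. h (x t) = s t)"
  using assms(1,2)
proof (induction m rule: dec_induct)
  case base
  have "(\<lambda>a. a) \<in> ring_hom A A"
    by (rule ring_hom_memI) auto
  then show ?case by force
next
  case (step m)
  then obtain h where h: "h \<in> ring_hom A A" "\<forall>a\<in>B {1..k}. h a = a" "h ` B {1..m} \<subseteq> B {1..k}"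
      "\<forall>t\<in>{k<..m}. h (x t) = s t"
    using Suc_leD by blast
  let ?t = "Suc m"
  let ?g = "spec ?t (s ?t)"
  have t: "?t \<in> {1..n}" "{1..?t} \<subseteq> {1..n}" "{1..?t} - {?t} = {1..m}"
    using step by auto
  note sc = signs(1)[OF s]
  have "h \<circ> ?g \<in> ring_hom A A"
    using ring_hom_trans[OF spec_ring_hom[OF t(1) s] h(1)] by simp
  moreover have "\<forall>a\<in>B {1..k}. (h \<circ> ?g) a = a"
  proof
    fix a assume a: "a \<in> B {1..k}"
    have "{1..k} \<subseteq> {1..n} - {?t}"
      using step.hyps step.prems by auto
    then show "(h \<circ> ?g) a = a"
      using h(2) a spec_id'[OF t(1) a _ sc] by simp
  qed
  moreover have "(h \<circ> ?g) ` B {1..?t} \<subseteq> B {1..k}"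
  proof clarify
    fix a assume "a \<in> B {1..?t}"
    then have "?g a \<in> B {1..m}"
      using spec_in_B[OF t(1) s t(2)] t(3) by metis
    then show "(h \<circ> ?g) a \<in> B {1..k}"
      using h(3) by auto
  qed
  moreover have "(h \<circ> ?g) (x t) = s t" if "t \<in> {k<..?t}" for t
  proof (cases "t = ?t")
    case True
    have "s ?t \<in> B {1..k}"
      using step.hyps step.prems by (intro signs(4)[OF s]) auto
    then show ?thesis
      using True h(2) spec_x[OF t(1) sc] by simp
  next
    case False
    then have xt: "x t \<in> B {t}" "{t} \<subseteq> {1..n} - {?t}" "t \<in> {k<..m}"
      using that step.hyps step.prems x_in_B[of t] by auto
    then show ?thesis
      using h(4) spec_id'[OF t(1) xt(1,2) sc] by simp
  qed
  ultimately show ?case by blast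
qed

section \<open>Products of the elements \<open>1 - x t\<close>\<close>

text \<open>A tail of the factor attached to \<open>j\<close>: \<open>m = 0\<close> gives the whole
  product, \<open>m = i - 1\<close> only \<open>1 - x i\<close>. In \<open>L i m\<close> the free
  coefficient \<open>v\<close> takes the place of the dropped factors, those of the first
  \<open>m\<close> generators.\<close>

definition Fac :: "nat \<Rightarrow> (nat \<Rightarrow> nat) \<Rightarrow> nat \<Rightarrow> 'a" where
  "Fac i j m = foldr (\<lambda>t p. (E t [^] j t) \<otimes> p) [Suc m..<i] (E i)"

abbreviation exponents :: "nat \<Rightarrow> (nat \<Rightarrow> nat) set" where
  "exponents i \<equiv> {1..i - 1} \<rightarrow>\<^sub>E {0, 1}"


lemma foldr_E_in_B:
  fixes j :: "nat \<Rightarrow> nat"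
  assumes "S \<subseteq> {1..n}" "set ts \<subseteq> S" "i \<in> S" "\<forall>t\<in>set ts. j t \<in> {0, 1}"
  shows "foldr (\<lambda>t p. (E t [^] j t) \<otimes> p) ts (E i) \<in> B S"
  using assms
proof (induction ts)
  case Nil
  then show ?case by (simp add: E_in_B)
next
  case (Cons t ts)
  have "E t \<in> B S" "E t \<in> carrier A"
    using Cons.prems E_in_B E_closed by auto
  then have "E t [^] j t \<in> B S"
    using Cons.prems B_one by auto
  then show ?case
    using Cons B_mult by auto
qed

lemma add_pow_closed: "a \<in> carrier A \<Longrightarrow> add_pow A (k :: nat) a \<in> carrier A"
  by (rule add.nat_pow_closed)

lemma add_pow_double:
  "a \<in> carrier A \<Longrightarrow> add_pow A ((2::nat) ^ Suc k) a = add_pow A ((2::nat) ^ k) a \<oplus> add_pow A ((2::nat) ^ k) a"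
  using add.nat_pow_mult[of a "2 ^ k" "2 ^ k"] by (simp add: mult_2)

lemma add_pow_two: "a \<in> carrier A \<Longrightarrow> add_pow A (2::nat) a = a \<oplus> a"
  using add_pow_double[of a 0] add.nat_pow_eone[of a] by simp

lemma add_pow_l: "a \<in> carrier A \<Longrightarrow> b \<in> carrier A \<Longrightarrow> add_pow A (k :: nat) a \<otimes> b = add_pow A k (a \<otimes> b)"
  by (rule add_pow_ldistr)

lemma add_pow_r: "a \<in> carrier A \<Longrightarrow> b \<in> carrier A \<Longrightarrow> a \<otimes> add_pow A (k :: nat) b = add_pow A k (a \<otimes> b)"
  by (rule add_pow_rdistr)

lemma add_pow_2_eq_zero: "a \<in> carrier A \<Longrightarrow> add_pow A ((2::nat) ^ k) a = \<zero> \<Longrightarrow> a = \<zero>"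
proof (induction k)
  case 0
  then show ?case
    using add.nat_pow_eone[of a] by simp
next
  case (Suc k)
  then show ?case
    using double_eq_zero[of "add_pow A ((2::nat) ^ k) a"] add_pow_closed
    by (simp only: add_pow_double)
qed

text \<open>Every factor with exponent 1 doubles both numbers: \<open>E t\<close> has square
  \<open>2 E t\<close> and takes the value 2 at \<open>x t = -1\<close>. So \<open>c\<close> counts
  these factors, its leading 1 standing for the final \<open>E i\<close>. An arbitrary list
  \<open>ts\<close> makes the induction possible.\<close>

lemma foldr_E:
  fixes j :: "nat \<Rightarrow> nat"
  assumes "set ts \<subseteq> {1..n}" "i \<in> {1..n}" "\<forall>t\<in>set ts. j t \<in> {0, 1}"
  defines "p \<equiv> foldr (\<lambda>t p. (E t [^] j t) \<otimes> p) ts (E i)"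
    and "c \<equiv> 1 + sum_list (map j ts)"
  shows "p \<in> carrier A" "\<And>a. a \<in> carrier A \<Longrightarrow> p \<otimes> a = a \<otimes> p"
    "p \<otimes> p = add_pow A ((2::nat) ^ c) p"
    "\<And>h. h \<in> ring_hom A A \<Longrightarrow> \<forall>t\<in>insert i (set ts). h (x t) = \<ominus> \<one> \<Longrightarrow> h p = add_pow A ((2::nat) ^ c) \<one>"
proof -
  have hE: "h (E t) = \<one> \<oplus> \<one>" if "h \<in> ring_hom A A" "h (x t) = \<ominus> \<one>" "t \<in> {1..n}" for h t
  proof -
    interpret h: ring_hom_ring A A h
      using that(1) by (intro ring_hom_ringI2) (rule ring_axioms)+
    show ?thesis
      using that x_closed[of t] by (simp add: E_def a_minus_def)
  qed
  define central where "central q \<longleftrightarrow> (\<forall>a\<in>carrier A. q \<otimes> a = a \<otimes> q)" for q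
  have "p \<in> carrier A \<and> central p \<and>
    p \<otimes> p = add_pow A ((2::nat) ^ c) p \<and>
    (\<forall>h\<in>ring_hom A A. (\<forall>t\<in>insert i (set ts). h (x t) = \<ominus> \<one>) \<longrightarrow> h p = add_pow A ((2::nat) ^ c) \<one>)"
    using assms(1,3) unfolding p_def c_def
  proof (induction ts)
    case Nil
    have central: "central (E i)"
      using E_comm[OF assms(2)] by (simp add: central_def)
    have "h (E i) = add_pow A (2::nat) \<one>" if "h \<in> ring_hom A A" "h (x i) = \<ominus> \<one>" for h
      using hE[OF that assms(2)] by (simp add: add_pow_two)
    then show ?case
      using E_closed[OF assms(2)] E_sq[OF assms(2)] central
        add_pow_two[OF E_closed[OF assms(2)]] by simp
  next
    case (Cons t ts)
    define q where "q = foldr (\<lambda>t p. (E t [^] j t) \<otimes> p) ts (E i)"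
    define d where "d = 1 + sum_list (map j ts)"
    have IH: "q \<in> carrier A" "central q"
      "q \<otimes> q = add_pow A ((2::nat) ^ d) q"
      "\<And>h. h \<in> ring_hom A A \<Longrightarrow> \<forall>t\<in>insert i (set ts). h (x t) = \<ominus> \<one> \<Longrightarrow> h q = add_pow A ((2::nat) ^ d) \<one>"
      using Cons unfolding q_def d_def by auto
    have q_comm: "q \<otimes> a = a \<otimes> q" if "a \<in> carrier A" for a
      using IH(2) that by (simp add: central_def)
    have t: "t \<in> {1..n}" and e: "E t \<in> carrier A"
      using Cons.prems E_closed by auto
    show ?case
    proof (cases "j t = 0")
      case True
      then show ?thesis
        using IH unfolding q_def d_def by auto
    next
      case False
      then have jt: "j t = 1"
        using Cons.prems by auto
      have eq: "E t [^] j t = E t"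
        using e jt by simp
      have comm: "E t \<otimes> q \<otimes> a = a \<otimes> (E t \<otimes> q)" if "a \<in> carrier A" for a
      proof -
        have "E t \<otimes> q \<otimes> a = E t \<otimes> a \<otimes> q"
          using IH(1) e that by (simp add: m_assoc q_comm[OF that])
        then show ?thesis
          using IH(1) e that by (simp add: m_assoc E_comm[OF t that])
      qed
      have "E t \<otimes> q \<otimes> (E t \<otimes> q) = (E t \<otimes> E t) \<otimes> (q \<otimes> q)"
        using IH(1) e by (simp add: m_assoc) (simp add: m_assoc[symmetric] q_comm[OF e])
      also have "\<dots> = add_pow A ((2::nat) ^ d) (E t \<otimes> q) \<oplus> add_pow A ((2::nat) ^ d) (E t \<otimes> q)"
        using IH(1) e by (simp add: IH(3) E_sq[OF t] l_distr add_pow_r add_pow_closed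
            add.nat_pow_distrib)
      finally have sq: "E t \<otimes> q \<otimes> (E t \<otimes> q) = add_pow A ((2::nat) ^ Suc d) (E t \<otimes> q)"
        using IH(1) e by (simp only: add_pow_double m_closed)
      have hq: "h (E t \<otimes> q) = add_pow A ((2::nat) ^ Suc d) \<one>"
        if h: "h \<in> ring_hom A A" "\<forall>t\<in>insert i (set (t # ts)). h (x t) = \<ominus> \<one>" for h
      proof -
        have "h (E t \<otimes> q) = h (E t) \<otimes> h q"
          using ring_hom_mult[OF h(1) e IH(1)] .
        also have "\<dots> = (\<one> \<oplus> \<one>) \<otimes> add_pow A ((2::nat) ^ d) \<one>"
          using IH(4) hE[OF h(1) _ t] h by simp
        also have "\<dots> = add_pow A ((2::nat) ^ Suc d) \<one>"
          using add_pow_double[of \<one> d] by (simp add: l_distr add_pow_closed)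
        finally show ?thesis .
      qed
      have "E t \<otimes> q \<in> carrier A"
        using e IH(1) by simp
      moreover have exponent: "1 + sum_list (map j (t # ts)) = Suc d"
        by (simp add: d_def jt)
      moreover have product: "foldr (\<lambda>t p. (E t [^] j t) \<otimes> p) (t # ts) (E i) = E t \<otimes> q"
        by (simp add: q_def eq)
      moreover have "central (E t \<otimes> q)"
        using comm by (simp only: central_def) blast
      ultimately show ?thesis
        unfolding exponent product using sq hq by blast
    qed
  qed
  then show "p \<in> carrier A" "\<And>a. a \<in> carrier A \<Longrightarrow> p \<otimes> a = a \<otimes> p"
    "p \<otimes> p = add_pow A ((2::nat) ^ c) p"
    "\<And>h. h \<in> ring_hom A A \<Longrightarrow> \<forall>t\<in>insert i (set ts). h (x t) = \<ominus> \<one> \<Longrightarrow> h p = add_pow A ((2::nat) ^ c) \<one>"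
    unfolding central_def by blast+
qed

lemma Fac_in_B:
  assumes "i \<in> {1..n}" "m < i" "j \<in> exponents i"
  shows "Fac i j m \<in> B {Suc m..i}"
proof -
  have "j t \<in> {0, 1}" if "t \<in> set [Suc m..<i]" for t
    using PiE_mem[OF assms(3), of t] that by auto
  then show ?thesis
    unfolding Fac_def using assms by (intro foldr_E_in_B) auto
qed

lemma Fac_step:
  assumes "Suc m < i"
  shows "Fac i j m = (E (Suc m) [^] j (Suc m)) \<otimes> Fac i j (Suc m)"
  using assms by (simp add: Fac_def upt_conv_Cons)

lemma Fac_step_0:
  assumes "i \<in> {1..n}" "Suc m < i" "j \<in> exponents i" "j (Suc m) = 0"
  shows "Fac i j m = Fac i j (Suc m)"
proof -
  have "Fac i j (Suc m) \<in> carrier A"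
    using Fac_in_B[OF assms(1,2,3)] B_carrier[of "{Suc (Suc m)..i}"] assms by auto
  then show ?thesis
    using assms by (simp add: Fac_step)
qed

lemma Fac_step_1:
  assumes "i \<in> {1..n}" "Suc m < i" "j (Suc m) = 1"
  shows "Fac i j m = E (Suc m) \<otimes> Fac i j (Suc m)"
  using assms E_closed[of "Suc m"] by (simp add: Fac_step)

lemma Fac_cong:
  "(\<And>t. m < t \<Longrightarrow> t < i \<Longrightarrow> j t = j' t) \<Longrightarrow> Fac i j m = Fac i j' m"
  unfolding Fac_def by (intro foldr_cong) auto

section \<open>Iterated splitting of \<open>K i\<close>\<close>

text \<open>Descends from \<open>K i\<close>, the case \<open>m = i - 1\<close>. Each splitting
  produces two subgroups; \<open>j (m + 1) = 1\<close> selects the normal one and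
  \<open>j (m + 1) = 0\<close> its complement.\<close>

lemma L_Fac_subgroup:
  assumes i: "i \<in> {1..n}" and "m \<le> i - 1" and j: "j \<in> exponents i"
  shows "subgroup (L i m (Fac i j m)) M"
  using assms(2)
proof (induction rule: inc_induct)
  case base
  have "Fac i j (i - 1) = E i"
    using i by (simp add: Fac_def)
  then show ?case
    using K_subgroup[OF i] K_eq_L[OF i] by simp
next
  case (step m)
  then have m: "Suc m < i" by simp
  have sd: "internal_semidirect M (L i m (E (Suc m) \<otimes> Fac i j (Suc m))) (L i m (Fac i j (Suc m)))
      (L i (Suc m) (Fac i j (Suc m)))"
    using L_semidirect[OF m i Fac_in_B[OF i m j] step.IH] .
  have "j (Suc m) \<in> {0, 1}"
    using PiE_mem[OF j, of "Suc m"] m by auto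
  then consider "j (Suc m) = 0" | "j (Suc m) = 1"
    by auto
  then show ?case
    using group.internal_semidirectD(2,3)[OF M_group sd] Fac_step_0[OF i m j] Fac_step_1[OF i m]
    by cases auto
qed

text \<open>A binary tree over the first \<open>m\<close> coordinates, the later ones being frozen
  at those of \<open>j\<close>. At each node the vectors with value 1 in the highest free coordinate
  form the normal left branch, so the leaves appear in decreasing lexicographic order, read from the
  last coordinate to the first.\<close>

lemma L_bracketing:
  assumes i: "i \<in> {1..n}" and "m \<le> i - 1" and "j \<in> exponents i"
  shows "\<exists>b. distinct (factor_list b) \<and>
    set (factor_list b) = {j' \<in> exponents i. \<forall>t\<in>{m<..i - 1}. j' t = j t} \<and>
    iterated_semidirect M (map_bracketing (\<lambda>j. L i 0 (Fac i j 0)) b) (L i m (Fac i j m))"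
  using assms(2,3)
proof (induction m arbitrary: j)
  case 0
  have "j' = j" if "j' \<in> exponents i" "\<forall>t\<in>{0<..i - 1}. j' t = j t" for j'
    using that 0 by (intro PiE_ext[OF that(1) 0(2)]) auto
  then show ?case
    using 0 L_Fac_subgroup[OF i, of 0 j] by (intro exI[of _ "Factor j"]) auto
next
  case (Suc m)
  have m: "Suc m < i"
    using Suc i by simp
  define jj where "jj e = j(Suc m := e)" for e
  have jj: "jj e \<in> exponents i" if "e \<in> {0, 1}" for e
    using Suc.prems(2) that m unfolding jj_def by (auto simp: PiE_iff extensional_def)
  have Fjj: "Fac i (jj e) (Suc m) = Fac i j (Suc m)" for e
    by (rule Fac_cong) (simp add: jj_def)
  obtain b1 where b1: "distinct (factor_list b1)"
    "set (factor_list b1) = {j' \<in> exponents i. \<forall>t\<in>{m<..i - 1}. j' t = jj 1 t}"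
    "iterated_semidirect M (map_bracketing (\<lambda>j. L i 0 (Fac i j 0)) b1) (L i m (Fac i (jj 1) m))"
    using Suc.IH[of "jj 1"] Suc.prems jj by auto
  obtain b0 where b0: "distinct (factor_list b0)"
    "set (factor_list b0) = {j' \<in> exponents i. \<forall>t\<in>{m<..i - 1}. j' t = jj 0 t}"
    "iterated_semidirect M (map_bracketing (\<lambda>j. L i 0 (Fac i j 0)) b0) (L i m (Fac i (jj 0) m))"
    using Suc.IH[of "jj 0"] Suc.prems jj by auto
  have "{m<..i - 1} = insert (Suc m) {Suc m<..i - 1}"
    using m by auto
  then have agree: "(\<forall>t\<in>{m<..i - 1}. j' t = jj e t)
      \<longleftrightarrow> j' (Suc m) = e \<and> (\<forall>t\<in>{Suc m<..i - 1}. j' t = j t)" for j' e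
    by (simp add: jj_def)
  have sets: "set (factor_list b1) = {j' \<in> exponents i. j' (Suc m) = 1 \<and> (\<forall>t\<in>{Suc m<..i - 1}. j' t = j t)}"
    "set (factor_list b0) = {j' \<in> exponents i. j' (Suc m) = 0 \<and> (\<forall>t\<in>{Suc m<..i - 1}. j' t = j t)}"
    unfolding b1(2) b0(2) agree by simp_all
  have "j' (Suc m) \<in> {0, 1}" if "j' \<in> exponents i" for j'
    using PiE_mem[OF that, of "Suc m"] m by auto
  then have union: "set (factor_list b1) \<union> set (factor_list b0) = {j' \<in> exponents i. \<forall>t\<in>{Suc m<..i - 1}. j' t = j t}"
    unfolding sets by blast
  have disj: "set (factor_list b1) \<inter> set (factor_list b0) = {}"
    unfolding sets by auto
  have "internal_semidirect M (L i m (E (Suc m) \<otimes> Fac i j (Suc m))) (L i m (Fac i j (Suc m)))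
      (L i (Suc m) (Fac i j (Suc m)))"
    using L_semidirect[OF m i Fac_in_B[OF i m Suc.prems(2)] L_Fac_subgroup[OF i Suc.prems]] .
  moreover have "Fac i (jj 1) m = E (Suc m) \<otimes> Fac i j (Suc m)"
    using Fac_step_1[OF i m, of "jj 1"] Fjj by (simp add: jj_def)
  moreover have "Fac i (jj 0) m = Fac i j (Suc m)"
    using Fac_step_0[OF i m jj, of 0] Fjj by (simp add: jj_def)
  ultimately have "iterated_semidirect M (map_bracketing (\<lambda>j. L i 0 (Fac i j 0)) (Semi b1 b0))
      (L i (Suc m) (Fac i j (Suc m)))"
    using b1(3) b0(3) unfolding bracketing.map iterated_semidirect.simps by metis
  moreover have "distinct (factor_list (Semi b1 b0))"
    using b1(1) b0(1) disj by simp
  moreover have "set (factor_list (Semi b1 b0)) = {j' \<in> exponents i. \<forall>t\<in>{Suc m<..i - 1}. j' t = j t}"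
    using union by simp
  ultimately show ?case by blast
qed

lemma K_bracketing:
  assumes i: "i \<in> {1..n}"
  shows "\<exists>b. distinct (factor_list b) \<and> set (factor_list b) = exponents i \<and>
    iterated_semidirect M (map_bracketing (\<lambda>j. L i 0 (Fac i j 0)) b) (K i)"
proof -
  \<comment> \<open>A placeholder: at \<open>m = i - 1\<close> no coordinate is frozen.\<close>
  define j :: "nat \<Rightarrow> nat" where "j = (\<lambda>t\<in>{1..i - 1}. 0)"
  have "j \<in> exponents i"
    by (simp add: j_def)
  moreover have "Fac i j (i - 1) = E i"
    using i by (simp add: Fac_def)
  ultimately show ?thesis
    using L_bracketing[OF i order_refl, of j] K_eq_L[OF i] by simp
qed

section \<open>The congruence groups\<close>

definition U :: "nat \<Rightarrow> 'a set" where
  "U k = {\<one> \<oplus> add_pow A ((2::nat) ^ k) u |u. u \<in> B {}} \<inter> W {}"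

text \<open>Evaluation of \<open>x 1, ..., x i\<close> at -1 sends \<open>1 + u p\<close> to
  \<open>1 + 2^c u\<close>. It is injective because multiplication by \<open>2^c\<close> is; the
  substance is surjectivity, where the inverse of \<open>1 + 2^c u\<close> has to be lifted as
  well.\<close>

lemma K_vec_iso_U:
  assumes i: "i \<in> {1..n}" and j: "j \<in> exponents i"
  shows "M\<lparr>carrier := L i 0 (Fac i j 0)\<rparr> \<cong> M\<lparr>carrier := U (1 + (\<Sum>t=1..i - 1. j t))\<rparr>"
proof -
  define c where "c = 1 + (\<Sum>t=1..i - 1. j t)"
  define p where "p = Fac i j 0"
  let ?two = "add_pow A ((2::nat) ^ c)"
  obtain h where h: "h \<in> ring_hom A A" "\<forall>a\<in>B {}. h a = a" "h ` B {1..i} \<subseteq> B {}"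
      "\<forall>t\<in>{0<..i}. h (x t) = \<ominus> \<one>"
    using evaluation_exists[of 0 i "\<lambda>_. \<ominus> \<one>"] i minus_one_sign by auto
  interpret h: ring_hom_ring A A h
    using h(1) by (intro ring_hom_ringI2) (rule ring_axioms)+
  have ts: "set [1..<i] \<subseteq> {1..n}"
    using i by auto
  have exps: "\<forall>t\<in>set [1..<i]. j t \<in> {0, 1}"
  proof
    fix t assume "t \<in> set [1..<i]"
    then show "j t \<in> {0, 1}"
      using PiE_mem[OF j, of t] by auto
  qed
  have c_eq: "c = 1 + sum_list (map j [1..<i])"
    unfolding c_def using i
    by (subst interv_sum_list_conv_sum_set_nat) (auto intro!: sum.cong)
  have p_eq: "p = foldr (\<lambda>t q. (E t [^] j t) \<otimes> q) [1..<i] (E i)"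
    by (simp add: p_def Fac_def One_nat_def)
  have p: "p \<in> carrier A" "p \<otimes> p = ?two p"
    unfolding p_eq c_eq using foldr_E(1,3)[OF ts i exps] by blast+
  have p_comm: "p \<otimes> a = a \<otimes> p" if "a \<in> carrier A" for a
    unfolding p_eq by (rule foldr_E(2)[OF ts i exps that])
  have "\<forall>t\<in>insert i (set [1..<i]). h (x t) = \<ominus> \<one>"
    using h(4) i by auto
  then have hp: "h p = ?two \<one>"
    unfolding p_eq c_eq by (rule foldr_E(4)[OF ts i exps h(1)])
  have sub: "{1..i} \<subseteq> {1..n}" "{} \<subseteq> {1..n}"
    using i by auto
  have R: "u \<in> carrier A" "h u = u" "u \<in> B {1..i}" if "u \<in> B {}" for u
    using that h(2) B_carrier[OF sub(2)] B_mono[of "{}" "{1..i}"] sub by auto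
  have pB: "p \<in> B {1..i}"
    using Fac_in_B[OF i _ j, of 0] i unfolding p_def by (simp add: One_nat_def)
  have helem: "h (\<one> \<oplus> u \<otimes> p) = \<one> \<oplus> ?two u" if "u \<in> B {}" for u
    using R[OF that] p(1) hp by (simp add: add_pow_r)
  have LU: "h a \<in> U c" if "a \<in> L i 0 p" for a
    using that helem ring_hom_W[OF h(1,3) sub(1)] by (auto simp: L_def U_def)
  have two_inj: "u = v" if "u \<in> B {}" "v \<in> B {}" "\<one> \<oplus> ?two u = \<one> \<oplus> ?two v" for u v
  proof -
    have c: "u \<in> carrier A" "v \<in> carrier A"
      using that R by auto
    then have "?two u = ?two v"
      using that add_pow_closed by simp
    moreover have "?two u = ?two (u \<ominus> v) \<oplus> ?two v"
      using c by (subst add.nat_pow_distrib[symmetric]) (auto simp: a_minus_def a_assoc l_neg)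
    ultimately have "?two v = ?two (u \<ominus> v) \<oplus> ?two v"
      by simp
    then have "?two (u \<ominus> v) = \<zero>"
      using c add.r_cancel_one'[of "?two v" "?two (u \<ominus> v)"] by (simp add: add_pow_closed)
    then have "u \<ominus> v = \<zero>"
      using add_pow_2_eq_zero c by auto
    then show ?thesis
      using c by simp
  qed
  have inj: "inj_on h (L i 0 p)"
  proof (rule inj_onI)
    fix a b assume "a \<in> L i 0 p" "b \<in> L i 0 p" and eq: "h a = h b"
    then obtain u v where uv: "u \<in> B {}" "a = \<one> \<oplus> u \<otimes> p" "v \<in> B {}" "b = \<one> \<oplus> v \<otimes> p"
      by (auto simp: L_def)
    then have "\<one> \<oplus> ?two u = \<one> \<oplus> ?two v"
      using eq helem[OF uv(1)] helem[OF uv(3)] by simp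
    then show "a = b"
      using two_inj[OF uv(1,3)] uv by blast
  qed
  have surj: "U c \<subseteq> h ` L i 0 p"
  proof
    fix y assume "y \<in> U c"
    then obtain u w where u: "u \<in> B {}" "y = \<one> \<oplus> ?two u" and w: "w \<in> B {}" "y \<otimes> w = \<one>" "w \<otimes> y = \<one>"
      by (auto simp: U_def W_iff)
    have cu: "u \<in> carrier A" "w \<in> carrier A" "?two u \<in> carrier A"
      using u w R add_pow_closed by auto
    have rel: "w \<oplus> ?two (u \<otimes> w) = \<one>" "w \<oplus> ?two (w \<otimes> u) = \<one>"
      using w(2,3) cu unfolding u(2) by (simp_all add: l_distr r_distr add_pow_l add_pow_r)
    then have "w \<oplus> ?two (u \<otimes> w) = w \<oplus> ?two (w \<otimes> u)"
      by simp
    then have "?two (u \<otimes> w) = ?two (w \<otimes> u)"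
      using cu by (simp add: add_pow_closed)
    \<comment> \<open>The left and right inverse equations differ only in \<open>2^c u w\<close>
      against \<open>2^c w u\<close>, and \<open>2^c\<close> cancels.\<close>
    then have uw: "u \<otimes> w = w \<otimes> u"
      using two_inj[of "u \<otimes> w" "w \<otimes> u"] u w B_mult[OF sub(2)] by simp
    have u_rel: "u \<otimes> w \<oplus> ?two (u \<otimes> (u \<otimes> w)) = u"
    proof -
      have "u \<otimes> (w \<oplus> ?two (u \<otimes> w)) = u"
        using rel cu by simp
      then show ?thesis
        using cu by (simp add: r_distr add_pow_r add_pow_closed)
    qed
    \<comment> \<open>With \<open>w\<close> the inverse of \<open>1 + 2^c u\<close>, the inverse of
      \<open>1 + u p\<close> is \<open>1 - u w p\<close>: since \<open>p p = 2^c p\<close>, their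
      product is \<open>1 + (u - z - 2^c u z) p\<close> for \<open>z = u w\<close>, and
      \<open>u_rel\<close> makes the bracket vanish.\<close>
    let ?a = "\<one> \<oplus> u \<otimes> p" and ?b = "\<one> \<ominus> (u \<otimes> w) \<otimes> p"
    define z where "z = u \<otimes> w"
    have z: "z \<in> carrier A" "z \<oplus> ?two (u \<otimes> z) = u"
      using cu u_rel by (auto simp: z_def)
    have "z \<otimes> u = u \<otimes> (w \<otimes> u)"
      using cu by (simp add: z_def m_assoc)
    then have uz: "u \<otimes> z = z \<otimes> u"
      by (simp add: z_def uw)
    have up: "(v \<otimes> p) \<otimes> (v' \<otimes> p) = ?two (v \<otimes> v') \<otimes> p" if "v \<in> carrier A" "v' \<in> carrier A" for v v'
    proof -
      have "(v \<otimes> p) \<otimes> (v' \<otimes> p) = v \<otimes> (p \<otimes> v') \<otimes> p"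
        using that p(1) by (simp add: m_assoc)
      also have "\<dots> = v \<otimes> v' \<otimes> (p \<otimes> p)"
        using that p(1) by (simp add: m_assoc p_comm[OF that(2)])
      finally show ?thesis
        using that p by (simp add: add_pow_l add_pow_r)
    qed
    have zp: "z \<otimes> p \<in> carrier A" "?two (u \<otimes> z) \<otimes> p \<in> carrier A"
      using z p cu add_pow_closed by auto
    have up_eq: "u \<otimes> p = z \<otimes> p \<oplus> ?two (u \<otimes> z) \<otimes> p"
      using z(1) p(1) cu add_pow_closed by (subst z(2)[symmetric]) (simp add: l_distr)
    have "?a \<otimes> ?b = \<one> \<oplus> u \<otimes> p \<ominus> (z \<otimes> p \<oplus> ?two (u \<otimes> z) \<otimes> p)"
      using cu z(1) p(1) zp up[of u z] unfolding z_def[symmetric]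
      by (simp add: a_minus_def l_distr r_distr r_minus minus_add a_ac)
    then have ab: "?a \<otimes> ?b = \<one>"
      unfolding up_eq using zp by (simp add: a_minus_def a_assoc r_neg)
    have "?b \<otimes> ?a = \<one> \<oplus> u \<otimes> p \<ominus> (z \<otimes> p \<oplus> ?two (u \<otimes> z) \<otimes> p)"
      using cu z(1) p(1) zp up[of z u] uz unfolding z_def[symmetric]
      by (simp add: a_minus_def l_distr r_distr l_minus minus_add a_ac)
    then have ba: "?b \<otimes> ?a = \<one>"
      unfolding up_eq using zp by (simp add: a_minus_def a_assoc r_neg)
    have "?a \<in> B {1..i}" "?b \<in> B {1..i}"
      using R u w pB sub(1) by (auto intro!: B_add B_mult B_diff B_one)
    then have "?a \<in> L i 0 p"
      using ab ba u by (auto simp: L_def W_iff)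
    then show "y \<in> h ` L i 0 p"
      using helem[OF u(1)] u(2) by (metis image_eqI)
  qed
  have "h \<in> iso (M\<lparr>carrier := L i 0 p\<rparr>) (M\<lparr>carrier := U c\<rparr>)"
  proof (rule isoI)
    have "a \<in> carrier A" if "a \<in> L i 0 p" for a
      using W_carrier[OF sub(1)] that by (auto simp: L_def)
    then show "h \<in> hom (M\<lparr>carrier := L i 0 p\<rparr>) (M\<lparr>carrier := U c\<rparr>)"
      using LU by (intro homI) simp_all
    show "bij_betw h (carrier (M\<lparr>carrier := L i 0 p\<rparr>)) (carrier (M\<lparr>carrier := U c\<rparr>))"
      using inj surj LU by (auto simp: bij_betw_def)
  qed
  then show ?thesis
    unfolding p_def c_def by (rule is_isoI)
qed

section \<open>Torsion units of the form \<open>1 + 2v\<close>\<close>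

text \<open>The binomial expansion with \<open>2v\<close> taken out on the left. Only the residue
  \<open>m\<close> of the cofactor modulo 2 is recorded, so \<open>s\<close> stays
  unspecified.\<close>

lemma power_of_one_plus_double:
  assumes "v \<in> carrier A"
  shows "\<exists>s\<in>carrier A. (\<one> \<oplus> (v \<oplus> v)) [^] (m::nat) = \<one> \<oplus> (v \<oplus> v) \<otimes> (add_pow A m \<one> \<oplus> (s \<oplus> s))"
proof (induction m)
  case 0
  then show ?case
    using assms by (intro bexI[of _ \<zero>]) simp_all
next
  case (Suc m)
  then obtain s where s: "s \<in> carrier A"
    "(\<one> \<oplus> (v \<oplus> v)) [^] m = \<one> \<oplus> (v \<oplus> v) \<otimes> (add_pow A m \<one> \<oplus> (s \<oplus> s))"
    by blast
  define w where "w = v \<oplus> v"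
  define q where "q = add_pow A m \<one> \<oplus> (s \<oplus> s)"
  \<comment> \<open>Chosen so that \<open>1 + q + q w = (m + 1) + 2r\<close>, in view of
    \<open>q w = 2 q v\<close>.\<close>
  define r where "r = q \<otimes> v \<oplus> s"
  have c: "w \<in> carrier A" "add_pow A m \<one> \<in> carrier A" "q \<in> carrier A" "r \<in> carrier A"
    using assms s by (auto simp: w_def q_def r_def)
  have qw: "q \<otimes> w = q \<otimes> v \<oplus> q \<otimes> v"
    using assms c by (simp add: w_def r_distr)
  have "(\<one> \<oplus> w) [^] Suc m = (\<one> \<oplus> w \<otimes> q) \<otimes> (\<one> \<oplus> w)"
    using s(2) by (simp add: w_def q_def)
  also have "\<dots> = \<one> \<oplus> w \<otimes> (\<one> \<oplus> q \<oplus> q \<otimes> w)"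
    using c by (simp add: l_distr r_distr m_assoc a_ac)
  also have "\<one> \<oplus> q \<oplus> q \<otimes> w = add_pow A (Suc m) \<one> \<oplus> (r \<oplus> r)"
    unfolding qw using assms s(1) c by (simp add: q_def r_def a_ac)
  finally show ?case
    using c unfolding w_def by blast
qed

lemma add_pow_even:
  fixes m :: nat
  assumes "a \<in> carrier A"
  shows "add_pow A (2 * m) a = add_pow A m a \<oplus> add_pow A m a"
  using add.nat_pow_mult[OF assms, of m m] by (simp add: mult_2)

text \<open>For odd \<open>m\<close> the cofactor in the expansion has the form
  \<open>1 + 2t\<close>, so \<open>v (1 + 2t) = 0\<close>, that is, \<open>v = 2 v (-t)\<close>.
  Iterating this, \<open>v\<close> is divisible by every power of 2.\<close>

lemma odd_torsion:
  assumes v: "v \<in> carrier A" and "odd m" and pow: "(\<one> \<oplus> (v \<oplus> v)) [^] (m::nat) = \<one>"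
  shows "v = \<zero>"
proof -
  obtain l where m: "m = Suc (2 * l)"
    using \<open>odd m\<close> by (metis oddE Suc_eq_plus1)
  obtain s where s: "s \<in> carrier A"
    "(\<one> \<oplus> (v \<oplus> v)) [^] m = \<one> \<oplus> (v \<oplus> v) \<otimes> (add_pow A m \<one> \<oplus> (s \<oplus> s))"
    using power_of_one_plus_double[OF v] by blast
  define t where "t = add_pow A l \<one> \<oplus> s"
  have t: "t \<in> carrier A"
    using s by (simp add: t_def)
  have "add_pow A m \<one> \<oplus> (s \<oplus> s) = \<one> \<oplus> (t \<oplus> t)"
    using s add_pow_even[of \<one> l] by (simp add: t_def m a_ac)
  then have "\<one> \<oplus> (v \<oplus> v) \<otimes> (\<one> \<oplus> (t \<oplus> t)) = \<one>"
    using s(2) pow by simp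
  then have "(v \<oplus> v) \<otimes> (\<one> \<oplus> (t \<oplus> t)) = \<zero>"
    using v t by simp
  moreover have "(v \<oplus> v) \<otimes> (\<one> \<oplus> (t \<oplus> t)) = v \<otimes> (\<one> \<oplus> (t \<oplus> t)) \<oplus> v \<otimes> (\<one> \<oplus> (t \<oplus> t))"
    using v t by (simp add: l_distr)
  ultimately have "v \<otimes> (\<one> \<oplus> (t \<oplus> t)) = \<zero>"
    using v t double_eq_zero[of "v \<otimes> (\<one> \<oplus> (t \<oplus> t))"] by simp
  then have "v \<oplus> (v \<otimes> t \<oplus> v \<otimes> t) = \<zero>"
    using v t by (simp add: r_distr)
  then have v_eq: "v = \<ominus> (v \<otimes> t \<oplus> v \<otimes> t)"
    using v t minus_equality[of v "v \<otimes> t \<oplus> v \<otimes> t"] by simp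
  define u where "u = \<ominus> t"
  have u: "u \<in> carrier A" "v = v \<otimes> u \<oplus> v \<otimes> u"
    using v t v_eq by (simp_all add: u_def r_minus minus_add)
  have "v = add_pow A ((2::nat) ^ k) (v \<otimes> u [^] k)" for k :: nat
  proof (induction k)
    case 0
    then show ?case
      using v add.nat_pow_eone[of v] by simp
  next
    case (Suc k)
    define y where "y = u [^] k"
    have y: "y \<in> carrier A" "v = add_pow A ((2::nat) ^ k) (v \<otimes> y)"
      using Suc u by (simp_all add: y_def)
    have "v \<otimes> y = (v \<otimes> u \<oplus> v \<otimes> u) \<otimes> y"
      using u(2) by simp
    also have "\<dots> = v \<otimes> (u \<otimes> y) \<oplus> v \<otimes> (u \<otimes> y)"
      using u(1) y(1) v by (simp add: l_distr m_assoc)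
    also have "u \<otimes> y = u [^] Suc k"
      using u nat_pow_Suc2[of u k] by (simp add: y_def)
    finally have "v \<otimes> y = v \<otimes> u [^] Suc k \<oplus> v \<otimes> u [^] Suc k" .
    then have "v = add_pow A ((2::nat) ^ k) (v \<otimes> u [^] Suc k) \<oplus> add_pow A ((2::nat) ^ k) (v \<otimes> u [^] Suc k)"
      using y u v by (subst y(2)) (simp del: nat_pow_Suc add: add.nat_pow_distrib)
    then show ?case
      using u v by (simp only: add_pow_double m_closed nat_pow_closed)
  qed
  then show ?thesis
    using two_adic_separated[OF v] u v by (metis m_closed nat_pow_closed)
qed

lemma tr_zero: "tr \<zero> = 0"
  using tr_add[of \<zero> \<zero>] by simp

lemma tr_minus: "a \<in> carrier A \<Longrightarrow> tr (\<ominus> a) = - tr a"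
  using tr_add[of a "\<ominus> a"] tr_zero by (simp add: r_neg)

lemma square_one_plus_double:
  assumes "v \<in> carrier A"
  shows "(\<one> \<oplus> (v \<oplus> v)) \<otimes> (\<one> \<oplus> (v \<oplus> v)) = \<one> \<oplus> ((v \<oplus> v \<otimes> v \<oplus> (v \<oplus> v \<otimes> v)) \<oplus> (v \<oplus> v \<otimes> v \<oplus> (v \<oplus> v \<otimes> v)))"
  using assms by (simp add: l_distr r_distr a_ac)

text \<open>Squaring halves an even exponent and replaces \<open>v\<close> by \<open>2y\<close> with
  \<open>y = v + v^2\<close>. The induction hypothesis leaves \<open>2y = 0\<close> or
  \<open>2y = -1\<close>. The second is impossible because \<open>tr (2y)\<close> is even, and the
  first makes \<open>-v\<close> idempotent.\<close>

lemma torsion_of_one_plus_double: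
  assumes "v \<in> carrier A" and "0 < m" and "(\<one> \<oplus> (v \<oplus> v)) [^] (m::nat) = \<one>"
  shows "v = \<zero> \<or> v = \<ominus> \<one>"
  using assms
proof (induction m arbitrary: v rule: less_induct)
  case (less m)
  show ?case
  proof (cases "even m")
    case False
    then show ?thesis
      using odd_torsion less.prems by blast
  next
    case True
    then obtain l where l: "m = 2 * l" "0 < l" "l < m"
      using less.prems(2) by auto
    define y where "y = v \<oplus> v \<otimes> v"
    have y: "y \<in> carrier A"
      using less.prems by (simp add: y_def)
    have "(\<one> \<oplus> (v \<oplus> v)) [^] m = ((\<one> \<oplus> (v \<oplus> v)) [^] (2::nat)) [^] l"
      using less.prems(1) l(1) nat_pow_pow[of "\<one> \<oplus> (v \<oplus> v)" 2 l] by simp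
    also have "(\<one> \<oplus> (v \<oplus> v)) [^] (2::nat) = (\<one> \<oplus> (v \<oplus> v)) \<otimes> (\<one> \<oplus> (v \<oplus> v))"
      using less.prems(1) by (simp add: numeral_2_eq_2)
    also have "\<dots> = \<one> \<oplus> ((y \<oplus> y) \<oplus> (y \<oplus> y))"
      using square_one_plus_double[OF less.prems(1)] by (simp add: y_def)
    finally have "(\<one> \<oplus> ((y \<oplus> y) \<oplus> (y \<oplus> y))) [^] l = \<one>"
      using less.prems(3) by simp
    then have "y \<oplus> y = \<zero> \<or> y \<oplus> y = \<ominus> \<one>"
      using less.IH[OF l(3) _ l(2), of "y \<oplus> y"] y by simp
    moreover have "y \<oplus> y \<noteq> \<ominus> \<one>"
    proof
      assume "y \<oplus> y = \<ominus> \<one>"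
      then have "tr (y \<oplus> y) = tr (\<ominus> \<one>)"
        by simp
      then have "tr y + tr y = - 1"
        using tr_add[OF y y] tr_minus[of \<one>] tr_one by simp
      then show False
        by presburger
    qed
    ultimately have "y = \<zero>"
      using double_eq_zero[OF y] by blast
    then have "v \<otimes> v = \<ominus> v"
      using less.prems(1) minus_equality[of "v \<otimes> v" v] by (simp add: y_def a_comm)
    then have "(\<ominus> v) \<otimes> (\<ominus> v) = \<ominus> v"
      using less.prems(1) by (simp add: l_minus r_minus)
    then have "\<ominus> v = \<zero> \<or> \<ominus> v = \<one>"
      using trivial_idempotents[of "\<ominus> v"] less.prems(1) by simp
    then show ?thesis
      using less.prems(1) by (metis minus_minus minus_zero)
  qed
qed

section \<open>Torsion-free complements of \<open>x i\<close> in \<open>K i\<close>\<close>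

abbreviation neg :: "nat \<Rightarrow> 'a \<Rightarrow> 'a" where
  "neg i \<equiv> spec i (\<ominus> \<one>)"

lemma neg_hom: "i \<in> {1..n} \<Longrightarrow> ring_hom_ring A A (neg i)"
  by (rule spec_ring_hom_ring[OF _ minus_one_sign])

lemma K_neg:
  assumes i: "i \<in> {1..n}" and "a \<in> K i"
  obtains v where "v \<in> carrier A" "a = \<one> \<oplus> v \<otimes> E i" "neg i a = \<one> \<oplus> (v \<oplus> v)" "neg i v = v"
proof -
  interpret h: ring_hom_ring A A "neg i"
    by (rule neg_hom[OF i])
  obtain v where v: "v \<in> B {1..i - 1}" "a = \<one> \<oplus> v \<otimes> E i"
    using assms K_eq_L[OF i] by (auto simp: L_def)
  have sub: "{1..i - 1} \<subseteq> {1..n}" "{1..i - 1} \<subseteq> {1..n} - {i}"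
    using i by auto
  have vc: "v \<in> carrier A" "neg i v = v"
    using B_carrier[OF sub(1) v(1)] spec_id'[OF i v(1) sub(2)] by auto
  then have "neg i a = \<one> \<oplus> (v \<oplus> v)"
    using v(2) E_closed[OF i] spec_minus_one_E[OF i] by (simp add: r_distr)
  then show ?thesis
    using that vc v(2) by blast
qed

text \<open>The kernel of a homomorphism from \<open>K i\<close> to the units modulo 4. That
  homomorphism takes the value 3 at \<open>x i\<close>, so \<open>x i\<close> generates a
  complement.\<close>

definition N :: "nat \<Rightarrow> 'a set" where
  "N i = {a \<in> K i. tr (neg i a) mod 4 = 1}"

lemma K_carrier: "i \<in> {1..n} \<Longrightarrow> a \<in> K i \<Longrightarrow> a \<in> carrier A \<and> a \<in> Units A"
  using W_Units[of "{1..i}"] by (auto simp: K_def)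

text \<open>For values \<open>1 + 2u\<close> and \<open>1 + 2v\<close> both sides are
  \<open>1 + 2 tr u + 2 tr v\<close> modulo 4: \<open>tr (u v)\<close> and
  \<open>tr u * tr v\<close> may differ, but both carry the coefficient 4.\<close>

lemma tr_neg_mult:
  assumes i: "i \<in> {1..n}" and a: "a \<in> K i" and b: "b \<in> K i"
  shows "tr (neg i (a \<otimes> b)) mod 4 = (tr (neg i a) * tr (neg i b)) mod 4"
proof -
  interpret h: ring_hom_ring A A "neg i"
    by (rule neg_hom[OF i])
  obtain u where u: "u \<in> carrier A" "neg i a = \<one> \<oplus> (u \<oplus> u)"
    by (rule K_neg[OF i a])
  obtain v where v: "v \<in> carrier A" "neg i b = \<one> \<oplus> (v \<oplus> v)"
    by (rule K_neg[OF i b])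
  have tra: "tr (neg i a) = 1 + 2 * tr u" and trb: "tr (neg i b) = 1 + 2 * tr v"
    using u v by (simp_all add: tr_add tr_one)
  have "neg i (a \<otimes> b) = \<one> \<oplus> (u \<oplus> u) \<oplus> ((v \<oplus> v) \<oplus> (u \<otimes> v \<oplus> u \<otimes> v \<oplus> (u \<otimes> v \<oplus> u \<otimes> v)))"
    using K_carrier[OF i a] K_carrier[OF i b] u v by (simp add: l_distr r_distr a_ac)
  then have trab: "tr (neg i (a \<otimes> b)) = 1 + 2 * tr u + 2 * tr v + 4 * tr (u \<otimes> v)"
    using u v by (simp add: tr_add tr_one)
  have "tr (neg i a) * tr (neg i b) = 1 + 2 * tr u + 2 * tr v + 4 * (tr u * tr v)"
    unfolding tra trb by (simp add: algebra_simps)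
  then show ?thesis
    unfolding trab by presburger
qed

lemma tr_neg_odd:
  assumes i: "i \<in> {1..n}" and a: "a \<in> K i"
  shows "tr (neg i a) mod 4 = 1 \<or> tr (neg i a) mod 4 = 3"
proof -
  obtain u where u: "u \<in> carrier A" "neg i a = \<one> \<oplus> (u \<oplus> u)"
    by (rule K_neg[OF i a])
  then have "tr (neg i a) = 1 + 2 * tr u"
    by (simp add: tr_add tr_one)
  then show ?thesis
    by presburger
qed

lemma x_Units: "i \<in> {1..n} \<Longrightarrow> x i \<in> Units A"
  using x_sq x_closed by (auto simp: Units_def)

lemma inv_x: "i \<in> {1..n} \<Longrightarrow> inv\<^bsub>M\<^esub> x i = x i"
  using inv_M[OF x_Units] inv_unique'[OF x_closed x_closed] x_sq by simp

lemma x_in_K: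
  assumes "i \<in> {1..n}"
  shows "x i \<in> K i"
proof -
  have "x i \<in> B {1..i}"
    using assms by (intro x_in_B') auto
  then show ?thesis
    using assms x_sq[OF assms] spec_x[OF assms] by (auto simp: K_def W_iff)
qed

lemma x_notin_N: "i \<in> {1..n} \<Longrightarrow> x i \<notin> N i"
  using tr_minus[of \<one>] tr_one spec_x[of i "\<ominus> \<one>"] by (simp add: N_def)

lemma one_in_K: "i \<in> {1..n} \<Longrightarrow> \<one> \<in> K i"
  using subgroup.one_closed[OF K_subgroup] by simp

lemma tr_neg_one: "i \<in> {1..n} \<Longrightarrow> tr (neg i \<one>) = 1"
proof -
  assume i: "i \<in> {1..n}"
  interpret h: ring_hom_ring A A "neg i"
    by (rule neg_hom[OF i])
  show ?thesis by (simp add: tr_one)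
qed

lemma N_subgroup:
  assumes i: "i \<in> {1..n}"
  shows "subgroup (N i) M"
proof (rule group.subgroupI[OF M_group])
  have K: "subgroup (K i) M"
    by (rule K_subgroup[OF i])
  show "N i \<subseteq> carrier M"
    using K_carrier[OF i] by (auto simp: N_def)
  have "\<one> \<in> N i"
    using one_in_K[OF i] tr_neg_one[OF i] by (simp add: N_def)
  then show "N i \<noteq> {}" by blast
  show "a \<otimes>\<^bsub>M\<^esub> b \<in> N i" if "a \<in> N i" "b \<in> N i" for a b
  proof -
    have ab: "a \<in> K i" "b \<in> K i" "tr (neg i a) mod 4 = 1" "tr (neg i b) mod 4 = 1"
      using that by (auto simp: N_def)
    have "(tr (neg i a) * tr (neg i b)) mod 4 = 1"
      using ab mod_mult_eq[of "tr (neg i a)" 4 "tr (neg i b)"] by simp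
    then show ?thesis
      using tr_neg_mult[OF i ab(1,2)] subgroup.m_closed[OF K ab(1,2)] by (simp add: N_def)
  qed
  show "inv\<^bsub>M\<^esub> a \<in> N i" if "a \<in> N i" for a
  proof -
    let ?b = "inv\<^bsub>M\<^esub> a"
    have a: "a \<in> K i" "tr (neg i a) mod 4 = 1"
      using that by (auto simp: N_def)
    have b: "?b \<in> K i"
      using subgroup.m_inv_closed[OF K a(1)] .
    have "a \<otimes> ?b = \<one>"
      using K_carrier[OF i a(1)] inv_M by simp
    then have "(tr (neg i a) * tr (neg i ?b)) mod 4 = 1"
      using tr_neg_mult[OF i a(1) b] tr_neg_one[OF i] by simp
    then have "tr (neg i ?b) mod 4 = 1"
      using a(2) mod_mult_left_eq[of "tr (neg i a)" 4 "tr (neg i ?b)"] by simp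
    then show ?thesis
      using b by (simp add: N_def)
  qed
qed

text \<open>A conjugate has the same trace, and \<open>neg i\<close> is a ring endomorphism.
  Allowing conjugation by all of \<open>W {1..i}\<close>, not only by \<open>K i\<close>, is what
  the second chain depends on.\<close>

lemma N_normalized:
  assumes i: "i \<in> {1..n}" and w: "w \<in> W {1..i}" and a: "a \<in> N i"
  shows "w \<otimes> a \<otimes> inv\<^bsub>M\<^esub> w \<in> N i"
proof -
  interpret h: ring_hom_ring A A "neg i"
    by (rule neg_hom[OF i])
  have aK: "a \<in> K i" "tr (neg i a) mod 4 = 1"
    using a by (auto simp: N_def)
  have "w \<otimes>\<^bsub>M\<^esub> a \<otimes>\<^bsub>M\<^esub> inv\<^bsub>M\<^esub> w \<in> K i"
    by (rule group.internal_semidirectD(6)[OF M_group K_semidirect[OF i] w aK(1)])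
  then have conjK: "w \<otimes> a \<otimes> inv w \<in> K i"
    using W_Units[of "{1..i}"] w i inv_M[of w] by auto
  have wU: "w \<in> Units A" "w \<in> carrier A" "inv w \<in> carrier A"
    using W_Units[of "{1..i}"] w i by auto
  have ac: "a \<in> carrier A"
    using K_carrier[OF i aK(1)] by simp
  have inv: "neg i (inv w) \<otimes> neg i w = \<one>"
    using h.hom_mult[of "inv w" w] wU by simp
  have "tr (neg i (w \<otimes> a \<otimes> inv w)) = tr ((neg i w \<otimes> neg i a) \<otimes> neg i (inv w))"
    using wU ac by simp
  also have "\<dots> = tr (neg i (inv w) \<otimes> (neg i w \<otimes> neg i a))"
    using wU ac by (intro tr_comm) simp_all
  also have "neg i (inv w) \<otimes> (neg i w \<otimes> neg i a) = neg i a"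
    using wU ac inv by (simp add: m_assoc[symmetric] del: h.hom_mult)
  finally show ?thesis
    using conjK aK wU(1) inv_M by (simp add: N_def)
qed

lemma N_normal_K:
  assumes i: "i \<in> {1..n}"
  shows "N i \<lhd> M\<lparr>carrier := K i\<rparr>"
proof -
  have "N i \<subseteq> K i" "K i \<subseteq> W {1..i}"
    by (auto simp: N_def K_def)
  then show ?thesis
    using group.m_inv_consistent[OF M_group K_subgroup[OF i]] N_normalized[OF i]
    by (subst group.normal_inv_iff)
       (auto simp: group.subgroup_imp_group[OF M_group] K_subgroup[OF i] N_subgroup[OF i]
          group.subgroup_incl[OF M_group])
qed

lemma M_pow: "a [^]\<^bsub>M\<^esub> (m::nat) = a [^] m"
  by (induction m) (simp_all add: nat_pow_def)

lemma N_torsion_free: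
  assumes i: "i \<in> {1..n}"
  shows "torsion_free M (N i)"
  unfolding torsion_free_def
proof (intro ballI allI impI)
  interpret h: ring_hom_ring A A "neg i"
    by (rule neg_hom[OF i])
  fix a and m :: nat
  assume a: "a \<in> N i" and m: "0 < m" and "a [^]\<^bsub>M\<^esub> m = \<one>\<^bsub>M\<^esub>"
  then have pow: "a [^] m = \<one>"
    by (simp add: M_pow)
  have aK: "a \<in> K i"
    using a by (simp add: N_def)
  obtain v where v: "v \<in> carrier A" "a = \<one> \<oplus> v \<otimes> E i" "neg i a = \<one> \<oplus> (v \<oplus> v)"
    by (rule K_neg[OF i aK])
  have hom_pow: "neg i (a [^] k) = neg i a [^] k" for k :: nat
    using K_carrier[OF i aK] by (induction k) simp_all
  have "(\<one> \<oplus> (v \<oplus> v)) [^] m = \<one>"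
    using hom_pow[of m] unfolding pow v(3) by simp
  then have "v = \<zero> \<or> v = \<ominus> \<one>"
    using torsion_of_one_plus_double[OF v(1) m] by blast
  \<comment> \<open>\<open>v = -1\<close> is the case \<open>a = x i\<close>, which the trace
    condition excludes.\<close>
  moreover have "v \<noteq> \<ominus> \<one>"
  proof
    assume "v = \<ominus> \<one>"
    then have "tr (neg i a) = -1"
      unfolding v(3) by (simp add: tr_add tr_minus tr_one)
    then show False
      using a by (simp add: N_def)
  qed
  ultimately show "a = \<one>\<^bsub>M\<^esub>"
    using v(2) E_closed[OF i] by simp
qed

text \<open>Multiplication by \<open>x i\<close> changes the sign of the trace modulo 4 and so
  exchanges the residues 1 and 3.\<close>

lemma K_split:
  assumes i: "i \<in> {1..n}" and a: "a \<in> K i"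
  shows "a \<in> N i \<or> a \<otimes> x i \<in> N i"
proof -
  have xK: "x i \<in> K i"
    by (rule x_in_K[OF i])
  have "a \<otimes> x i \<in> K i"
    using subgroup.m_closed[OF K_subgroup[OF i] a xK] by simp
  moreover have "tr (neg i (a \<otimes> x i)) mod 4 = (- tr (neg i a)) mod 4"
    using tr_neg_mult[OF i a xK] tr_minus[of \<one>] tr_one spec_x[OF i, of "\<ominus> \<one>"] by simp
  ultimately show ?thesis
    using tr_neg_odd[OF i a] a unfolding N_def mem_Collect_eq by presburger
qed

lemma generate_x:
  assumes i: "i \<in> {1..n}"
  shows "generate M {x i} = {\<one>, x i}"
proof
  show "generate M {x i} \<subseteq> {\<one>, x i}"
  proof
    fix z assume "z \<in> generate M {x i}"
    then show "z \<in> {\<one>, x i}"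
      by induction (use x_closed[OF i] x_sq[OF i] inv_x[OF i] in auto)
  qed
  show "{\<one>, x i} \<subseteq> generate M {x i}"
    using generate.one[of M "{x i}"] generate.incl[of "x i" "{x i}" M] by auto
qed

lemma K_iso:
  assumes i: "i \<in> {1..n}"
  shows "M\<lparr>carrier := K i\<rparr> \<cong> M\<lparr>carrier := N i\<rparr> \<times>\<times> M\<lparr>carrier := generate M {x i}\<rparr>"
proof (rule group.commuting_factors_iso[OF M_group N_subgroup[OF i]])
  show "subgroup (generate M {x i}) M"
    using x_Units[OF i] by (intro group.generate_is_subgroup[OF M_group]) simp
  have N1: "\<one> \<in> N i"
    using subgroup.one_closed[OF N_subgroup[OF i]] by simp
  then show "N i \<inter> generate M {x i} = {\<one>\<^bsub>M\<^esub>}"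
    using x_notin_N[OF i] by (auto simp: generate_x[OF i])
  have NK: "N i \<subseteq> K i"
    by (auto simp: N_def)
  show "N i <#>\<^bsub>M\<^esub> generate M {x i} = K i"
  proof
    show "N i <#>\<^bsub>M\<^esub> generate M {x i} \<subseteq> K i"
      using NK subgroup.m_closed[OF K_subgroup[OF i]] x_in_K[OF i] one_in_K[OF i]
      unfolding set_mult_def generate_x[OF i] by fastforce
    show "K i \<subseteq> N i <#>\<^bsub>M\<^esub> generate M {x i}"
    proof
      fix a assume a: "a \<in> K i"
      then have ac: "a \<in> carrier A"
        using K_carrier[OF i] by blast
      have "a = a \<otimes> \<one>" "a = (a \<otimes> x i) \<otimes> x i"
        using ac x_closed[OF i] x_sq[OF i] by (simp_all add: m_assoc)
      then show "a \<in> N i <#>\<^bsub>M\<^esub> generate M {x i}"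
        using K_split[OF i a] unfolding set_mult_def generate_x[OF i] M_simps by blast
    qed
  qed
  show "a \<otimes>\<^bsub>M\<^esub> z = z \<otimes>\<^bsub>M\<^esub> a" if "a \<in> N i" "z \<in> generate M {x i}" for a z
  proof -
    have ac: "a \<in> carrier A"
      using that NK K_carrier[OF i] by blast
    show ?thesis
      using that(2) x_comm[OF i ac] ac unfolding generate_x[OF i] by auto
  qed
qed

section \<open>The central subgroup and the second chain\<close>

definition Z :: "'a set" where
  "Z = generate M (x ` {1..n})"

lemma Z_subgroup: "subgroup Z M"
  unfolding Z_def using x_Units by (intro group.generate_is_subgroup[OF M_group]) auto

lemma Z_Units: "z \<in> Z \<Longrightarrow> z \<in> Units A"
  using subgroup.subset[OF Z_subgroup] by auto

text \<open>The generators are their own inverses, so no case for inverses remains.\<close>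

lemma Z_induct [consumes 1, case_names one x mult]:
  assumes "z \<in> Z" and "P \<one>" and "\<And>t. t \<in> {1..n} \<Longrightarrow> P (x t)"
    and "\<And>y z. y \<in> Z \<Longrightarrow> z \<in> Z \<Longrightarrow> P y \<Longrightarrow> P z \<Longrightarrow> P (y \<otimes> z)"
  shows "P z"
  using assms(1) unfolding Z_def
proof (induction rule: generate.induct)
  case one
  then show ?case using assms(2) by simp
next
  case (incl h)
  then show ?case using assms(3) by auto
next
  case (inv h)
  then obtain t where "t \<in> {1..n}" "h = x t" by blast
  then show ?case using assms(3) inv_x[of t] by simp
next
  case (eng h1 h2)
  then show ?case using assms(4) unfolding Z_def by simp
qed

lemma Z_comm:
  assumes "z \<in> Z" and a: "a \<in> carrier A"
  shows "z \<otimes> a = a \<otimes> z"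
  using assms(1)
proof (induction rule: Z_induct)
  case one
  then show ?case using a by simp
next
  case (x t)
  then show ?case using x_comm a by simp
next
  case (mult y z)
  have c: "y \<in> carrier A" "z \<in> carrier A"
    using mult Z_Units Units_closed by auto
  have "y \<otimes> z \<otimes> a = y \<otimes> (a \<otimes> z)"
    using c a by (simp add: m_assoc mult.IH(2))
  also have "\<dots> = a \<otimes> (y \<otimes> z)"
    using c a by (simp add: m_assoc[symmetric] mult.IH(1))
  finally show ?case .
qed

text \<open>\<open>D 0\<close> is the last factor of the left-nested product and \<open>D n\<close>
  the full unit group. As \<open>Z\<close> contains all \<open>x t\<close> from the start, passing
  from \<open>D (j - 1)\<close> to \<open>D j\<close> adds only \<open>N j\<close> instead of
  \<open>K j\<close>.\<close>

definition D :: "nat \<Rightarrow> 'a set" where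
  "D j = W {1..j} <#>\<^bsub>M\<^esub> Z"

lemma D_iff: "d \<in> D j \<longleftrightarrow> (\<exists>w\<in>W {1..j}. \<exists>z\<in>Z. d = w \<otimes> z)"
  by (auto simp: D_def set_mult_def)

lemma D_subgroup:
  assumes "j \<le> n"
  shows "subgroup (D j) M"
proof (rule group.subgroupI[OF M_group])
  have sub: "{1..j} \<subseteq> {1..n}"
    using assms by auto
  note WU = subsetD[OF W_Units[OF sub]]
  show "D j \<subseteq> carrier M"
    using WU Z_Units by (auto simp: D_iff)
  show "D j \<noteq> {}"
    using subgroup.one_closed[OF W_subgroup[OF sub]] subgroup.one_closed[OF Z_subgroup]
    by (force simp: D_def set_mult_def)
  fix a assume "a \<in> D j"
  then obtain w z where a: "w \<in> W {1..j}" "z \<in> Z" "a = w \<otimes> z"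
    by (auto simp: D_iff)
  have aU: "w \<in> Units A" "z \<in> Units A" "w \<in> carrier A" "z \<in> carrier A"
    using a WU Z_Units by auto
  have wi: "inv\<^bsub>M\<^esub> w \<in> W {1..j}" and zi: "inv\<^bsub>M\<^esub> z \<in> Z"
    using a subgroup.m_inv_closed[OF W_subgroup[OF sub]] subgroup.m_inv_closed[OF Z_subgroup] by auto
  have "a = z \<otimes> w"
    using a(3) Z_comm[OF a(2) aU(3)] by simp
  then have "inv\<^bsub>M\<^esub> a = inv\<^bsub>M\<^esub> w \<otimes> inv\<^bsub>M\<^esub> z"
    using aU group.inv_mult_group[OF M_group, of z w] by simp
  then show "inv\<^bsub>M\<^esub> a \<in> D j"
    using wi zi by (auto simp: D_iff)
  fix b assume "b \<in> D j"
  then obtain w' z' where b: "w' \<in> W {1..j}" "z' \<in> Z" "b = w' \<otimes> z'"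
    by (auto simp: D_iff)
  have bU: "w' \<in> carrier A" "z' \<in> carrier A"
    using b WU Z_Units by auto
  have "a \<otimes> b = w \<otimes> (z \<otimes> w') \<otimes> z'"
    using a b aU bU by (simp add: m_assoc)
  also have "\<dots> = (w \<otimes> w') \<otimes> (z \<otimes> z')"
    unfolding Z_comm[OF a(2) bU(1)] using aU bU by (simp add: m_assoc)
  finally show "a \<otimes>\<^bsub>M\<^esub> b \<in> D j"
    using subgroup.m_closed[OF W_subgroup[OF sub] a(1) b(1)] subgroup.m_closed[OF Z_subgroup a(2) b(2)]
    by (auto simp: D_iff)
qed

text \<open>A central factor does not affect conjugation, so normality under \<open>D j\<close>
  reduces to normality under \<open>W {1..j}\<close>.\<close>

lemma D_conjugate:
  assumes "j \<le> n" "d \<in> D j" and a: "a \<in> carrier A"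
  obtains w where "w \<in> W {1..j}" "d \<otimes> a \<otimes> inv\<^bsub>M\<^esub> d = w \<otimes> a \<otimes> inv\<^bsub>M\<^esub> w"
proof -
  have sub: "{1..j} \<subseteq> {1..n}"
    using assms(1) by auto
  obtain w z where d: "w \<in> W {1..j}" "z \<in> Z" "d = w \<otimes> z"
    using assms(2) by (auto simp: D_iff)
  have U: "w \<in> Units A" "z \<in> Units A" "w \<in> carrier A" "z \<in> carrier A"
    using d W_Units[OF sub] Z_Units by auto
  have inv_d: "inv\<^bsub>M\<^esub> d = inv z \<otimes> inv w"
    using U group.inv_mult_group[OF M_group, of w z] d(3) inv_M by simp
  have "d \<otimes> a \<otimes> inv\<^bsub>M\<^esub> d = w \<otimes> (z \<otimes> a) \<otimes> (inv z \<otimes> inv w)"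
    unfolding inv_d using U a d(3) by (simp add: m_assoc)
  also have "\<dots> = w \<otimes> a \<otimes> (z \<otimes> inv z) \<otimes> inv w"
    unfolding Z_comm[OF d(2) a] using U a Units_inv_closed by (simp add: m_assoc del: Units_r_inv)
  also have "\<dots> = w \<otimes> a \<otimes> inv\<^bsub>M\<^esub> w"
    using U a inv_M by simp
  finally show ?thesis
    using that d(1) by blast
qed

lemma W_in_D:
  assumes "w \<in> W {1..j}" "j \<le> n"
  shows "w \<in> D j"
proof -
  have "w \<in> carrier A"
    using assms W_carrier[of "{1..j}"] by auto
  then have "w = w \<otimes> \<one>"
    by simp
  then show ?thesis
    using assms(1) subgroup.one_closed[OF Z_subgroup] unfolding D_iff M_simps by blast
qed

text \<open>Such an \<open>h\<close> erases the generators after \<open>j\<close> from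
  \<open>z\<close> and leaves a product of \<open>x t\<close> with \<open>t \<le> j\<close>, in
  which \<open>x j\<close> has exponent 0 or 1 after reduction. Putting \<open>x j = 1\<close>
  computes the remaining factor.\<close>

lemma evaluation_of_Z:
  assumes h: "h \<in> ring_hom A A" "\<forall>a\<in>B {1..j}. h a = a" "\<forall>t\<in>{j<..n}. h (x t) = \<one>"
    and j: "j \<in> {1..n}" and "z \<in> Z"
  shows "h z \<in> carrier A \<and> (h z = spec j \<one> (h z) \<or> h z = spec j \<one> (h z) \<otimes> x j)"
  using \<open>z \<in> Z\<close>
proof (induction rule: Z_induct)
  interpret g: ring_hom_ring A A "spec j \<one>"
    by (rule spec_ring_hom_ring[OF j one_sign])
  interpret h: ring_hom_ring A A h
    using h(1) by (intro ring_hom_ringI2) (rule ring_axioms)+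
  case one
  show ?case by simp
next
  interpret g: ring_hom_ring A A "spec j \<one>"
    by (rule spec_ring_hom_ring[OF j one_sign])
  case (x t)
  consider "j < t" | "t = j" | "t < j" by linarith
  then show ?case
  proof cases
    case 1
    then have "h (x t) = \<one>"
      using h(3) x by auto
    then show ?thesis by simp
  next
    case 2
    have "x j \<in> B {1..j}"
      using j by (intro x_in_B') auto
    then have "h (x j) = x j"
      using h(2) by blast
    then show ?thesis
      using 2 spec_x[OF j, of \<one>] x_closed[OF j] by simp
  next
    case 3
    have "x t \<in> B {1..j}"
      using j x 3 by (intro x_in_B') auto
    then have "h (x t) = x t"
      using h(2) by blast
    moreover have "spec j \<one> (x t) = x t"
      using spec_id'[OF j x_in_B[OF x]] x 3 by simp
    ultimately show ?thesis
      using x_closed[OF x] by simp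
  qed
next
  interpret g: ring_hom_ring A A "spec j \<one>"
    by (rule spec_ring_hom_ring[OF j one_sign])
  case (mult y z)
  define a where "a = h y"
  define b where "b = h z"
  define a' where "a' = spec j \<one> a"
  define b' where "b' = spec j \<one> b"
  have yz: "y \<in> carrier A" "z \<in> carrier A"
    using mult Z_Units by auto
  have hyz: "h (y \<otimes> z) = a \<otimes> b"
    unfolding a_def b_def by (rule ring_hom_mult[OF h(1) yz])
  have c: "a \<in> carrier A" "b \<in> carrier A" "a' \<in> carrier A" "b' \<in> carrier A" "x j \<in> carrier A"
    using mult x_closed[OF j] by (simp_all add: a_def b_def a'_def b'_def)
  have ab: "a = a' \<or> a = a' \<otimes> x j" "b = b' \<or> b = b' \<otimes> x j"
    using mult by (simp_all add: a_def b_def a'_def b'_def)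
  have "a' \<otimes> x j \<otimes> b' = a' \<otimes> (x j \<otimes> b')"
    using c by (simp add: m_assoc)
  also have "\<dots> = a' \<otimes> b' \<otimes> x j"
    unfolding x_comm[OF j c(4)] using c by (simp add: m_assoc)
  finally have comm: "a' \<otimes> x j \<otimes> b' = a' \<otimes> b' \<otimes> x j" .
  have "a' \<otimes> x j \<otimes> (b' \<otimes> x j) = a' \<otimes> x j \<otimes> b' \<otimes> x j"
    using c by (simp add: m_assoc)
  also have "\<dots> = a' \<otimes> b'"
    unfolding comm using c x_sq[OF j] by (simp add: m_assoc)
  finally have sq: "a' \<otimes> x j \<otimes> (b' \<otimes> x j) = a' \<otimes> b'" .
  have "a \<otimes> b = a' \<otimes> b' \<or> a \<otimes> b = a' \<otimes> b' \<otimes> x j"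
    using ab comm sq c by (elim disjE) (simp_all add: m_assoc)
  moreover have "spec j \<one> (a \<otimes> b) = a' \<otimes> b'"
    using c by (simp add: a'_def b'_def)
  ultimately show ?case
    unfolding hyz using c by simp
qed

text \<open>Let \<open>a = w z\<close> be in \<open>N j\<close>. Erasing the generators after
  \<open>j\<close> fixes \<open>a\<close> and \<open>w\<close> and turns \<open>z\<close> into
  \<open>y'\<close> or \<open>y' x j\<close>, where \<open>y'\<close> is the value at
  \<open>x j = 1\<close>. Putting \<open>x j = 1\<close> in \<open>a\<close> gives
  \<open>w y' = 1\<close>, so \<open>a\<close> is 1 or \<open>x j\<close>; but \<open>x j\<close> is
  not in \<open>N j\<close>.\<close>

lemma N_inter_D:
  assumes j: "j \<in> {1..n}"
  shows "N j \<inter> D (j - 1) \<subseteq> {\<one>}"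
proof
  interpret g: ring_hom_ring A A "spec j \<one>"
    by (rule spec_ring_hom_ring[OF j one_sign])
  fix a assume "a \<in> N j \<inter> D (j - 1)"
  then obtain w z where a: "a \<in> N j" "w \<in> W {1..j - 1}" "z \<in> Z" "a = w \<otimes> z"
    by (auto simp: D_iff)
  have sub: "{1..j} \<subseteq> {1..n}" "{1..j - 1} \<subseteq> {1..n}" "{1..j - 1} \<subseteq> {1..n} - {j}"
    "{1..j - 1} \<subseteq> {1..j}"
    using j by auto
  obtain h where h: "h \<in> ring_hom A A" "\<forall>a\<in>B {1..j}. h a = a" "\<forall>t\<in>{j<..n}. h (x t) = \<one>"
    using evaluation_exists[of j n "\<lambda>_. \<one>"] j one_sign by auto
  have aK: "a \<in> K j" "a \<in> B {1..j}" "spec j \<one> a = \<one>"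
    using a(1) by (auto simp: N_def K_def W_iff)
  have wB: "w \<in> B {1..j - 1}" "w \<in> carrier A"
    using a(2) W_carrier[OF sub(2)] by (auto simp: W_iff)
  then have hw: "h w = w" "spec j \<one> w = w"
    using h(2) B_mono[OF sub(4,1)] spec_id'[OF j wB(1) sub(3)] by auto
  define y where "y = h z"
  have y: "y \<in> carrier A" "y = spec j \<one> y \<or> y = spec j \<one> y \<otimes> x j"
    using evaluation_of_Z[OF h j a(3)] by (simp_all add: y_def)
  have zc: "z \<in> carrier A"
    using Units_closed[OF Z_Units[OF a(3)]] .
  have "a = h (w \<otimes> z)"
    using h(2) aK(2) a(4) by simp
  also have "\<dots> = w \<otimes> y"
    using ring_hom_mult[OF h(1) wB(2) zc] hw by (simp add: y_def)
  finally have ay: "a = w \<otimes> y" .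
  then have one: "w \<otimes> spec j \<one> y = \<one>"
    using aK(3) wB y(1) hw by simp
  have "a \<noteq> x j"
    using a(1) x_notin_N[OF j] by blast
  moreover have "w \<otimes> (spec j \<one> y \<otimes> x j) = x j"
    using one wB(2) y(1) x_closed[OF j] by (simp add: m_assoc[symmetric])
  ultimately have "a = \<one>"
    using y(2) one ay by metis
  then show "a \<in> {\<one>}"
    by simp
qed

lemma D_semidirect:
  assumes j: "j \<in> {1..n}"
  shows "internal_semidirect M (N j) (D (j - 1)) (D j)"
proof (rule group.internal_semidirectI[OF M_group])
  have sub: "{1..j} \<subseteq> {1..n}" "{1..j - 1} \<subseteq> {1..n}" "{1..j - 1} \<subseteq> {1..j}"
    using j by auto
  have jn: "j \<le> n" "j - 1 \<le> n"
    using j by auto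
  show "subgroup (D j) M" "subgroup (D (j - 1)) M" "subgroup (N j) M"
    using D_subgroup jn N_subgroup[OF j] by auto
  have NW: "N j \<subseteq> W {1..j}"
    by (auto simp: N_def K_def)
  then show "N j \<subseteq> D j"
    using W_in_D[OF _ jn(1)] by blast
  show "D (j - 1) \<subseteq> D j"
    using W_mono[OF sub(3,1)] unfolding D_def set_mult_def by blast
  show "N j \<inter> D (j - 1) \<subseteq> {\<one>\<^bsub>M\<^esub>}"
    using N_inter_D[OF j] by simp
  note WU = subsetD[OF W_Units[OF sub(1)]]
  show "d \<otimes>\<^bsub>M\<^esub> a \<otimes>\<^bsub>M\<^esub> inv\<^bsub>M\<^esub> d \<in> N j" if "d \<in> D j" "a \<in> N j" for d a
  proof -
    have "a \<in> carrier A"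
      using that(2) NW WU by blast
    then obtain w where "w \<in> W {1..j}" "d \<otimes> a \<otimes> inv\<^bsub>M\<^esub> d = w \<otimes> a \<otimes> inv\<^bsub>M\<^esub> w"
      using D_conjugate[OF jn(1) \<open>d \<in> D j\<close>] by blast
    then show ?thesis
      using N_normalized[OF j _ that(2)] by simp
  qed
  show "D j \<subseteq> N j <#>\<^bsub>M\<^esub> D (j - 1)"
  proof
    fix d assume "d \<in> D j"
    then obtain w z where d: "w \<in> W {1..j}" "z \<in> Z" "d = w \<otimes> z"
      by (auto simp: D_iff)
    have "w \<in> K j <#>\<^bsub>M\<^esub> W {1..j - 1}"
      using d(1) group.internal_semidirectD(8)[OF M_group K_semidirect[OF j]] by simp
    then obtain k w' where k: "k \<in> K j" "w' \<in> W {1..j - 1}" "w = k \<otimes> w'"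
      by (auto simp: set_mult_def)
    have c: "k \<in> carrier A" "w' \<in> carrier A" "z \<in> carrier A" "x j \<in> carrier A"
      using k d K_carrier[OF j] W_carrier[OF sub(2)] Z_Units x_closed[OF j] by auto
    have "x j \<in> Z"
      using j unfolding Z_def by (intro generate.incl) auto
    then have xz: "x j \<otimes> z \<in> Z"
      using subgroup.m_closed[OF Z_subgroup _ d(2)] by simp
    have eq1: "d = k \<otimes> (w' \<otimes> z)"
      using c d(3) k(3) by (simp add: m_assoc)
    \<comment> \<open>For the case that \<open>k\<close> is not in \<open>N j\<close>: the central
      \<open>x j\<close> is inserted twice, once next to \<open>k\<close>, which brings it into
      \<open>N j\<close>, and once into the factor from \<open>Z\<close>.\<close>
    have "x j \<otimes> (w' \<otimes> (x j \<otimes> z)) = x j \<otimes> (x j \<otimes> w') \<otimes> z"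
      unfolding x_comm[OF j c(2)] using c by (simp add: m_assoc)
    also have "\<dots> = w' \<otimes> z"
      using c x_sq[OF j] by (simp add: m_assoc[symmetric])
    finally have eq2: "d = (k \<otimes> x j) \<otimes> (w' \<otimes> (x j \<otimes> z))"
      unfolding eq1 using c by (simp add: m_assoc)
    have "w' \<otimes> z \<in> D (j - 1)" "w' \<otimes> (x j \<otimes> z) \<in> D (j - 1)"
      using k(2) d(2) xz by (auto simp: D_iff)
    then show "d \<in> N j <#>\<^bsub>M\<^esub> D (j - 1)"
      using K_split[OF j k(1)] eq1 eq2 unfolding set_mult_def M_simps by blast
  qed
qed

lemma D_full: "D n = Units A"
proof
  show "D n \<subseteq> Units A"
    using subgroup.subset[OF D_subgroup[of n]] by simp
  show "Units A \<subseteq> D n"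
    using W_in_D[of _ n] W_full by auto
qed

lemma D_0_direct: "internal_direct M (W {}) Z (D 0)"
proof -
  have D0: "D 0 = W {} <#>\<^bsub>M\<^esub> Z"
    by (simp add: D_def)
  have sD: "subgroup (D 0) M" and sW: "subgroup (W {}) M"
    using D_subgroup[of 0] W_subgroup[of "{}"] by auto
  have WD: "W {} \<subseteq> D 0"
    using W_in_D[of _ 0] by auto
  have ZD: "Z \<subseteq> D 0"
  proof
    fix z assume z: "z \<in> Z"
    have "z = \<one> \<otimes> z"
      using Units_closed[OF Z_Units[OF z]] by simp
    then show "z \<in> D 0"
      using z subgroup.one_closed[OF sW] unfolding D0 set_mult_def M_simps by blast
  qed
  have sub: "subgroup (W {}) (M\<lparr>carrier := D 0\<rparr>)" "subgroup Z (M\<lparr>carrier := D 0\<rparr>)"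
    using group.subgroup_incl[OF M_group] sW Z_subgroup sD WD ZD by auto
  note Dinv = group.m_inv_consistent[OF M_group sD]
  have "W {} \<lhd> M\<lparr>carrier := D 0\<rparr>"
  proof (subst group.normal_inv_iff)
    show "group (M\<lparr>carrier := D 0\<rparr>)"
      by (rule group.subgroup_imp_group[OF M_group sD])
    have "d \<otimes> a \<otimes> inv\<^bsub>M\<^esub> d \<in> W {}" if "d \<in> D 0" "a \<in> W {}" for d a
    proof -
      have "a \<in> carrier A"
        using that(2) W_carrier[of "{}"] by blast
      then obtain w where w: "w \<in> W {}" "d \<otimes> a \<otimes> inv\<^bsub>M\<^esub> d = w \<otimes> a \<otimes> inv\<^bsub>M\<^esub> w"
        using D_conjugate[of 0 d a] \<open>d \<in> D 0\<close> by auto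
      then show ?thesis
        using subgroup.m_closed[OF sW subgroup.m_closed[OF sW w(1) that(2)] subgroup.m_inv_closed[OF sW w(1)]]
        by simp
    qed
    then show "subgroup (W {}) (M\<lparr>carrier := D 0\<rparr>) \<and>
      (\<forall>d\<in>carrier (M\<lparr>carrier := D 0\<rparr>). \<forall>a\<in>W {}.
        d \<otimes>\<^bsub>M\<lparr>carrier := D 0\<rparr>\<^esub> a \<otimes>\<^bsub>M\<lparr>carrier := D 0\<rparr>\<^esub> inv\<^bsub>M\<lparr>carrier := D 0\<rparr>\<^esub> d \<in> W {})"
      using sub Dinv by simp
  qed
  moreover have "Z \<lhd> M\<lparr>carrier := D 0\<rparr>"
  proof (subst group.normal_inv_iff)
    show "group (M\<lparr>carrier := D 0\<rparr>)"
      by (rule group.subgroup_imp_group[OF M_group sD])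
    have "d \<otimes> a \<otimes> inv\<^bsub>M\<^esub> d \<in> Z" if "d \<in> D 0" "a \<in> Z" for d a
    proof -
      have U: "d \<in> Units A" "d \<in> carrier A" "a \<in> carrier A"
        using that subgroup.subset[OF sD] Z_Units by auto
      have "d \<otimes> a \<otimes> inv d = a \<otimes> d \<otimes> inv d"
        using Z_comm[OF that(2) U(2)] by simp
      also have "\<dots> = a"
        using U by (simp add: m_assoc)
      finally show ?thesis
        using that(2) U inv_M by simp
    qed
    then show "subgroup Z (M\<lparr>carrier := D 0\<rparr>) \<and>
      (\<forall>d\<in>carrier (M\<lparr>carrier := D 0\<rparr>). \<forall>a\<in>Z.
        d \<otimes>\<^bsub>M\<lparr>carrier := D 0\<rparr>\<^esub> a \<otimes>\<^bsub>M\<lparr>carrier := D 0\<rparr>\<^esub> inv\<^bsub>M\<lparr>carrier := D 0\<rparr>\<^esub> d \<in> Z)"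
      using sub Dinv by simp
  qed
  moreover have "W {} \<inter> Z = {\<one>\<^bsub>M\<^esub>}"
  proof
    show "{\<one>\<^bsub>M\<^esub>} \<subseteq> W {} \<inter> Z"
      using subgroup.one_closed[OF sW] subgroup.one_closed[OF Z_subgroup] by blast
    \<comment> \<open>Setting all generators to 1 fixes \<open>W {}\<close> and sends
      \<open>Z\<close> to 1, so a common element is 1.\<close>
    obtain h where h: "h \<in> ring_hom A A" "\<forall>a\<in>B {}. h a = a" "\<forall>t\<in>{0<..n}. h (x t) = \<one>"
      using evaluation_exists[of 0 n "\<lambda>_. \<one>"] one_sign by auto
    have hz: "h z = \<one>" if "z \<in> Z" for z
      using that
    proof (induction rule: Z_induct)
      case one
      show ?case by (rule ring_hom_one[OF h(1)])
    next
      case (x t)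
      then show ?case using h(3) by auto
    next
      case (mult y z)
      then show ?case
        using ring_hom_mult[OF h(1), of y z] Units_closed[OF Z_Units] by simp
    qed
    show "W {} \<inter> Z \<subseteq> {\<one>\<^bsub>M\<^esub>}"
    proof
      fix a assume a: "a \<in> W {} \<inter> Z"
      then have "h a = a"
        using h(2) by (auto simp: W_iff)
      then show "a \<in> {\<one>\<^bsub>M\<^esub>}"
        using hz a by auto
    qed
  qed
  ultimately show ?thesis
    using sD D0 by (simp add: internal_direct_def)
qed

end

section \<open>Twisted group rings of finite groups\<close>

text \<open>The sum over \<open>w\<close> collapses along the fibres of \<open>m\<close>. In the
  associativity proof this replaces the coefficient of an inner product by a sum over pairs.\<close>

lemma sum_convolution:
  fixes F :: "'h \<Rightarrow> 'h \<Rightarrow> int"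
  assumes "finite S" and "\<And>y z. y \<in> S \<Longrightarrow> z \<in> S \<Longrightarrow> m y z \<in> S"
  shows "(\<Sum>w\<in>S. (\<Sum>y\<in>S. \<Sum>z\<in>S. if m y z = w then F y z else 0) * g w)
    = (\<Sum>y\<in>S. \<Sum>z\<in>S. F y z * g (m y z))"
proof -
  have "(\<Sum>w\<in>S. (\<Sum>y\<in>S. \<Sum>z\<in>S. if m y z = w then F y z else 0) * g w)
      = (\<Sum>w\<in>S. \<Sum>y\<in>S. \<Sum>z\<in>S. if m y z = w then F y z * g w else 0)"
    by (simp add: sum_distrib_right if_distrib[of "\<lambda>c. c * _"] cong: if_cong)
  also have "\<dots> = (\<Sum>y\<in>S. \<Sum>w\<in>S. \<Sum>z\<in>S. if m y z = w then F y z * g w else 0)"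
    by (rule sum.swap)
  also have "\<dots> = (\<Sum>y\<in>S. \<Sum>z\<in>S. \<Sum>w\<in>S. if m y z = w then F y z * g w else 0)"
    by (intro sum.cong refl sum.swap)
  also have "\<dots> = (\<Sum>y\<in>S. \<Sum>z\<in>S. F y z * g (m y z))"
    using assms by (intro sum.cong refl) simp
  finally show ?thesis .
qed

locale finite_twisted_group = group H for H (structure) +
  fixes \<alpha> :: "'a \<Rightarrow> 'a \<Rightarrow> int"
  assumes finite_carrier: "finite (carrier H)"
    and cocycle: "normalized_cocycle H \<alpha>"
begin

abbreviation TR where "TR \<equiv> twisted_group_ring H \<alpha>"

lemma cocycle_sq: "g \<in> carrier H \<Longrightarrow> h \<in> carrier H \<Longrightarrow> \<alpha> g h * \<alpha> g h = 1"
proof -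
  assume "g \<in> carrier H" "h \<in> carrier H"
  then have "\<alpha> g h = 1 \<or> \<alpha> g h = - 1"
    using cocycle by (simp add: normalized_cocycle_def)
  then show ?thesis by auto
qed

lemma cocycle_assoc:
  "g \<in> carrier H \<Longrightarrow> h \<in> carrier H \<Longrightarrow> k \<in> carrier H \<Longrightarrow>
    \<alpha> g h * \<alpha> (g \<otimes> h) k = \<alpha> h k * \<alpha> g (h \<otimes> k)"
  using cocycle by (auto simp: normalized_cocycle_def)

lemma cocycle_one: "g \<in> carrier H \<Longrightarrow> \<alpha> \<one> g = 1" "g \<in> carrier H \<Longrightarrow> \<alpha> g \<one> = 1"
  using cocycle by (auto simp: normalized_cocycle_def)

lemma TR_carrier: "a \<in> carrier TR \<longleftrightarrow> supp a \<subseteq> carrier H"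
  using finite_subset[OF _ finite_carrier] by (auto simp: twisted_group_ring_def)

lemma TR_carrier': "a \<in> carrier TR \<longleftrightarrow> (\<forall>z. z \<notin> carrier H \<longrightarrow> a z = 0)"
  by (auto simp: TR_carrier supp_def)

lemma TR_simps: "\<zero>\<^bsub>TR\<^esub> = (\<lambda>z. 0)" "\<one>\<^bsub>TR\<^esub> = basis_elem \<one>" "a \<oplus>\<^bsub>TR\<^esub> b = (\<lambda>z. a z + b z)"
  by (simp_all add: twisted_group_ring_def)

lemma TR_mult:
  assumes "a \<in> carrier TR" "b \<in> carrier TR"
  shows "(a \<otimes>\<^bsub>TR\<^esub> b) z
    = (\<Sum>g\<in>carrier H. \<Sum>h\<in>carrier H. if g \<otimes> h = z then a g * b h * \<alpha> g h else 0)"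
proof -
  have s: "supp a \<subseteq> carrier H" "supp b \<subseteq> carrier H"
    using assms by (auto simp: TR_carrier)
  have "(a \<otimes>\<^bsub>TR\<^esub> b) z = (\<Sum>g\<in>supp a. \<Sum>h\<in>supp b. if g \<otimes> h = z then a g * b h * \<alpha> g h else 0)"
    by (simp add: twisted_group_ring_def)
  also have "\<dots> = (\<Sum>g\<in>supp a. \<Sum>h\<in>carrier H. if g \<otimes> h = z then a g * b h * \<alpha> g h else 0)"
    by (intro sum.cong refl sum.mono_neutral_left finite_carrier s) (auto simp: supp_def)
  also have "\<dots> = (\<Sum>g\<in>carrier H. \<Sum>h\<in>carrier H. if g \<otimes> h = z then a g * b h * \<alpha> g h else 0)"
    by (intro sum.mono_neutral_left finite_carrier s) (auto simp: supp_def cong: if_cong)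
  finally show ?thesis .
qed

lemma TR_mult_supp:
  assumes "a \<in> carrier TR" "b \<in> carrier TR" "(a \<otimes>\<^bsub>TR\<^esub> b) z \<noteq> 0"
  obtains g h where "g \<in> supp a" "h \<in> supp b" "z = g \<otimes> h"
proof -
  have "\<exists>g\<in>supp a. \<exists>h\<in>supp b. z = g \<otimes> h"
  proof (rule ccontr)
    assume "\<not> ?thesis"
    then have "(a \<otimes>\<^bsub>TR\<^esub> b) z = 0"
      unfolding TR_mult[OF assms(1,2)] supp_def by (intro sum.neutral ballI) auto
    then show False
      using assms(3) by simp
  qed
  then show ?thesis
    using that by blast
qed

lemma TR_mult_closed:
  assumes "a \<in> carrier TR" "b \<in> carrier TR"
  shows "a \<otimes>\<^bsub>TR\<^esub> b \<in> carrier TR"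
  unfolding TR_carrier
proof
  fix z assume "z \<in> supp (a \<otimes>\<^bsub>TR\<^esub> b)"
  then have "(a \<otimes>\<^bsub>TR\<^esub> b) z \<noteq> 0"
    by (simp add: supp_def)
  then obtain g h where "g \<in> supp a" "h \<in> supp b" "z = g \<otimes> h"
    using TR_mult_supp[OF assms] by blast
  then show "z \<in> carrier H"
    using assms by (auto simp: TR_carrier)
qed

lemma basis_closed: "g \<in> carrier H \<Longrightarrow> basis_elem g \<in> carrier TR"
  by (rule basis_elem_closed)

lemma basis_mult_left:
  assumes "a \<in> carrier TR" "g \<in> carrier H" "z \<in> carrier H"
  shows "(basis_elem g \<otimes>\<^bsub>TR\<^esub> a) (g \<otimes> z) = a z * \<alpha> g z"
proof -
  have "(\<Sum>h\<in>carrier H. if g' \<otimes> h = g \<otimes> z then basis_elem g g' * a h * \<alpha> g' h else 0)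
      = (if g' = g then a z * \<alpha> g z else 0)" if "g' \<in> carrier H" for g'
  proof (cases "g' = g")
    case True
    then have "(\<Sum>h\<in>carrier H. if g' \<otimes> h = g \<otimes> z then basis_elem g g' * a h * \<alpha> g' h else 0)
        = (\<Sum>h\<in>carrier H. if h = z then a h * \<alpha> g h else 0)"
      using assms by (intro sum.cong) (auto simp: basis_elem_def)
    then show ?thesis
      using True assms finite_carrier by simp
  qed (simp add: basis_elem_def cong: if_cong)
  then show ?thesis
    using TR_mult[OF basis_closed[OF assms(2)] assms(1)] assms finite_carrier by simp
qed

lemma basis_mult_right:
  assumes "a \<in> carrier TR" "g \<in> carrier H" "z \<in> carrier H"
  shows "(a \<otimes>\<^bsub>TR\<^esub> basis_elem g) (z \<otimes> g) = a z * \<alpha> z g"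
proof -
  have "(\<Sum>h\<in>carrier H. if g' \<otimes> h = z \<otimes> g then a g' * basis_elem g h * \<alpha> g' h else 0)
      = (if g' = z then a z * \<alpha> z g else 0)" if "g' \<in> carrier H" for g'
  proof -
    have "(\<Sum>h\<in>carrier H. if g' \<otimes> h = z \<otimes> g then a g' * basis_elem g h * \<alpha> g' h else 0)
        = (\<Sum>h\<in>carrier H. if h = g then if g' = z then a g' * \<alpha> g' h else 0 else 0)"
      using assms that by (intro sum.cong) (auto simp: basis_elem_def)
    then show ?thesis
      using assms finite_carrier by simp
  qed
  then show ?thesis
    using TR_mult[OF assms(1) basis_closed[OF assms(2)]] assms finite_carrier by simp
qed

lemma TR_eqI:
  assumes "a \<in> carrier TR" "b \<in> carrier TR" "\<And>z. z \<in> carrier H \<Longrightarrow> a z = b z"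
  shows "a = b"
  using assms unfolding TR_carrier' by (intro ext) metis

text \<open>Both bracketings expand into a triple sum over \<open>g\<close>, \<open>h\<close>,
  \<open>t\<close>; the summands agree by the cocycle identity.\<close>

lemma TR_assoc:
  assumes a: "a \<in> carrier TR" and b: "b \<in> carrier TR" and c: "c \<in> carrier TR"
  shows "a \<otimes>\<^bsub>TR\<^esub> b \<otimes>\<^bsub>TR\<^esub> c = a \<otimes>\<^bsub>TR\<^esub> (b \<otimes>\<^bsub>TR\<^esub> c)"
proof
  fix z
  let ?H = "carrier H"
  have "(a \<otimes>\<^bsub>TR\<^esub> b \<otimes>\<^bsub>TR\<^esub> c) z
      = (\<Sum>w\<in>?H. \<Sum>t\<in>?H. if w \<otimes> t = z then (a \<otimes>\<^bsub>TR\<^esub> b) w * c t * \<alpha> w t else 0)"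
    using TR_mult[OF TR_mult_closed[OF a b] c] .
  also have "\<dots> = (\<Sum>w\<in>?H. \<Sum>t\<in>?H. (a \<otimes>\<^bsub>TR\<^esub> b) w * (if w \<otimes> t = z then c t * \<alpha> w t else 0))"
    by (intro sum.cong refl) simp
  also have "\<dots> = (\<Sum>t\<in>?H. \<Sum>w\<in>?H. (a \<otimes>\<^bsub>TR\<^esub> b) w * (if w \<otimes> t = z then c t * \<alpha> w t else 0))"
    by (rule sum.swap)
  also have "\<dots> = (\<Sum>t\<in>?H. \<Sum>g\<in>?H. \<Sum>h\<in>?H. (a g * b h * \<alpha> g h) *
      (if g \<otimes> h \<otimes> t = z then c t * \<alpha> (g \<otimes> h) t else 0))"
    unfolding TR_mult[OF a b] by (intro sum.cong refl sum_convolution finite_carrier) simp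
  also have "\<dots> = (\<Sum>g\<in>?H. \<Sum>t\<in>?H. \<Sum>h\<in>?H. (a g * b h * \<alpha> g h) *
      (if g \<otimes> h \<otimes> t = z then c t * \<alpha> (g \<otimes> h) t else 0))"
    by (rule sum.swap)
  also have "\<dots> = (\<Sum>g\<in>?H. \<Sum>h\<in>?H. \<Sum>t\<in>?H. (a g * b h * \<alpha> g h) *
      (if g \<otimes> h \<otimes> t = z then c t * \<alpha> (g \<otimes> h) t else 0))"
    by (intro sum.cong refl sum.swap)
  also have "\<dots> = (\<Sum>g\<in>?H. \<Sum>h\<in>?H. \<Sum>t\<in>?H. (b h * c t * \<alpha> h t) *
      (if g \<otimes> (h \<otimes> t) = z then a g * \<alpha> g (h \<otimes> t) else 0))"
  proof (intro sum.cong refl)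
    fix g h t assume ght: "g \<in> ?H" "h \<in> ?H" "t \<in> ?H"
    have "(a g * b h * \<alpha> g h) * (c t * \<alpha> (g \<otimes> h) t) = a g * b h * c t * (\<alpha> g h * \<alpha> (g \<otimes> h) t)"
      by (simp add: mult_ac)
    also have "\<dots> = (b h * c t * \<alpha> h t) * (a g * \<alpha> g (h \<otimes> t))"
      unfolding cocycle_assoc[OF ght] by (simp add: mult_ac)
    finally have eq: "(a g * b h * \<alpha> g h) * (c t * \<alpha> (g \<otimes> h) t) = (b h * c t * \<alpha> h t) * (a g * \<alpha> g (h \<otimes> t))" .
    have "g \<otimes> h \<otimes> t = g \<otimes> (h \<otimes> t)"
      using ght by (simp add: m_assoc)
    then show "(a g * b h * \<alpha> g h) * (if g \<otimes> h \<otimes> t = z then c t * \<alpha> (g \<otimes> h) t else 0)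
        = (b h * c t * \<alpha> h t) * (if g \<otimes> (h \<otimes> t) = z then a g * \<alpha> g (h \<otimes> t) else 0)"
      by (simp only: eq if_distrib[of "\<lambda>y. _ * y"] mult_zero_right)
  qed
  also have "\<dots> = (\<Sum>g\<in>?H. \<Sum>w\<in>?H. (b \<otimes>\<^bsub>TR\<^esub> c) w * (if g \<otimes> w = z then a g * \<alpha> g w else 0))"
    unfolding TR_mult[OF b c] by (intro sum.cong refl sum_convolution[symmetric] finite_carrier) simp
  also have "\<dots> = (\<Sum>g\<in>?H. \<Sum>w\<in>?H. if g \<otimes> w = z then a g * (b \<otimes>\<^bsub>TR\<^esub> c) w * \<alpha> g w else 0)"
    by (intro sum.cong refl) simp
  also have "\<dots> = (a \<otimes>\<^bsub>TR\<^esub> (b \<otimes>\<^bsub>TR\<^esub> c)) z"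
    using TR_mult[OF a TR_mult_closed[OF b c]] by simp
  finally show "(a \<otimes>\<^bsub>TR\<^esub> b \<otimes>\<^bsub>TR\<^esub> c) z = (a \<otimes>\<^bsub>TR\<^esub> (b \<otimes>\<^bsub>TR\<^esub> c)) z" .
qed

lemma TR_l_one: "a \<in> carrier TR \<Longrightarrow> \<one>\<^bsub>TR\<^esub> \<otimes>\<^bsub>TR\<^esub> a = a"
  using basis_mult_left[of a \<one>] TR_mult_closed[OF basis_closed]
  by (intro TR_eqI) (simp_all add: TR_simps cocycle_one)

lemma TR_r_one: "a \<in> carrier TR \<Longrightarrow> a \<otimes>\<^bsub>TR\<^esub> \<one>\<^bsub>TR\<^esub> = a"
  using basis_mult_right[of a \<one>] TR_mult_closed[OF _ basis_closed]
  by (intro TR_eqI) (simp_all add: TR_simps cocycle_one)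

lemma TR_ring: "ring TR"
proof (rule ringI)
  show "abelian_group TR"
  proof (rule abelian_groupI)
    show "\<exists>b\<in>carrier TR. b \<oplus>\<^bsub>TR\<^esub> a = \<zero>\<^bsub>TR\<^esub>" if "a \<in> carrier TR" for a
      using that by (intro bexI[of _ "\<lambda>z. - a z"]) (auto simp: TR_carrier' TR_simps)
  qed (auto simp: TR_carrier' TR_simps)
  have "\<one>\<^bsub>TR\<^esub> \<in> carrier TR"
    unfolding TR_simps by (rule basis_closed[OF one_closed])
  then show "monoid TR"
    by (intro monoidI TR_mult_closed TR_assoc TR_l_one TR_r_one)
  fix a b c assume abc: "a \<in> carrier TR" "b \<in> carrier TR" "c \<in> carrier TR"
  then have "a \<oplus>\<^bsub>TR\<^esub> b \<in> carrier TR"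
    by (auto simp: TR_carrier' TR_simps)
  note m = TR_mult[OF this abc(3)] TR_mult[OF abc(3) this] TR_mult[OF abc(1,3)] TR_mult[OF abc(2,3)]
    TR_mult[OF abc(3,1)] TR_mult[OF abc(3,2)]
  show "(a \<oplus>\<^bsub>TR\<^esub> b) \<otimes>\<^bsub>TR\<^esub> c = a \<otimes>\<^bsub>TR\<^esub> c \<oplus>\<^bsub>TR\<^esub> b \<otimes>\<^bsub>TR\<^esub> c"
    unfolding fun_eq_iff TR_simps(3)[of "a \<otimes>\<^bsub>TR\<^esub> c"] m
    by (auto simp: TR_simps(3) distrib_right simp flip: sum.distrib intro!: sum.cong)
  show "c \<otimes>\<^bsub>TR\<^esub> (a \<oplus>\<^bsub>TR\<^esub> b) = c \<otimes>\<^bsub>TR\<^esub> a \<oplus>\<^bsub>TR\<^esub> c \<otimes>\<^bsub>TR\<^esub> b"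
    unfolding fun_eq_iff TR_simps(3)[of "c \<otimes>\<^bsub>TR\<^esub> a"] m
    by (auto simp: TR_simps(3) distrib_right distrib_left simp flip: sum.distrib intro!: sum.cong)
qed

lemma TR_minus:
  assumes "a \<in> carrier TR"
  shows "\<ominus>\<^bsub>TR\<^esub> a = (\<lambda>z. - a z)"
proof -
  interpret R: ring TR by (rule TR_ring)
  have "(\<lambda>z. - a z) \<in> carrier TR"
    using assms by (auto simp: TR_carrier')
  moreover have "(\<lambda>z. - a z) \<oplus>\<^bsub>TR\<^esub> a = \<zero>\<^bsub>TR\<^esub>"
    by (auto simp: TR_simps)
  ultimately show ?thesis
    using assms by (intro R.minus_equality)
qed

lemma TR_add_pow: "add_pow TR (k :: nat) a z = int k * a z"
proof (induction k)
  case 0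
  then show ?case
    by (simp add: add_pow_def nat_pow_def TR_simps)
next
  case (Suc k)
  have "add_pow TR (Suc k) a = add_pow TR k a \<oplus>\<^bsub>TR\<^esub> a"
    by (simp add: add_pow_def nat_pow_def)
  then show ?case
    using Suc by (simp add: TR_simps algebra_simps)
qed

section \<open>The trace and idempotents\<close>

lemma TR_trace_comm:
  assumes "a \<in> carrier TR" "b \<in> carrier TR"
  shows "(a \<otimes>\<^bsub>TR\<^esub> b) \<one> = (b \<otimes>\<^bsub>TR\<^esub> a) \<one>"
proof -
  \<comment> \<open>The cocycle identity for the triple \<open>g, h, g\<close>; as \<open>g\<close>
    and \<open>h\<close> are mutually inverse, normalisation makes the other two values 1.\<close>
  have sym: "\<alpha> g h = \<alpha> h g" if "g \<in> carrier H" "h \<in> carrier H" "g \<otimes> h = \<one>" for g h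
  proof -
    have "h \<otimes> g = \<one>"
      using that by (simp add: inv_equality inv_comm)
    then show ?thesis
      using cocycle_assoc[of g h g] that by (simp add: cocycle_one)
  qed
  have "(a \<otimes>\<^bsub>TR\<^esub> b) \<one>
      = (\<Sum>g\<in>carrier H. \<Sum>h\<in>carrier H. if g \<otimes> h = \<one> then a g * b h * \<alpha> g h else 0)"
    by (rule TR_mult[OF assms])
  also have "\<dots> = (\<Sum>h\<in>carrier H. \<Sum>g\<in>carrier H. if g \<otimes> h = \<one> then a g * b h * \<alpha> g h else 0)"
    by (rule sum.swap)
  also have "\<dots> = (\<Sum>h\<in>carrier H. \<Sum>g\<in>carrier H. if h \<otimes> g = \<one> then b h * a g * \<alpha> h g else 0)"
    using sym inv_comm by (intro sum.cong refl) (auto simp: mult_ac)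
  also have "\<dots> = (b \<otimes>\<^bsub>TR\<^esub> a) \<one>"
    by (rule TR_mult[OF assms(2,1), symmetric])
  finally show ?thesis .
qed

text \<open>Left multiplication by \<open>e\<close> is an idempotent matrix of trace \<open>|H| e(1)\<close>.\<close>

lemma idempotent_trace:
  assumes e: "e \<in> carrier TR" and idem: "e \<otimes>\<^bsub>TR\<^esub> e = e"
  shows "0 \<le> e \<one>" and "e \<one> = 0 \<Longrightarrow> e = \<zero>\<^bsub>TR\<^esub>"
proof -
  define P where "P i k = (\<Sum>g\<in>carrier H. if g \<otimes> k = i then e g * \<alpha> g k else 0)" for i k
  have apply_P: "(e \<otimes>\<^bsub>TR\<^esub> b) i = (\<Sum>k\<in>carrier H. P i k * b k)" if "b \<in> carrier TR" for b i
  proof -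
    have "(e \<otimes>\<^bsub>TR\<^esub> b) i = (\<Sum>k\<in>carrier H. \<Sum>g\<in>carrier H. if g \<otimes> k = i then e g * b k * \<alpha> g k else 0)"
      unfolding TR_mult[OF e that] by (rule sum.swap)
    also have "\<dots> = (\<Sum>k\<in>carrier H. P i k * b k)"
      unfolding P_def sum_distrib_right by (intro sum.cong refl) simp
    finally show ?thesis .
  qed
  have column: "(e \<otimes>\<^bsub>TR\<^esub> basis_elem j) i = P i j" if "j \<in> carrier H" for i j
  proof -
    have "(\<Sum>k\<in>carrier H. P i k * basis_elem j k) = (\<Sum>k\<in>carrier H. if k = j then P i k else 0)"
      by (intro sum.cong refl) (simp add: basis_elem_def)
    then show ?thesis
      using apply_P[OF basis_closed[OF that]] that finite_carrier by simp
  qed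
  have P_idem: "(\<Sum>k\<in>carrier H. P i k * P k j) = P i j" if "j \<in> carrier H" for i j
  proof -
    have "(\<Sum>k\<in>carrier H. P i k * P k j) = (e \<otimes>\<^bsub>TR\<^esub> (e \<otimes>\<^bsub>TR\<^esub> basis_elem j)) i"
      using apply_P[OF TR_mult_closed[OF e basis_closed[OF that]]] column[OF that] by simp
    also have "\<dots> = P i j"
      using TR_assoc[OF e e basis_closed[OF that]] idem column[OF that] by simp
    finally show ?thesis .
  qed
  have diag: "P i i = e \<one>" if "i \<in> carrier H" for i
  proof -
    have "P i i = (\<Sum>g\<in>carrier H. if g = \<one> then e g * \<alpha> g i else 0)"
      unfolding P_def using that by (intro sum.cong refl) auto
    then show ?thesis
      using that finite_carrier by (simp add: cocycle_one)
  qed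
  have real_idem: "(\<Sum>k\<in>carrier H. real_of_int (P i k) * real_of_int (P k j)) = real_of_int (P i j)"
    if "j \<in> carrier H" for i j
    using P_idem[OF that, of i] by (metis (mono_tags, lifting) of_int_mult of_int_sum sum.cong)
  have tr: "(\<Sum>i\<in>carrier H. real_of_int (P i i)) = real (card (carrier H)) * real_of_int (e \<one>)"
    using diag by simp
  have card: "0 < card (carrier H)"
    using finite_carrier one_closed card_gt_0_iff by blast
  have "0 \<le> (\<Sum>i\<in>carrier H. real_of_int (P i i))"
    by (rule trace_idempotent_matrix(1)[OF finite_carrier real_idem])
  then show "0 \<le> e \<one>"
    using card unfolding tr by (simp add: zero_le_mult_iff)
  assume "e \<one> = 0"
  then have zero: "(\<Sum>i\<in>carrier H. real_of_int (P i i)) = 0"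
    unfolding tr by simp
  have "P i \<one> = 0" if "i \<in> carrier H" for i
    using trace_idempotent_matrix(2)[OF finite_carrier real_idem zero that one_closed] by simp
  moreover have "P i \<one> = e i" for i
    using column[OF one_closed, of i] TR_r_one[OF e] by (simp add: TR_simps)
  ultimately show "e = \<zero>\<^bsub>TR\<^esub>"
    using e by (intro TR_eqI) (auto simp: TR_simps TR_carrier')
qed

text \<open>The coefficients at 1 of \<open>e\<close> and of the idempotent \<open>1 - e\<close> are
  nonnegative integers with sum 1. One of them is 0, and that idempotent vanishes.\<close>

lemma trivial_idempotents:
  assumes e: "e \<in> carrier TR" and idem: "e \<otimes>\<^bsub>TR\<^esub> e = e"
  shows "e = \<zero>\<^bsub>TR\<^esub> \<or> e = \<one>\<^bsub>TR\<^esub>"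
proof -
  interpret R: ring TR by (rule TR_ring)
  define f where "f = \<one>\<^bsub>TR\<^esub> \<ominus>\<^bsub>TR\<^esub> e"
  have f: "f \<in> carrier TR"
    using e by (simp add: f_def)
  have "f \<otimes>\<^bsub>TR\<^esub> e = \<zero>\<^bsub>TR\<^esub>"
    using e idem by (simp add: f_def a_minus_def R.l_distr R.l_minus R.r_neg)
  then have "f \<otimes>\<^bsub>TR\<^esub> f = f"
    using e f by (subst (2) f_def) (simp add: a_minus_def R.r_distr R.r_minus)
  then have ftr: "0 \<le> f \<one>" "f \<one> = 0 \<Longrightarrow> f = \<zero>\<^bsub>TR\<^esub>"
    using idempotent_trace[OF f] by auto
  have "f \<one> = 1 - e \<one>"
    by (simp add: f_def a_minus_def TR_simps TR_minus[OF e] basis_elem_def)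
  then consider "e \<one> = 0" | "f \<one> = 0"
    using ftr(1) idempotent_trace(1)[OF e idem] by linarith
  then show ?thesis
  proof cases
    case 1
    then show ?thesis
      using idempotent_trace(2)[OF e idem] by blast
  next
    case 2
    then have "\<one>\<^bsub>TR\<^esub> \<ominus>\<^bsub>TR\<^esub> e = \<zero>\<^bsub>TR\<^esub>"
      using ftr(2) by (simp add: f_def)
    then show ?thesis
      using e by simp
  qed
qed

section \<open>Subrings of elements supported on a subgroup\<close>

definition sub_TR :: "'a set \<Rightarrow> ('a \<Rightarrow> int) set" where
  "sub_TR L = {a \<in> carrier TR. supp a \<subseteq> L}"

lemma sub_TR_iff: "a \<in> sub_TR L \<longleftrightarrow> a \<in> carrier TR \<and> (\<forall>z. z \<notin> L \<longrightarrow> a z = 0)"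
  by (auto simp: sub_TR_def supp_def)

lemma sub_TR_subring:
  assumes L: "subgroup L H"
  shows "subring (sub_TR L) TR"
proof -
  interpret R: ring TR by (rule TR_ring)
  show ?thesis
  proof (rule R.subringI)
    show "sub_TR L \<subseteq> carrier TR"
      by (auto simp: sub_TR_iff)
    show "\<one>\<^bsub>TR\<^esub> \<in> sub_TR L"
      using subgroup.one_closed[OF L] R.one_closed by (auto simp: sub_TR_iff TR_simps basis_elem_def)
    show "\<ominus>\<^bsub>TR\<^esub> a \<in> sub_TR L" if "a \<in> sub_TR L" for a
      using that R.a_inv_closed[of a] by (auto simp: sub_TR_iff TR_minus)
    show "a \<otimes>\<^bsub>TR\<^esub> b \<in> sub_TR L" if ab: "a \<in> sub_TR L" "b \<in> sub_TR L" for a b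
    proof -
      have c: "a \<in> carrier TR" "b \<in> carrier TR" "supp a \<subseteq> L" "supp b \<subseteq> L"
        using ab by (auto simp: sub_TR_def)
      have "z \<in> L" if nz: "(a \<otimes>\<^bsub>TR\<^esub> b) z \<noteq> 0" for z
      proof -
        obtain g h where "g \<in> supp a" "h \<in> supp b" "z = g \<otimes> h"
          by (rule TR_mult_supp[OF c(1,2) nz])
        then show ?thesis
          using c subgroup.m_closed[OF L] by blast
      qed
      then show ?thesis
        using TR_mult_closed[OF c(1,2)] by (auto simp: sub_TR_iff)
    qed
    show "a \<oplus>\<^bsub>TR\<^esub> b \<in> sub_TR L" if "a \<in> sub_TR L" "b \<in> sub_TR L" for a b
      using that R.a_closed[of a b] by (auto simp: sub_TR_iff TR_simps)
  qed
qed

lemma involution_coset: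
  assumes "subgroup L H" "c \<in> carrier H" "c \<notin> L" "z \<in> L"
  shows "z \<otimes> c \<notin> L" and "z \<in> carrier H"
proof -
  show zc: "z \<in> carrier H"
    using subgroup.mem_carrier[OF assms(1,4)] .
  show "z \<otimes> c \<notin> L"
  proof
    assume "z \<otimes> c \<in> L"
    then have "inv z \<otimes> (z \<otimes> c) \<in> L"
      using assms(1,4) subgroup.m_closed subgroup.m_inv_closed by metis
    then show False
      using zc assms(2,3) by (simp add: m_assoc[symmetric])
  qed
qed

lemma mult_right_involution:
  assumes "v \<in> carrier TR" "c \<in> carrier H" "c \<otimes> c = \<one>" "z \<in> carrier H"
  shows "(v \<otimes>\<^bsub>TR\<^esub> basis_elem c) z = v (z \<otimes> c) * \<alpha> (z \<otimes> c) c"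
  using basis_mult_right[of v c "z \<otimes> c"] assms by (simp add: m_assoc)

lemma sub_TR_decompose:
  assumes L: "subgroup L H" and c: "c \<in> carrier H" "c \<notin> L" "c \<otimes> c = \<one>"
    and a: "a \<in> sub_TR (L \<union> (\<lambda>z. z \<otimes> c) ` L)"
  shows "\<exists>u\<in>sub_TR L. \<exists>v\<in>sub_TR L. a = u \<oplus>\<^bsub>TR\<^esub> v \<otimes>\<^bsub>TR\<^esub> basis_elem c"
proof -
  define u where "u z = (if z \<in> L then a z else 0)" for z
  \<comment> \<open>The sign undoes the one in \<open>u_z u_c = \<alpha>(z, c) u_zc\<close>; being 1
    or -1, it is its own inverse.\<close>
  define v where "v z = (if z \<in> L then a (z \<otimes> c) * \<alpha> z c else 0)" for z
  have ac: "a \<in> carrier TR" "\<And>z. z \<notin> L \<union> (\<lambda>z. z \<otimes> c) ` L \<Longrightarrow> a z = 0"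
    using a by (auto simp: sub_TR_iff)
  have uv: "u \<in> sub_TR L" "v \<in> sub_TR L"
    using subgroup.mem_carrier[OF L] by (auto simp: sub_TR_iff TR_carrier' u_def v_def)
  then have uvc: "u \<in> carrier TR" "v \<in> carrier TR"
    by (auto simp: sub_TR_iff)
  interpret R: ring TR by (rule TR_ring)
  have "a = u \<oplus>\<^bsub>TR\<^esub> v \<otimes>\<^bsub>TR\<^esub> basis_elem c"
  proof (rule TR_eqI)
    show "u \<oplus>\<^bsub>TR\<^esub> v \<otimes>\<^bsub>TR\<^esub> basis_elem c \<in> carrier TR"
      using uvc basis_closed[OF c(1)] by simp
    fix z assume z: "z \<in> carrier H"
    have vz: "(v \<otimes>\<^bsub>TR\<^esub> basis_elem c) z = v (z \<otimes> c) * \<alpha> (z \<otimes> c) c"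
      by (rule mult_right_involution[OF uvc(2) c(1,3) z])
    have zcc: "z \<otimes> c \<otimes> c = z"
      using z c by (simp add: m_assoc)
    show "a z = (u \<oplus>\<^bsub>TR\<^esub> v \<otimes>\<^bsub>TR\<^esub> basis_elem c) z"
    proof (cases "z \<in> L")
      case True
      then show ?thesis
        using involution_coset[OF L c(1,2) True] by (simp add: TR_simps vz u_def v_def)
    next
      case False
      show ?thesis
      proof (cases "z \<otimes> c \<in> L")
        case True
        then show ?thesis
          using False zcc cocycle_sq[of "z \<otimes> c" c] z c by (simp add: TR_simps vz u_def v_def mult.assoc)
      next
        case zc: False
        have "z \<notin> (\<lambda>z. z \<otimes> c) ` L"
        proof
          assume "z \<in> (\<lambda>z. z \<otimes> c) ` L"
          then obtain y where "y \<in> L" "z = y \<otimes> c" by blast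
          then have "z \<otimes> c = y"
            using subgroup.mem_carrier[OF L] c by (simp add: m_assoc)
          then show False
            using zc \<open>y \<in> L\<close> by simp
        qed
        then show ?thesis
          using False zc ac(2)[of z] by (simp add: TR_simps vz u_def v_def)
      qed
    qed
  qed (rule ac(1))
  then show ?thesis
    using uv by blast
qed

text \<open>For \<open>z\<close> in \<open>L\<close> the element \<open>z \<otimes> c\<close> lies
  outside \<open>L\<close>, so \<open>u\<close> is read off on \<open>L\<close> and
  \<open>v\<close>, up to sign, on the coset.\<close>

lemma sub_TR_direct:
  assumes L: "subgroup L H" and c: "c \<in> carrier H" "c \<notin> L" "c \<otimes> c = \<one>"
    and uv: "u \<in> sub_TR L" "v \<in> sub_TR L" "u' \<in> sub_TR L" "v' \<in> sub_TR L"
    and eq: "u \<oplus>\<^bsub>TR\<^esub> v \<otimes>\<^bsub>TR\<^esub> basis_elem c = u' \<oplus>\<^bsub>TR\<^esub> v' \<otimes>\<^bsub>TR\<^esub> basis_elem c"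
  shows "u = u' \<and> v = v'"
proof -
  have uvc: "u \<in> carrier TR" "v \<in> carrier TR" "u' \<in> carrier TR" "v' \<in> carrier TR"
    using uv by (auto simp: sub_TR_iff)
  have out: "u z = 0" "v z = 0" "u' z = 0" "v' z = 0" if "z \<notin> L" for z
    using uv that by (auto simp: sub_TR_iff)
  have eqz: "u z + v (z \<otimes> c) * \<alpha> (z \<otimes> c) c = u' z + v' (z \<otimes> c) * \<alpha> (z \<otimes> c) c" if "z \<in> carrier H" for z
    using fun_cong[OF eq, of z] mult_right_involution[OF _ c(1,3) that] uvc by (simp add: TR_simps)
  have in_L: "u z = u' z" "v z = v' z" if z: "z \<in> L" for z
  proof -
    note zc = involution_coset[OF L c(1,2) z]
    show "u z = u' z"
      using eqz[OF zc(2)] out[OF zc(1)] by simp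
    have "z \<otimes> c \<otimes> c = z"
      using zc c by (simp add: m_assoc)
    then have "v z * \<alpha> z c = v' z * \<alpha> z c"
      using eqz[of "z \<otimes> c"] out[OF zc(1)] zc(2) c(1) by simp
    then show "v z = v' z"
      using cocycle_sq[OF zc(2) c(1)] by auto
  qed
  have "u z = u' z" "v z = v' z" for z
    using in_L out by (cases "z \<in> L"; simp)+
  then show ?thesis
    by blast
qed

lemma basis_central:
  assumes c: "c \<in> carrier H"
    and comm: "\<And>g. g \<in> carrier H \<Longrightarrow> c \<otimes> g = g \<otimes> c"
    and sym: "\<And>g. g \<in> carrier H \<Longrightarrow> \<alpha> c g = \<alpha> g c"
    and a: "a \<in> carrier TR"
  shows "basis_elem c \<otimes>\<^bsub>TR\<^esub> a = a \<otimes>\<^bsub>TR\<^esub> basis_elem c"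
proof (rule TR_eqI)
  show "basis_elem c \<otimes>\<^bsub>TR\<^esub> a \<in> carrier TR" "a \<otimes>\<^bsub>TR\<^esub> basis_elem c \<in> carrier TR"
    using TR_mult_closed basis_closed[OF c] a by auto
  fix z assume z: "z \<in> carrier H"
  define y where "y = inv c \<otimes> z"
  have y: "y \<in> carrier H" "z = c \<otimes> y"
    using z c by (simp_all add: y_def m_assoc[symmetric])
  have "(basis_elem c \<otimes>\<^bsub>TR\<^esub> a) z = a y * \<alpha> c y"
    unfolding y(2) by (rule basis_mult_left[OF a c y(1)])
  also have "\<dots> = (a \<otimes>\<^bsub>TR\<^esub> basis_elem c) z"
    unfolding y(2) comm[OF y(1)] sym[OF y(1)] by (rule basis_mult_right[OF a c y(1), symmetric])
  finally show "(basis_elem c \<otimes>\<^bsub>TR\<^esub> a) z = (a \<otimes>\<^bsub>TR\<^esub> basis_elem c) z" .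
qed

end

section \<open>Inflated cocycles on \<open>G \<times> C\<^sub>2\<^sup>n\<close>\<close>

lemma C2_pow_simps:
  "carrier (C2_pow n) = {1..n} \<rightarrow>\<^sub>E {0..<2}"
  "d \<otimes>\<^bsub>C2_pow n\<^esub> e = (\<lambda>k\<in>{1..n}. (d k + e k) mod 2)"
  "\<one>\<^bsub>C2_pow n\<^esub> = (\<lambda>k\<in>{1..n}. 0)"
  by (simp_all add: C2_pow_def carrier_integer_mod_group)

lemma C2_pow_group: "group (C2_pow n)"
  by (simp add: C2_pow_def)

lemma C2_pow_bit:
  assumes "e \<in> carrier (C2_pow n)" "k \<in> {1..n}"
  shows "e k = 0 \<or> e k = 1"
  using PiE_mem[OF assms(1)[unfolded C2_pow_simps] assms(2)] by auto

lemma C2_pow_comm: "d \<otimes>\<^bsub>C2_pow n\<^esub> e = e \<otimes>\<^bsub>C2_pow n\<^esub> d"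
  by (simp add: C2_pow_simps add.commute)

lemma C2_pow_sq:
  assumes "e \<in> carrier (C2_pow n)"
  shows "e \<otimes>\<^bsub>C2_pow n\<^esub> e = \<one>\<^bsub>C2_pow n\<^esub>"
  unfolding C2_pow_simps(2,3)
proof (rule restrict_ext)
  fix k assume "k \<in> {1..n}"
  then show "(e k + e k) mod 2 = 0"
    using C2_pow_bit[OF assms] by auto
qed

lemma C2_pow_inv:
  assumes "e \<in> carrier (C2_pow n)"
  shows "inv\<^bsub>C2_pow n\<^esub> e = e"
  using group.inv_equality[OF C2_pow_group C2_pow_sq[OF assms] assms assms] .

lemma C2_gen_closed: "C2_gen n i \<in> carrier (C2_pow n)"
  by (auto simp: C2_pow_simps C2_gen_def)

text \<open>A description by coordinates of the subgroup generated by the \<open>C2_gen n k\<close>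
  with \<open>k\<close> in \<open>S\<close>. It makes sense for arbitrary \<open>S\<close>, as the
  tower requires, and \<open>C2_sub_eq\<close> matches it with \<open>C2_sub\<close> on initial
  segments.\<close>

definition C2_support :: "nat \<Rightarrow> nat set \<Rightarrow> (nat \<Rightarrow> int) set" where
  "C2_support n S = {e \<in> carrier (C2_pow n). \<forall>k\<in>{1..n} - S. e k = 0}"

lemma C2_support_subgroup: "subgroup (C2_support n S) (C2_pow n)"
proof (rule group.subgroupI[OF C2_pow_group])
  have "\<one>\<^bsub>C2_pow n\<^esub> \<in> C2_support n S"
    using monoid.one_closed[OF group.is_monoid[OF C2_pow_group]]
    by (simp add: C2_support_def C2_pow_simps(3))
  then show "C2_support n S \<noteq> {}"
    by blast
  show "d \<otimes>\<^bsub>C2_pow n\<^esub> e \<in> C2_support n S" if "d \<in> C2_support n S" "e \<in> C2_support n S" for d e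
  proof -
    have "d \<otimes>\<^bsub>C2_pow n\<^esub> e \<in> carrier (C2_pow n)"
      using that by (intro monoid.m_closed[OF group.is_monoid[OF C2_pow_group]]) (auto simp: C2_support_def)
    then show ?thesis
      using that by (simp add: C2_support_def C2_pow_simps(2))
  qed
qed (auto simp: C2_support_def C2_pow_inv)

lemma C2_gen_support: "i \<in> {1..n} \<Longrightarrow> C2_gen n i \<in> C2_support n S \<longleftrightarrow> i \<in> S"
  using C2_gen_closed[of n i] by (auto simp: C2_support_def C2_gen_def)

lemma C2_support_mono: "S \<subseteq> T \<Longrightarrow> C2_support n S \<subseteq> C2_support n T"
  by (auto simp: C2_support_def)

lemma C2_gen_cancel:
  assumes "e \<in> carrier (C2_pow n)"
  shows "e \<otimes>\<^bsub>C2_pow n\<^esub> C2_gen n i \<otimes>\<^bsub>C2_pow n\<^esub> C2_gen n i = e"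
proof -
  interpret C: group "C2_pow n" by (rule C2_pow_group)
  show ?thesis
    using assms C2_gen_closed C2_pow_sq[OF C2_gen_closed] by (simp add: C.m_assoc del: mult_product_group)
qed

lemma C2_support_insert:
  assumes i: "i \<in> {1..n}" and e: "e \<in> C2_support n (insert i S)"
  shows "e \<in> C2_support n S \<or> e \<otimes>\<^bsub>C2_pow n\<^esub> C2_gen n i \<in> C2_support n S"
proof -
  have ec: "e \<in> carrier (C2_pow n)" "\<forall>k\<in>{1..n} - insert i S. e k = 0"
    using e by (auto simp: C2_support_def)
  have "e \<otimes>\<^bsub>C2_pow n\<^esub> C2_gen n i \<in> carrier (C2_pow n)"
    using ec C2_gen_closed by (intro monoid.m_closed[OF group.is_monoid[OF C2_pow_group]])
  moreover have "e i = 0 \<or> e i = 1"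
    by (rule C2_pow_bit[OF ec(1) i])
  ultimately show ?thesis
    using ec i by (auto simp: C2_support_def C2_pow_simps(2) C2_gen_def)
qed

lemma C2_sub_eq: "i \<le> n \<Longrightarrow> C2_sub n i = C2_support n {1..i}"
proof (rule equalityI)
  interpret C: group "C2_pow n" by (rule C2_pow_group)
  show "C2_sub n i \<subseteq> C2_support n {1..i}" if "i \<le> n"
    unfolding C2_sub_def using that C2_gen_support
    by (intro C.generate_subgroup_incl C2_support_subgroup) auto
  show "C2_support n {1..i} \<subseteq> C2_sub n i" if "i \<le> n"
    using that
  proof (induction i)
    case 0
    have "e = \<one>\<^bsub>C2_pow n\<^esub>" if "e \<in> C2_support n {1..0}" for e
    proof -
      have "e \<in> {1..n} \<rightarrow>\<^sub>E {0..<2}" "\<forall>k\<in>{1..n}. e k = 0"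
        using that by (auto simp: C2_support_def C2_pow_simps(1))
      then show ?thesis
        unfolding C2_pow_simps(3) by (intro extensionalityI[of _ "{1..n}"]) (auto simp: PiE_iff)
    qed
    then show ?case
      by (auto simp: C2_sub_def intro: generate.one)
  next
    case (Suc i)
    have sub: "subgroup (C2_sub n (Suc i)) (C2_pow n)"
      unfolding C2_sub_def using C2_gen_closed by (intro C.generate_is_subgroup) auto
    have gen: "C2_gen n (Suc i) \<in> C2_sub n (Suc i)"
      unfolding C2_sub_def by (intro generate.incl) auto
    have "C2_sub n i \<subseteq> C2_sub n (Suc i)"
      unfolding C2_sub_def by (intro C.mono_generate image_mono) auto
    then have IH: "C2_support n {1..i} \<subseteq> C2_sub n (Suc i)"
      using Suc by auto
    show ?case
    proof
      fix e assume e: "e \<in> C2_support n {1..Suc i}"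
      have "{1..Suc i} = insert (Suc i) {1..i}"
        by auto
      then have "e \<in> C2_sub n (Suc i) \<or> e \<otimes>\<^bsub>C2_pow n\<^esub> C2_gen n (Suc i) \<in> C2_sub n (Suc i)"
        using C2_support_insert[of "Suc i" n e "{1..i}"] e Suc.prems IH by auto
      moreover have "e \<otimes>\<^bsub>C2_pow n\<^esub> C2_gen n (Suc i) \<otimes>\<^bsub>C2_pow n\<^esub> C2_gen n (Suc i) = e"
        using e by (intro C2_gen_cancel) (simp add: C2_support_def)
      ultimately show "e \<in> C2_sub n (Suc i)"
        using subgroup.m_closed[OF sub _ gen] by metis
    qed
  qed
qed

locale inflated_twist = G: group G for G :: "('g, 'b) monoid_scheme" +
  fixes n :: nat and \<alpha> :: "'g cocycle"
  assumes finite_G: "finite (carrier G)"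
    and normalized: "normalized_cocycle (G \<times>\<times> C2_pow n) \<alpha>"
    and inflated: "class_inflated G (C2_pow n) \<alpha>"
begin

abbreviation GC where "GC \<equiv> G \<times>\<times> C2_pow n"

abbreviation gen where "gen i \<equiv> (\<one>\<^bsub>G\<^esub>, C2_gen n i)"

sublocale C: group "C2_pow n"
  by (rule C2_pow_group)

sublocale T: finite_twisted_group GC \<alpha>
proof (intro finite_twisted_group.intro finite_twisted_group_axioms.intro)
  show "group GC"
    by (intro DirProd_group G.is_group C.is_group)
  show "finite (carrier GC)"
    using finite_G by (simp add: C2_pow_simps(1) finite_PiE)
  show "normalized_cocycle GC \<alpha>"
    by (rule normalized)
qed

definition B :: "nat set \<Rightarrow> 'g elem set" where
  "B S = T.sub_TR (carrier G \<times> C2_support n S)"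

lemma gen_closed: "gen i \<in> carrier GC"
  using C2_gen_closed[of n i] by simp

lemma gen_sq: "gen i \<otimes>\<^bsub>GC\<^esub> gen i = \<one>\<^bsub>GC\<^esub>"
  using C2_pow_sq[OF C2_gen_closed[of n i]] by simp

lemma gen_comm: "g \<in> carrier GC \<Longrightarrow> gen i \<otimes>\<^bsub>GC\<^esub> g = g \<otimes>\<^bsub>GC\<^esub> gen i"
  by (auto simp: C2_pow_comm)

text \<open>\<alpha> differs from an inflated cocycle by the coboundary of \<open>f\<close>. By
  normalisation the inflated one is 1 as soon as one argument is \<open>gen i\<close>, and a
  coboundary is symmetric on commuting arguments; at \<open>(gen i, gen i)\<close> it is
  \<open>f (gen i)^2 / f 1 = 1\<close>.\<close>

lemma cocycle_gen:
  shows "g \<in> carrier GC \<Longrightarrow> \<alpha> (gen i) g = \<alpha> g (gen i)" and "\<alpha> (gen i) (gen i) = 1"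
proof -
  obtain \<beta> f where \<beta>: "normalized_cocycle G \<beta>"
    and f: "f \<in> carrier GC \<rightarrow> {1, -1}"
    and rel: "\<And>y z. y \<in> carrier GC \<Longrightarrow> z \<in> carrier GC \<Longrightarrow>
      \<alpha> y z * f (y \<otimes>\<^bsub>GC\<^esub> z) = inflation \<beta> y z * (f y * f z)"
    using inflated unfolding class_inflated_def cohomologous_def by blast
  have f_unit: "f z = 1 \<or> f z = -1" if "z \<in> carrier GC" for z
    using f that by blast
  have \<beta>1: "inflation \<beta> (gen i) z = 1" "inflation \<beta> z (gen i) = 1" if "z \<in> carrier GC" for z
    using \<beta> that by (auto simp: inflation_def normalized_cocycle_def)
  show "\<alpha> (gen i) g = \<alpha> g (gen i)" if g: "g \<in> carrier GC"
  proof -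
    have "\<alpha> (gen i) g * f (g \<otimes>\<^bsub>GC\<^esub> gen i) = \<alpha> g (gen i) * f (g \<otimes>\<^bsub>GC\<^esub> gen i)"
      using rel[OF gen_closed g, of i] rel[OF g gen_closed, of i] \<beta>1[OF g] gen_comm[OF g, of i]
      by (simp add: mult.commute)
    moreover have "f (g \<otimes>\<^bsub>GC\<^esub> gen i) \<noteq> 0"
      using f_unit[OF T.m_closed[OF g gen_closed[of i]]] by presburger
    ultimately show ?thesis by simp
  qed
  \<comment> \<open>The relation at the pair (1, 1), where both cocycles are 1; a sign equal to its
    own square is 1.\<close>
  have "f \<one>\<^bsub>GC\<^esub> = f \<one>\<^bsub>GC\<^esub> * f \<one>\<^bsub>GC\<^esub>"
    using rel[OF T.one_closed T.one_closed] \<beta> T.cocycle_one(1)[OF T.one_closed]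
    by (simp add: inflation_def normalized_cocycle_def del: one_DirProd) simp
  then have "f \<one>\<^bsub>GC\<^esub> = 1"
    using f_unit[OF T.one_closed] by auto
  moreover have "f (gen i) * f (gen i) = 1"
    using f_unit[OF gen_closed, of i] by auto
  ultimately show "\<alpha> (gen i) (gen i) = 1"
    using rel[OF gen_closed gen_closed, of i i] \<beta>1[OF gen_closed] gen_sq by simp
qed

lemma support_subgroup: "subgroup (carrier G \<times> C2_support n S) GC"
  by (intro DirProd_subgroups G.is_group C.is_group G.subgroup_self C2_support_subgroup)

lemma support_insert:
  assumes "i \<in> {1..n}"
  shows "carrier G \<times> C2_support n (insert i S)
    \<subseteq> carrier G \<times> C2_support n S \<union> (\<lambda>z. z \<otimes>\<^bsub>GC\<^esub> gen i) ` (carrier G \<times> C2_support n S)"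
proof
  fix z assume "z \<in> carrier G \<times> C2_support n (insert i S)"
  then obtain g e where z: "z = (g, e)" "g \<in> carrier G" "e \<in> C2_support n (insert i S)"
    by auto
  have e: "e \<in> carrier (C2_pow n)"
    using z(3) by (simp add: C2_support_def)
  define w where "w = (g, e \<otimes>\<^bsub>C2_pow n\<^esub> C2_gen n i)"
  have "z = w \<otimes>\<^bsub>GC\<^esub> gen i"
    using z(1,2) C2_gen_cancel[OF e] by (simp add: w_def)
  moreover have "z \<in> carrier G \<times> C2_support n S \<or> w \<in> carrier G \<times> C2_support n S"
    using C2_support_insert[OF assms z(3)] z(1,2) by (simp add: w_def)
  ultimately show "z \<in> carrier G \<times> C2_support n S \<union> (\<lambda>z. z \<otimes>\<^bsub>GC\<^esub> gen i) ` (carrier G \<times> C2_support n S)"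
    by (elim disjE) (simp, rule UnI2, rule image_eqI)
qed

section \<open>The twisted group ring as an involution tower\<close>

sublocale involution_tower "full_ring G n \<alpha>" n B "x_elem G n" "\<lambda>a. a \<one>\<^bsub>GC\<^esub>"
proof (intro involution_tower.intro involution_tower_axioms.intro)
  show "ring (full_ring G n \<alpha>)"
    unfolding full_ring_def by (rule T.TR_ring)
  show "subring (B S) (full_ring G n \<alpha>)" for S
    unfolding full_ring_def B_def by (intro T.sub_TR_subring support_subgroup)
  show "B S \<subseteq> B T" if "S \<subseteq> T" for S T
    using C2_support_mono[OF that] unfolding B_def T.sub_TR_def by blast
  show "B {1..n} = carrier (full_ring G n \<alpha>)"
    by (auto simp: B_def T.sub_TR_def full_ring_def T.TR_carrier C2_support_def)
  show "x_elem G n i \<in> B {i}" if "i \<in> {1..n}" for i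
    using T.basis_closed[OF gen_closed] C2_gen_support[OF that]
    by (simp add: B_def T.sub_TR_def x_elem_def)
  show "x_elem G n i \<otimes>\<^bsub>full_ring G n \<alpha>\<^esub> a = a \<otimes>\<^bsub>full_ring G n \<alpha>\<^esub> x_elem G n i"
    if "a \<in> carrier (full_ring G n \<alpha>)" for i a
    using that unfolding full_ring_def x_elem_def
    by (intro T.basis_central gen_closed gen_comm cocycle_gen)
  show "x_elem G n i \<otimes>\<^bsub>full_ring G n \<alpha>\<^esub> x_elem G n i = \<one>\<^bsub>full_ring G n \<alpha>\<^esub>" for i
    unfolding full_ring_def x_elem_def basis_elem_mult gen_sq cocycle_gen(2) T.TR_simps(2) by simp
  show "\<exists>u\<in>B S. \<exists>v\<in>B S. a = u \<oplus>\<^bsub>full_ring G n \<alpha>\<^esub> v \<otimes>\<^bsub>full_ring G n \<alpha>\<^esub> x_elem G n i"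
    if "i \<in> {1..n} - S" "a \<in> B (insert i S)" for S i a
    unfolding full_ring_def x_elem_def B_def
  proof (intro T.sub_TR_decompose support_subgroup gen_closed gen_sq)
    show "gen i \<notin> carrier G \<times> C2_support n S"
      using that C2_gen_support[of i n S] by auto
    show "a \<in> T.sub_TR (carrier G \<times> C2_support n S
        \<union> (\<lambda>z. z \<otimes>\<^bsub>GC\<^esub> gen i) ` (carrier G \<times> C2_support n S))"
      using that support_insert[of i S] unfolding B_def T.sub_TR_def by blast
  qed
  show "u = u' \<and> v = v'"
    if i: "i \<in> {1..n}" and uv: "u \<in> B ({1..n} - {i})" "v \<in> B ({1..n} - {i})"
      "u' \<in> B ({1..n} - {i})" "v' \<in> B ({1..n} - {i})"
      and eq: "u \<oplus>\<^bsub>full_ring G n \<alpha>\<^esub> v \<otimes>\<^bsub>full_ring G n \<alpha>\<^esub> x_elem G n i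
        = u' \<oplus>\<^bsub>full_ring G n \<alpha>\<^esub> v' \<otimes>\<^bsub>full_ring G n \<alpha>\<^esub> x_elem G n i" for i u v u' v'
  proof (rule T.sub_TR_direct[OF support_subgroup gen_closed _ gen_sq uv[unfolded B_def]])
    show "gen i \<notin> carrier G \<times> C2_support n ({1..n} - {i})"
      using C2_gen_support[OF i] by auto
  qed (use eq in \<open>simp only: full_ring_def x_elem_def\<close>)
  show "a = \<zero>\<^bsub>full_ring G n \<alpha>\<^esub>" if "a \<oplus>\<^bsub>full_ring G n \<alpha>\<^esub> a = \<zero>\<^bsub>full_ring G n \<alpha>\<^esub>" for a
    using that by (simp add: full_ring_def T.TR_simps fun_eq_iff)
  show "a = \<zero>\<^bsub>full_ring G n \<alpha>\<^esub>"
    if div: "\<And>k::nat. \<exists>b\<in>carrier (full_ring G n \<alpha>). a = add_pow (full_ring G n \<alpha>) ((2::nat) ^ k) b" for a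
  proof -
    have "a z = 0" for z
    proof (rule ccontr)
      assume nz: "a z \<noteq> 0"
      \<comment> \<open>Since \<open>2^k > k\<close>, this power of 2 exceeds the absolute value of
        the nonzero coefficient that it would have to divide.\<close>
      define k where "k = nat \<bar>a z\<bar>"
      obtain b where "a = add_pow (full_ring G n \<alpha>) ((2::nat) ^ k) b"
        using div by blast
      then have "a z = int (2 ^ k) * b z"
        by (simp only: full_ring_def T.TR_add_pow)
      then have "int (2 ^ k) \<le> \<bar>a z\<bar>"
        using nz by (intro zdvd_imp_le) simp_all
      moreover have "int k < int (2 ^ k)"
        by (simp only: of_nat_less_iff less_exp)
      ultimately show False
        by (simp add: k_def)
    qed
    then show ?thesis
      by (simp add: full_ring_def T.TR_simps fun_eq_iff)
  qed
  show "a = \<zero>\<^bsub>full_ring G n \<alpha>\<^esub> \<or> a = \<one>\<^bsub>full_ring G n \<alpha>\<^esub>"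
    if "a \<in> carrier (full_ring G n \<alpha>)" "a \<otimes>\<^bsub>full_ring G n \<alpha>\<^esub> a = a" for a
    using that unfolding full_ring_def by (rule T.trivial_idempotents)
  show "(a \<oplus>\<^bsub>full_ring G n \<alpha>\<^esub> b) \<one>\<^bsub>GC\<^esub> = a \<one>\<^bsub>GC\<^esub> + b \<one>\<^bsub>GC\<^esub>" for a b
    by (simp only: full_ring_def T.TR_simps)
  show "(a \<otimes>\<^bsub>full_ring G n \<alpha>\<^esub> b) \<one>\<^bsub>GC\<^esub> = (b \<otimes>\<^bsub>full_ring G n \<alpha>\<^esub> a) \<one>\<^bsub>GC\<^esub>"
    if "a \<in> carrier (full_ring G n \<alpha>)" "b \<in> carrier (full_ring G n \<alpha>)" for a b
    using that unfolding full_ring_def by (rule T.TR_trace_comm)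
  show "\<one>\<^bsub>full_ring G n \<alpha>\<^esub> \<one>\<^bsub>GC\<^esub> = 1"
    by (simp only: full_ring_def T.TR_simps basis_elem_apply simp_thms if_True)
qed

section \<open>Identification with the groups of the theorem\<close>

lemma sub_ring_eq: "i \<le> n \<Longrightarrow> sub_ring G n \<alpha> i = (full_ring G n \<alpha>)\<lparr>carrier := B {1..i}\<rparr>"
  by (simp add: sub_ring_def C2_sub_eq B_def T.sub_TR_def full_ring_def)

lemma Units_sub_ring: "i \<le> n \<Longrightarrow> Units (sub_ring G n \<alpha> i) = W {1..i}"
  by (simp add: sub_ring_eq W_def)

text \<open>\<open>eps\<close> decomposes over the preceding ring, \<open>spec\<close> over all
  other generators. A decomposition of the first kind is also one of the second, so its uniqueness
  is inherited.\<close>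

lemma eps_eq:
  assumes i: "i \<in> {1..n}" and a: "a \<in> B {1..i}"
  shows "eps G n \<alpha> i a = spec i \<one>\<^bsub>full_ring G n \<alpha>\<^esub> a"
proof -
  have sub: "{1..i - 1} \<subseteq> {1..n}" "i \<in> {1..n} - {1..i - 1}" "{1..i} = insert i {1..i - 1}" "i - 1 \<le> n"
    using i by auto
  have mono: "B {1..i - 1} \<subseteq> B ({1..n} - {i})"
    using i by (intro B_mono) auto
  obtain u v where uv: "u \<in> B {1..i - 1}" "v \<in> B {1..i - 1}"
    "a = u \<oplus>\<^bsub>full_ring G n \<alpha>\<^esub> v \<otimes>\<^bsub>full_ring G n \<alpha>\<^esub> x_elem G n i"
    using B_insert[OF sub(1,2), folded sub(3), OF a] by blast
  have carr: "carrier (sub_ring G n \<alpha> (i - 1)) = B {1..i - 1}"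
    by (simp add: sub_ring_eq[OF sub(4)])
  have "spec i \<one>\<^bsub>full_ring G n \<alpha>\<^esub> a = u \<oplus>\<^bsub>full_ring G n \<alpha>\<^esub> v"
    using uv mono spec_eq[OF i, of u v "\<one>\<^bsub>full_ring G n \<alpha>\<^esub>"] B_carrier[OF sub(1)] by auto
  moreover have "eps G n \<alpha> i a = u \<oplus>\<^bsub>full_ring G n \<alpha>\<^esub> v"
    unfolding eps_def carr
  proof (rule the_equality)
    fix w assume "\<exists>u\<in>B {1..i - 1}. \<exists>v\<in>B {1..i - 1}.
      a = u \<oplus>\<^bsub>full_ring G n \<alpha>\<^esub> v \<otimes>\<^bsub>full_ring G n \<alpha>\<^esub> x_elem G n i \<and> w = u \<oplus>\<^bsub>full_ring G n \<alpha>\<^esub> v"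
    then obtain u' v' where uv': "u' \<in> B {1..i - 1}" "v' \<in> B {1..i - 1}"
      "a = u' \<oplus>\<^bsub>full_ring G n \<alpha>\<^esub> v' \<otimes>\<^bsub>full_ring G n \<alpha>\<^esub> x_elem G n i" "w = u' \<oplus>\<^bsub>full_ring G n \<alpha>\<^esub> v'"
      by blast
    then have "u = u' \<and> v = v'"
      using uv mono by (intro B_direct[OF i]) auto
    then show "w = u \<oplus>\<^bsub>full_ring G n \<alpha>\<^esub> v"
      using uv'(4) by simp
  qed (use uv in blast)
  ultimately show ?thesis by simp
qed

lemma K_group_eq:
  assumes i: "i \<in> {1..n}"
  shows "K_group G n \<alpha> i = K i"
proof -
  have le: "i \<le> n" "i - 1 \<le> n"
    using i by auto
  have "\<one>\<^bsub>units_of (sub_ring G n \<alpha> (i - 1))\<^esub> = \<one>\<^bsub>full_ring G n \<alpha>\<^esub>"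
    by (simp add: units_of_def sub_ring_eq[OF le(2)])
  moreover have "carrier (units_of (sub_ring G n \<alpha> i)) = W {1..i}"
    by (simp add: units_of_def Units_sub_ring[OF le(1)])
  moreover have "eps G n \<alpha> i a = spec i \<one>\<^bsub>full_ring G n \<alpha>\<^esub> a" if "a \<in> W {1..i}" for a
    using that eps_eq[OF i] by (simp add: W_iff)
  ultimately show ?thesis
    unfolding K_group_def K_def kernel_def by auto
qed

lemma U_group_eq: "U_group G n \<alpha> k = U k"
  using Units_sub_ring[of 0] sub_ring_eq[of 0] by (simp add: U_group_def U_def)

lemma K_vec_eq:
  assumes "i \<in> {1..n}"
  shows "K_vec G n \<alpha> i j = L i 0 (Fac i j 0)"
proof -
  have "K_vec_factor G n \<alpha> i j = Fac i j 0"
    by (simp add: K_vec_factor_def Fac_def E_def Let_def One_nat_def)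
  then show ?thesis
    using assms Units_sub_ring[of i] sub_ring_eq[of 0] by (simp add: K_vec_def L_def)
qed

end

theorem theorem7p3:
  fixes G :: "('g, 'b) monoid_scheme" and n :: nat and \<alpha> :: "'g cocycle"
  assumes "group G" and "finite (carrier G)"
    and "normalized_cocycle (G \<times>\<times> C2_pow n) \<alpha>"
    and "class_inflated G (C2_pow n) \<alpha>"
  shows
    "(\<forall>i. 2 \<le> i \<and> i \<le> n \<longrightarrow>
        (\<exists>b. distinct (factor_list b) \<and> set (factor_list b) = ({1..i - 1} \<rightarrow>\<^sub>E {0, 1}) \<and>
             iterated_semidirect (unit_group G n \<alpha>)
               (map_bracketing (K_vec G n \<alpha> i) b) (K_group G n \<alpha> i)) \<and>
        (\<forall>j \<in> {1..i - 1} \<rightarrow>\<^sub>E {0, 1}.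
             subgroup_of (unit_group G n \<alpha>) (K_vec G n \<alpha> i j) \<cong>
             subgroup_of (unit_group G n \<alpha>) (U_group G n \<alpha> (1 + (\<Sum>t=1..i - 1. j t))))) \<and>
     iterated_semidirect (unit_group G n \<alpha>)
       (right_nested (map (K_group G n \<alpha>) (rev [1..<Suc n])) (Units (sub_ring G n \<alpha> 0)))
       (carrier (unit_group G n \<alpha>)) \<and>
     (\<exists>N D.
        (\<forall>i \<in> {1..n}.
           N i \<lhd> subgroup_of (unit_group G n \<alpha>) (K_group G n \<alpha> i) \<and>
           torsion_free (unit_group G n \<alpha>) (N i) \<and>
           subgroup_of (unit_group G n \<alpha>) (K_group G n \<alpha> i) \<cong>
             subgroup_of (unit_group G n \<alpha>) (N i) \<times>\<times>
             subgroup_of (unit_group G n \<alpha>) (generate (unit_group G n \<alpha>) {x_elem G n i})) \<and>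
        internal_direct (unit_group G n \<alpha>)
          (Units (sub_ring G n \<alpha> 0))
          (generate (unit_group G n \<alpha>) (x_elem G n ` {1..n})) D \<and>
        iterated_semidirect (unit_group G n \<alpha>)
          (left_nested (map N (rev [1..<Suc n])) D)
          (carrier (unit_group G n \<alpha>)))"
proof -
  interpret inflated_twist G n \<alpha>
    using assms by (intro inflated_twist.intro inflated_twist_axioms.intro)
  have M_eq: "unit_group G n \<alpha> = M"
    by (simp add: unit_group_def)
  have W0: "Units (sub_ring G n \<alpha> 0) = W {1..0}"
    using Units_sub_ring[of 0] by simp
  have carr: "carrier M = W {1..n}" "carrier M = D n"
    using W_full D_full by simp_all
  have part1: "\<exists>b. distinct (factor_list b) \<and> set (factor_list b) = ({1..i - 1} \<rightarrow>\<^sub>E {0, 1}) \<and>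
      iterated_semidirect M (map_bracketing (K_vec G n \<alpha> i) b) (K_group G n \<alpha> i)"
    if "2 \<le> i" "i \<le> n" for i
  proof -
    have i: "i \<in> {1..n}"
      using that by auto
    have "K_vec G n \<alpha> i = (\<lambda>j. L i 0 (Fac i j 0))"
      using K_vec_eq[OF i] by blast
    then show ?thesis
      using K_bracketing[OF i] K_group_eq[OF i] by simp
  qed
  have part2: "M\<lparr>carrier := K_vec G n \<alpha> i j\<rparr> \<cong> M\<lparr>carrier := U_group G n \<alpha> (1 + (\<Sum>t=1..i - 1. j t))\<rparr>"
    if "2 \<le> i" "i \<le> n" "j \<in> {1..i - 1} \<rightarrow>\<^sub>E {0, 1}" for i j
  proof -
    have i: "i \<in> {1..n}"
      using that by auto
    show ?thesis
      unfolding K_vec_eq[OF i] U_group_eq by (rule K_vec_iso_U[OF i that(3)])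
  qed
  have K_list: "map (K_group G n \<alpha>) (rev [1..<Suc n]) = map K (rev [1..<Suc n])"
    by (intro map_cong refl K_group_eq) auto
  have part3: "iterated_semidirect M
      (right_nested (map (K_group G n \<alpha>) (rev [1..<Suc n])) (W {1..0})) (W {1..n})"
    unfolding K_list
    by (rule group.iterated_semidirect_right_nested[OF M_group, where W = "\<lambda>i. W {1..i}"])
      (auto intro: K_semidirect W_subgroup)
  have part4: "iterated_semidirect M (left_nested (map N (rev [1..<Suc n])) (D 0)) (D n)"
    using D_semidirect D_subgroup[of 0] by (intro group.iterated_semidirect_left_nested[OF M_group]) auto
  have part5: "N i \<lhd> M\<lparr>carrier := K_group G n \<alpha> i\<rparr> \<and> torsion_free M (N i) \<and>
      M\<lparr>carrier := K_group G n \<alpha> i\<rparr> \<cong> M\<lparr>carrier := N i\<rparr> \<times>\<times> M\<lparr>carrier := generate M {x_elem G n i}\<rparr>"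
    if "i \<in> {1..n}" for i
    unfolding K_group_eq[OF that] using N_normal_K[OF that] N_torsion_free[OF that] K_iso[OF that] by blast
  have part6: "internal_direct M (W {1..0}) (generate M (x_elem G n ` {1..n})) (D 0)"
    using D_0_direct by (simp add: Z_def)
  show ?thesis
    unfolding M_eq W0
  proof (intro conjI exI[of _ N] exI[of _ "D 0"] allI impI ballI)
  qed (use part1 part2 part3 part4 part5 part6 carr in auto)
qed

end
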